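(* Let $\alpha\in\overline{\mathbb{Q}}\setminus\mu_\infty$ be a non-zero algebraic integer of degree $d$. Then $$h(\alpha)\ \geq\ \frac12\sum_{p}\max\left\{0,\ \frac{1}{\sum_{K\in\mathcal{Q}_{p,\alpha}} e_K\,q_K}-\frac{1}{d^2}\sum_{K\in\mathcal{Q}_{p,\alpha}}\frac{|\mathcal{S}_K(\alpha)|}{e_K}\right\}\log p\ -\ \frac{\log d}{2d},$$ where the outer sum runs over all rational primes $p$.
   Context: $\overline{\mathbb{Q}}$ is the algebraic closure of $\mathbb{Q}$ in $\mathbb{C}$, $\mu_\infty$ is the set of roots of unity in $\overline{\mathbb{Q}}$, and for each prime $p$ an embedding $i_p:\overline{\mathbb{Q}}\hookrightarrow\overline{\mathbb{Q}_p}$ is fixed. Let $\alpha_1,\dots,\alpha_d$ be the Galois conjugates of $\alpha$. $h(\alpha)=\frac{1}{d}\log\big(|a_d|\prod_i\max(1,|\alpha_i|)\big)$ is the absolute logarithmic Weil height, where $a_d$ is the leading coefficient of the primitive minimal polynomial of $\alpha$ in $\mathbb{Z}[x]$. For a prime $p$, $\mathcal{Q}_{p,\alpha}=\{\mathbb{Q}_p(i_p(\alpha_i)) : 1\le i\le d\}$ is the set of distinct finite extensions of $\mathbb{Q}_p$ generated by the conjugates of $\alpha$. For $K\in\mathcal{Q}_{p,\alpha}$, $e_K$ is its ramification index, $\mathbb{F}_{q_K}$ its residue field, and $\mathcal{S}_K(\alpha)=\{\alpha_i : i_p(\alpha_i)\in K\}$ the set of conjugates of $\alpha$ lying in $K$.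 *)

theory Defs
  imports
    "HOL-Algebra.Algebraic_Closure_Type"
    "HOL-Algebra.Generated_Fields"
    "HOL-Algebra.Ideal_Product"
    "HOL-Analysis.Analysis"
begin

text \<open>HOL-Algebra and the polynomial library share several constant names; qualified names are
  used wherever they clash.\<close>


section \<open>Algebraic numbers\<close>

definition Qbar :: "complex ring" where
  "Qbar = (ring_of_type_algebra :: complex ring)\<lparr>carrier := {z. algebraic z}\<rparr>"

text \<open>The primitive minimal polynomial in \<open>\<int>[x]\<close>; its sign, which is otherwise free, is fixed
  by a positive leading coefficient.\<close>

definition min_int_poly :: "complex \<Rightarrow> int poly" where
  "min_int_poly \<alpha> = (THE f. Polynomial.content f = 1 \<and> Polynomial.lead_coeff f > 0 \<and>
     poly (map_poly of_int f) \<alpha> = 0 \<and>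
     (\<forall>g. g \<noteq> 0 \<and> poly (map_poly of_int g) \<alpha> = 0 \<longrightarrow> Polynomial.degree f \<le> Polynomial.degree g))"

definition alg_degree :: "complex \<Rightarrow> nat" where
  "alg_degree \<alpha> = Polynomial.degree (min_int_poly \<alpha>)"

text \<open>The minimal polynomial is separable, so a set of roots loses no multiplicities.\<close>

definition conjugates :: "complex \<Rightarrow> complex set" where
  "conjugates \<alpha> = {z. poly (map_poly of_int (min_int_poly \<alpha>)) z = 0}"

definition weil_height :: "complex \<Rightarrow> real" where
  "weil_height \<alpha> = 1 / real (alg_degree \<alpha>) *
     ln (\<bar>real_of_int (Polynomial.lead_coeff (min_int_poly \<alpha>))\<bar> * (\<Prod>z\<in>conjugates \<alpha>. max 1 (norm z)))"

definition roots_of_unity :: "complex set" where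
  "roots_of_unity = {z. \<exists>n>0. z ^ n = 1}"


section \<open>The field of \<open>p\<close>-adic numbers\<close>

definition padic_val_rat :: "nat \<Rightarrow> rat \<Rightarrow> int" where
  "padic_val_rat p x = (case quotient_of x of (a, b) \<Rightarrow>
     int (multiplicity (int p) a) - int (multiplicity (int p) b))"

definition padic_abs_rat :: "nat \<Rightarrow> rat \<Rightarrow> real" where
  "padic_abs_rat p x = (if x = 0 then 0 else real p powi (- padic_val_rat p x))"

definition padic_Cauchy :: "nat \<Rightarrow> (nat \<Rightarrow> rat) \<Rightarrow> bool" where
  "padic_Cauchy p x \<longleftrightarrow> (\<forall>\<epsilon>>0. \<exists>N. \<forall>m\<ge>N. \<forall>n\<ge>N. padic_abs_rat p (x m - x n) < \<epsilon>)"

definition padic_Cauchy_ring :: "nat \<Rightarrow> (nat \<Rightarrow> rat) ring" where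
  "padic_Cauchy_ring p = \<lparr>carrier = {x. padic_Cauchy p x},
     monoid.mult = (\<lambda>x y n. x n * y n), one = (\<lambda>n. 1),
     ring.zero = (\<lambda>n. 0), add = (\<lambda>x y n. x n + y n)\<rparr>"

definition padic_null :: "nat \<Rightarrow> (nat \<Rightarrow> rat) set" where
  "padic_null p = {x. (\<lambda>n. padic_abs_rat p (x n)) \<longlonglongrightarrow> 0}"

text \<open>\<open>\<rat>\<^sub>p\<close> is the completion of \<open>\<rat>\<close> with respect to the \<open>p\<close>-adic absolute value.\<close>

definition Qp :: "nat \<Rightarrow> (nat \<Rightarrow> rat) set ring" where
  "Qp p = padic_Cauchy_ring p Quot padic_null p"

definition padic_abs :: "nat \<Rightarrow> (nat \<Rightarrow> rat) set \<Rightarrow> real" where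
  "padic_abs p A = (THE r. \<forall>x\<in>A. (\<lambda>n. padic_abs_rat p (x n)) \<longlonglongrightarrow> r)"

definition Zp :: "nat \<Rightarrow> (nat \<Rightarrow> rat) set set" where
  "Zp p = {A \<in> carrier (Qp p). padic_abs p A \<le> 1}"


section \<open>Finite extensions inside an algebraic closure of \<open>\<rat>\<^sub>p\<close>\<close>

text \<open>The type of elements of the algebraic closure of \<open>Qp p\<close> provided by HOL-Algebra. The type
  does not depend on \<open>p\<close>; the carrier and the operations do.\<close>

type_synonym padic_closure = "(((nat \<Rightarrow> rat) set list \<times> nat) multiset) \<Rightarrow> (nat \<Rightarrow> rat) set"

definition Qp_bar :: "nat \<Rightarrow> padic_closure ring" where
  "Qp_bar p = field.alg_closure (Qp p)"

definition Qp_incl :: "nat \<Rightarrow> (nat \<Rightarrow> rat) set \<Rightarrow> padic_closure" where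
  "Qp_incl p = ring.indexed_const (Qp p)"

definition Qp_adjoin :: "nat \<Rightarrow> padic_closure \<Rightarrow> padic_closure set" where
  "Qp_adjoin p x = generate_field (Qp_bar p) (insert x (Qp_incl p ` carrier (Qp p)))"

text \<open>The valuation ring of \<open>K\<close> is the integral closure of \<open>\<int>\<^sub>p\<close> in \<open>K\<close>. HOL-Algebra polynomials
  are coefficient lists with the leading coefficient first, and \<open>[]\<close> is the zero polynomial.\<close>

definition integer_ring :: "nat \<Rightarrow> padic_closure set \<Rightarrow> padic_closure ring" where
  "integer_ring p K = (Qp_bar p)\<lparr>carrier := {x \<in> K.
     \<exists>f \<in> carrier ((Qp_incl p ` Zp p)[X]\<^bsub>Qp_bar p\<^esub>).
       f \<noteq> [] \<and> Polynomials.lead_coeff f = \<one>\<^bsub>Qp_bar p\<^esub> \<and> ring.eval (Qp_bar p) f x = \<zero>\<^bsub>Qp_bar p\<^esub>}\<rparr>"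

definition max_ideal :: "nat \<Rightarrow> padic_closure set \<Rightarrow> padic_closure set" where
  "max_ideal p K = (THE M. maximalideal M (integer_ring p K))"

definition residue_field :: "nat \<Rightarrow> padic_closure set \<Rightarrow> padic_closure set ring" where
  "residue_field p K = integer_ring p K Quot max_ideal p K"

definition residue_card :: "nat \<Rightarrow> padic_closure set \<Rightarrow> nat" where
  "residue_card p K = card (carrier (residue_field p K))"

text \<open>The ramification index \<open>e\<close>: the principal ideal generated by \<open>p\<close> is the \<open>e\<close>-th power of the
  maximal ideal.\<close>

definition ram_index :: "nat \<Rightarrow> padic_closure set \<Rightarrow> nat" where
  "ram_index p K = (THE e. PIdl\<^bsub>integer_ring p K\<^esub> ([p] \<cdot>\<^bsub>integer_ring p K\<^esub> \<one>\<^bsub>integer_ring p K\<^esub>) =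
     max_ideal p K [^]\<^bsub>ideals_set (integer_ring p K)\<^esub> e)"


section \<open>Local data attached to the conjugates of an algebraic number\<close>

text \<open>\<open>j\<close> stands for an embedding of \<open>Qbar\<close> into \<open>Qp_bar p\<close>, i.e. an element of
  \<open>ring_hom Qbar (Qp_bar p)\<close>, which is automatically injective.\<close>

definition conj_fields :: "nat \<Rightarrow> (complex \<Rightarrow> padic_closure) \<Rightarrow> complex \<Rightarrow> padic_closure set set" where
  "conj_fields p j \<alpha> = (\<lambda>z. Qp_adjoin p (j z)) ` conjugates \<alpha>"

definition conj_in :: "(complex \<Rightarrow> padic_closure) \<Rightarrow> complex \<Rightarrow> padic_closure set \<Rightarrow> complex set" where
  "conj_in j \<alpha> K = {z \<in> conjugates \<alpha>. j z \<in> K}"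

end

theory Submission
  imports Defs "Jordan_Normal_Form.Determinant"
begin

text \<open>
  Let \<open>D\<close> be the discriminant of the minimal polynomial, a nonzero integer. Hadamard's inequality
  for the Vandermonde matrix of the conjugates gives \<open>ln \<bar>D\<bar> \<le> d ln d + 2 d\<^sup>2 h(\<alpha>)\<close>.
  Conversely \<open>D\<close> has many prime factors \<open>p\<close>: sort the conjugates by the field
  \<open>K = \<rat>\<^sub>p(i\<^sub>p(\<alpha>\<^sub>i))\<close> and, within \<open>K\<close>, by their residue class. There are
  \<open>\<Sum>\<^sub>K q\<^sub>K\<close> boxes, the difference of two conjugates in a box of \<open>K\<close> has valuation
  at least \<open>1/e\<^sub>K\<close>, and the Cauchy-Schwarz inequality with weights \<open>e\<^sub>K\<close> bounds
  the valuation of \<open>D\<close> from below by \<open>d\<^sup>2 / \<Sum>\<^sub>K e\<^sub>K q\<^sub>K - \<Sum>\<^sub>K \<bar>S\<^sub>K\<bar> / e\<^sub>K\<close>.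

  No valuation on the algebraic closure is needed: \<open>x \<in> \<pp>\<^sub>K\<close> is used in the form
  \<open>x\<^sup>e \<in> p O\<^sub>K\<close> with \<open>e = e\<^sub>K\<close>, and divisibility is read off from \<open>1/p\<close>
  not being integral.
\<close>

text \<open>The closure \<open>Qp_bar p\<close> is a record with a carrier, whereas polynomials,
  sums and products are wanted in a field type. The local argument therefore runs in a field type
  with a bijection \<open>\<rho>\<close> onto that carrier, and Z_p becomes a set \<open>Z\<close>
  described by the axioms of \<open>padic_integers\<close>. Two facts about the ring of integers of
  K carry the local theory: it is a valuation ring, because x or 1/x is integral for every x, and
  its quotient by p is finite. They yield the unique maximal ideal, a generator of it, the exponent
  e_K and the finite residue field, and so evaluate the definite descriptions in the definitions. As
  1/e_K is a fraction, differences of conjugates are raised to a common power, the product of the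
  e_K, before divisibility by p is counted. Cauchy-Schwarz counts ordered pairs including z = w; the
  subtracted sum of |S_K| / e_K pays for this diagonal, since each conjugate is counted there at
  least for its own field. Dividing the upper bound for ln |D| by d^2 leaves ln d / d + 2 h, whence
  the factor 1/2 and the term ln d / (2 d).\<close>

hide_const (open) Ring_Hom.ring_hom \<comment> \<open>it shadows the \<open>ring_hom\<close> of HOL-Algebra\<close>

section \<open>Rings of integers over a complete discrete valuation ring\<close>

text \<open>Instantiated for the p-adic integers and again, as \<open>Q\<close>, for their fraction
  field, so that \<open>Zspan\<close> serves for lattices and for vector spaces alike.\<close>

locale field_subring =
  fixes Z :: "'a::field set"
  assumes Z_0: "0 \<in> Z" and Z_1: "1 \<in> Z"
    and Z_add: "a \<in> Z \<Longrightarrow> b \<in> Z \<Longrightarrow> a + b \<in> Z"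
    and Z_mult: "a \<in> Z \<Longrightarrow> b \<in> Z \<Longrightarrow> a * b \<in> Z"
    and Z_uminus: "a \<in> Z \<Longrightarrow> - a \<in> Z"
begin

lemma Z_diff: "a \<in> Z \<Longrightarrow> b \<in> Z \<Longrightarrow> a - b \<in> Z"
  using Z_add[of a "- b"] Z_uminus[of b] by simp

lemma Z_of_nat: "of_nat n \<in> Z"
  by (induction n) (auto intro: Z_0 Z_1 Z_add)

lemma Z_of_int: "of_int n \<in> Z"
  by (cases n) (auto simp: Z_of_nat intro!: Z_uminus Z_diff Z_1 simp flip: of_nat_Suc)

lemma Z_power: "a \<in> Z \<Longrightarrow> a ^ n \<in> Z"
  by (induction n) (auto intro: Z_1 Z_mult)

lemma Z_sum: "(\<And>i. i \<in> A \<Longrightarrow> f i \<in> Z) \<Longrightarrow> sum f A \<in> Z"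
  by (induction A rule: infinite_finite_induct) (auto intro: Z_0 Z_add)

definition Zmodule :: "'a set \<Rightarrow> bool" where
  "Zmodule M \<longleftrightarrow> 0 \<in> M \<and> (\<forall>a\<in>M. \<forall>b\<in>M. a + b \<in> M) \<and> (\<forall>c\<in>Z. \<forall>a\<in>M. c * a \<in> M)"

lemma ZmoduleD:
  assumes "Zmodule M"
  shows "0 \<in> M" "a \<in> M \<Longrightarrow> b \<in> M \<Longrightarrow> a + b \<in> M" "c \<in> Z \<Longrightarrow> a \<in> M \<Longrightarrow> c * a \<in> M"
    "a \<in> M \<Longrightarrow> - a \<in> M" "a \<in> M \<Longrightarrow> b \<in> M \<Longrightarrow> a - b \<in> M"
proof -
  show *: "0 \<in> M" "a \<in> M \<Longrightarrow> b \<in> M \<Longrightarrow> a + b \<in> M" "c \<in> Z \<Longrightarrow> a \<in> M \<Longrightarrow> c * a \<in> M" for a b c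
    using assms by (auto simp: Zmodule_def)
  show **: "- a \<in> M" if "a \<in> M" for a
    using *(3)[of "-1" a] that by (simp add: Z_1 Z_uminus)
  show "a \<in> M \<Longrightarrow> b \<in> M \<Longrightarrow> a - b \<in> M"
    using *(2)[of a "- b"] ** by simp
qed

lemma Zmodule_sum:
  assumes "Zmodule M" "\<And>i. i \<in> A \<Longrightarrow> f i \<in> M"
  shows "sum f A \<in> M"
  using assms(2) by (induction A rule: infinite_finite_induct) (auto intro: ZmoduleD[OF assms(1)])

text \<open>Recursion over a list of generators lets \<open>Zspan_eq_zero\<close> and
  \<open>finite_mod_p\<close> peel off one generator at a time; the generators may be
  dependent.\<close>

primrec Zspan :: "'a list \<Rightarrow> 'a set" where
  "Zspan [] = {0}"
| "Zspan (m # ms) = {c * m + v | c v. c \<in> Z \<and> v \<in> Zspan ms}"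

lemma Zspan_ConsI: "c \<in> Z \<Longrightarrow> v \<in> Zspan ms \<Longrightarrow> c * m + v \<in> Zspan (m # ms)"
  by auto

lemma Zmodule_Zspan: "Zmodule (Zspan ms)"
proof (induction ms)
  case Nil
  show ?case by (simp add: Zmodule_def)
next
  case (Cons m ms)
  show ?case unfolding Zmodule_def
  proof (intro conjI ballI)
    show "0 \<in> Zspan (m # ms)"
      using Z_0 ZmoduleD(1)[OF Cons] by force
  next
    fix a b assume ab: "a \<in> Zspan (m # ms)" "b \<in> Zspan (m # ms)"
    then obtain c v d w where "a = c * m + v" "c \<in> Z" "v \<in> Zspan ms" "b = d * m + w" "d \<in> Z" "w \<in> Zspan ms"
      by auto
    then have "a + b = (c + d) * m + (v + w)" "c + d \<in> Z" "v + w \<in> Zspan ms"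
      by (auto intro: Z_add ZmoduleD(2)[OF Cons] simp: algebra_simps)
    then show "a + b \<in> Zspan (m # ms)" using Zspan_ConsI by metis
  next
    fix a b assume ab: "b \<in> Z" "a \<in> Zspan (m # ms)"
    then obtain c v where "a = c * m + v" "c \<in> Z" "v \<in> Zspan ms"
      by auto
    with ab have "b * a = (b * c) * m + b * v" "b * c \<in> Z" "b * v \<in> Zspan ms"
      by (auto intro: Z_mult ZmoduleD(3)[OF Cons] simp: algebra_simps)
    then show "b * a \<in> Zspan (m # ms)" using Zspan_ConsI by metis
  qed
qed

lemma Zspan_mono: "v \<in> Zspan ms \<Longrightarrow> v \<in> Zspan (m # ms)"
  using Zspan_ConsI[OF Z_0, of v ms m] by simp

lemma Zspan_generator: "m \<in> set ms \<Longrightarrow> m \<in> Zspan ms"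
proof (induction ms)
  case (Cons a ms)
  show ?case
  proof (cases "m = a")
    case True
    then show ?thesis
      using Zspan_ConsI[OF Z_1 ZmoduleD(1)[OF Zmodule_Zspan], of m ms] by simp
  next
    case False
    with Cons show ?thesis by (intro Zspan_mono) auto
  qed
qed auto

lemma Zspan_least:
  assumes "Zmodule M" "set ms \<subseteq> M"
  shows "Zspan ms \<subseteq> M"
  using assms(2) by (induction ms) (auto intro: ZmoduleD[OF assms(1)] intro!: ZmoduleD(2)[OF assms(1)])

end

text \<open>An axiomatic Z_p inside a field that is algebraic over its fraction field.
  \<open>unit_or_multiple\<close> makes p Z the maximal ideal, \<open>residues\<close> bounds the
  residue field by p elements, and \<open>separated\<close> with \<open>complete\<close> express
  p-adic completeness for sequences whose k-th step lies in p^k Z.\<close>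

locale padic_integers = field_subring Z for Z :: "'a::field set" +
  fixes p :: nat
  assumes p_nonzero: "of_nat p \<noteq> (0 :: 'a)"
    and p_not_unit: "inverse (of_nat p) \<notin> Z"
    and residues: "a \<in> Z \<Longrightarrow> \<exists>c<p. \<exists>b\<in>Z. a = of_nat c + of_nat p * b"
    and unit_or_multiple: "a \<in> Z \<Longrightarrow> inverse a \<in> Z \<or> (\<exists>b\<in>Z. a = of_nat p * b)"
    and separated: "(\<And>k. \<exists>b\<in>Z. a = of_nat p ^ k * b) \<Longrightarrow> a = 0"
    and complete: "(\<And>k. u k \<in> Z) \<Longrightarrow> (\<And>k. \<exists>b\<in>Z. u (Suc k) - u k = of_nat p ^ k * b) \<Longrightarrow>
      \<exists>a\<in>Z. \<forall>k. \<exists>b\<in>Z. a - u k = of_nat p ^ k * b"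
    and algebraic_over: "\<exists>f. f \<noteq> 0 \<and> (\<forall>i. coeff f i \<in> Z) \<and> poly f x = 0"
begin

abbreviation \<pi> :: 'a where "\<pi> \<equiv> of_nat p"

text \<open>\<open>separated\<close> forbids infinite divisibility by \<open>\<pi>\<close>; behind
  the largest power the cofactor is no multiple of \<open>\<pi>\<close>, so
  \<open>unit_or_multiple\<close> makes it a unit.\<close>

lemma Z_factor:
  assumes "a \<in> Z" "a \<noteq> 0"
  obtains k u where "a = \<pi> ^ k * u" "u \<in> Z" "inverse u \<in> Z"
proof -
  obtain k where k: "\<not> (\<exists>b\<in>Z. a = \<pi> ^ k * b)"
    using separated[of a] assms(2) by blast
  define m where "m = (LEAST k. \<not> (\<exists>b\<in>Z. a = \<pi> ^ k * b))"
  have m: "\<not> (\<exists>b\<in>Z. a = \<pi> ^ m * b)"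
    unfolding m_def by (rule LeastI) (rule k)
  have "m \<noteq> 0"
    using m assms(1) by (metis mult_1 power_0)
  then obtain l where l: "m = Suc l" by (cases m) auto
  have "\<exists>b\<in>Z. a = \<pi> ^ l * b"
    using not_less_Least[of l "\<lambda>k. \<not> (\<exists>b\<in>Z. a = \<pi> ^ k * b)"] l m_def by auto
  then obtain b where b: "b \<in> Z" "a = \<pi> ^ l * b" by blast
  have "\<not> (\<exists>c\<in>Z. b = \<pi> * c)"
    using m b l by (auto simp: mult_ac)
  with unit_or_multiple b(1) have "inverse b \<in> Z" by blast
  with b show ?thesis using that by blast
qed

lemma one_minus_unit:
  assumes "a \<in> Z"
  shows "inverse (1 - \<pi> * a) \<in> Z" "1 - \<pi> * a \<noteq> 0"
proof -
  have no: False if "b \<in> Z" "1 - \<pi> * a = \<pi> * b" for b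
  proof -
    have "1 = \<pi> * (a + b)" using that by (simp add: algebra_simps)
    then have "inverse \<pi> = a + b" by (metis inverse_unique)
    then show False using p_not_unit that assms by (metis Z_add)
  qed
  show "1 - \<pi> * a \<noteq> 0" using no[of 0] Z_0 by auto
  have "1 - \<pi> * a \<in> Z" by (intro Z_diff Z_mult Z_1 Z_of_nat assms)
  then show "inverse (1 - \<pi> * a) \<in> Z" using unit_or_multiple no by blast
qed

section \<open>Polynomials over \<open>Z\<close> and the ring generated by one element\<close>

definition Zpoly :: "'a poly set" where "Zpoly = {f. \<forall>i. coeff f i \<in> Z}"

lemma Zpoly_coeff: "f \<in> Zpoly \<Longrightarrow> coeff f i \<in> Z"
  by (simp add: Zpoly_def)

lemma Zpoly_0: "0 \<in> Zpoly" by (simp add: Zpoly_def Z_0)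
lemma Zpoly_1: "1 \<in> Zpoly" by (simp add: Zpoly_def Z_0 Z_1)
lemma Zpoly_add: "f \<in> Zpoly \<Longrightarrow> g \<in> Zpoly \<Longrightarrow> f + g \<in> Zpoly" by (simp add: Zpoly_def Z_add)
lemma Zpoly_diff: "f \<in> Zpoly \<Longrightarrow> g \<in> Zpoly \<Longrightarrow> f - g \<in> Zpoly" by (simp add: Zpoly_def Z_diff)
lemma Zpoly_smult: "c \<in> Z \<Longrightarrow> f \<in> Zpoly \<Longrightarrow> smult c f \<in> Zpoly" by (simp add: Zpoly_def Z_mult)
lemma Zpoly_mult: "f \<in> Zpoly \<Longrightarrow> g \<in> Zpoly \<Longrightarrow> f * g \<in> Zpoly"
  by (auto simp: Zpoly_def coeff_mult intro!: Z_sum Z_mult)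
lemma Zpoly_monom: "c \<in> Z \<Longrightarrow> monom c n \<in> Zpoly"
  by (simp add: Zpoly_def Z_0)
lemma Zpoly_sum: "(\<And>i. i \<in> A \<Longrightarrow> f i \<in> Zpoly) \<Longrightarrow> sum f A \<in> Zpoly"
  by (induction A rule: infinite_finite_induct) (auto intro: Zpoly_0 Zpoly_add)
lemma Zpoly_pCons: "pCons a f \<in> Zpoly \<longleftrightarrow> a \<in> Z \<and> f \<in> Zpoly"
  by (auto simp: Zpoly_def coeff_pCons split: nat.splits)

definition adjoin :: "'a \<Rightarrow> 'a set" where "adjoin x = (\<lambda>f. poly f x) ` Zpoly"

lemma adjoin_add: "a \<in> adjoin x \<Longrightarrow> b \<in> adjoin x \<Longrightarrow> a + b \<in> adjoin x"
  by (auto simp: adjoin_def simp flip: poly_add intro!: imageI Zpoly_add)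
lemma adjoin_diff: "a \<in> adjoin x \<Longrightarrow> b \<in> adjoin x \<Longrightarrow> a - b \<in> adjoin x"
  by (auto simp: adjoin_def simp flip: poly_diff intro!: imageI Zpoly_diff)
lemma adjoin_mult: "a \<in> adjoin x \<Longrightarrow> b \<in> adjoin x \<Longrightarrow> a * b \<in> adjoin x"
  by (auto simp: adjoin_def simp flip: poly_mult intro!: imageI Zpoly_mult)
lemma adjoin_Z: "a \<in> Z \<Longrightarrow> a \<in> adjoin x"
  unfolding adjoin_def by (rule image_eqI[of _ _ "[:a:]"]) (auto simp: Zpoly_pCons Zpoly_0)
lemma adjoin_self: "x \<in> adjoin x"
  unfolding adjoin_def by (rule image_eqI[of _ _ "[:0, 1:]"]) (auto simp: Zpoly_pCons Zpoly_0 Z_0 Z_1)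
lemma adjoin_power: "a \<in> adjoin x \<Longrightarrow> a ^ n \<in> adjoin x"
  by (induction n) (auto intro: adjoin_mult adjoin_Z Z_1)
lemma adjoin_sum: "(\<And>i. i \<in> A \<Longrightarrow> f i \<in> adjoin x) \<Longrightarrow> sum f A \<in> adjoin x"
  by (induction A rule: infinite_finite_induct) (auto intro: adjoin_Z Z_0 adjoin_add)

lemma poly_closed:
  assumes "f \<in> Zpoly" "x \<in> B" "Z \<subseteq> B"
    and "\<And>a b. a \<in> B \<Longrightarrow> b \<in> B \<Longrightarrow> a + b \<in> B" "\<And>a b. a \<in> B \<Longrightarrow> b \<in> B \<Longrightarrow> a * b \<in> B"
  shows "poly f x \<in> B"
  using assms(1) by (induction f) (use assms Z_0 in \<open>auto simp: Zpoly_pCons\<close>)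

text \<open>Cancelling powers of the variable from an annihilating polynomial leaves a nonzero
  constant term. In this shape \<open>x\<close> divides a nonzero constant inside
  \<open>adjoin x\<close>, which serves to carry divisibility from \<open>x\<close> to
  \<open>Z\<close> and also to invert \<open>x\<close>.\<close>

lemma annihilator_nonzero_const:
  assumes "x \<noteq> 0"
  obtains c h where "c \<in> Z" "c \<noteq> 0" "h \<in> Zpoly" "c + x * poly h x = 0"
proof -
  have "\<exists>c\<in>Z. \<exists>h\<in>Zpoly. c \<noteq> 0 \<and> c + x * poly h x = 0"
    if "f \<noteq> 0" "f \<in> Zpoly" "poly f x = 0" for f
    using that
  proof (induction f)
    case (pCons a f)
    show ?case
    proof (cases "a = 0")
      case True
      with pCons assms show ?thesis by (auto simp: Zpoly_pCons)
    next
      case False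
      with pCons show ?thesis by (auto simp: Zpoly_pCons)
    qed
  qed auto
  moreover obtain f where "f \<noteq> 0" "f \<in> Zpoly" "poly f x = 0"
    using algebraic_over[of x] by (auto simp: Zpoly_def)
  ultimately show ?thesis using that by blast
qed

text \<open>The largest power of \<open>\<pi>\<close> common to all coefficients is divided out; it
  exists because \<open>separated\<close> applies to the nonzero leading coefficient.\<close>

lemma annihilator_primitive:
  obtains f where "f \<in> Zpoly" "poly f x = 0" "\<exists>i. \<not> (\<exists>b\<in>Z. coeff f i = \<pi> * b)"
proof -
  obtain f where f: "f \<noteq> 0" "f \<in> Zpoly" "poly f x = 0"
    using algebraic_over[of x] by (auto simp: Zpoly_def)
  define D where "D k \<longleftrightarrow> (\<forall>i. \<exists>b\<in>Z. coeff f i = \<pi> ^ k * b)" for k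
  have "\<exists>k. \<not> D k"
    using f(1) separated unfolding D_def by (metis leading_coeff_0_iff)
  then have m: "\<not> D (LEAST k. \<not> D k)" by (rule LeastI_ex)
  have "D 0" using f(2) by (auto simp: D_def Zpoly_def)
  then obtain l where l: "(LEAST k. \<not> D k) = Suc l"
    using m by (metis not0_implies_Suc)
  have Dl: "D l" using not_less_Least[of l "\<lambda>k. \<not> D k"] l by auto
  define g where "g = smult (inverse (\<pi> ^ l)) f"
  have "g \<in> Zpoly"
    using Dl p_nonzero by (auto simp: g_def Zpoly_def D_def) (metis field_class.field_inverse mult.assoc mult_1 power_not_zero)
  moreover have "poly g x = 0" using f(3) by (simp add: g_def)
  moreover have "\<exists>i. \<not> (\<exists>b\<in>Z. coeff g i = \<pi> * b)"
  proof (rule ccontr)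
    assume a: "\<nexists>i. \<not> (\<exists>b\<in>Z. coeff g i = \<pi> * b)"
    have "\<exists>b\<in>Z. coeff f i = \<pi> ^ Suc l * b" for i
    proof -
      obtain b where b: "b \<in> Z" "coeff g i = \<pi> * b" using a by blast
      have "coeff f i = \<pi> ^ l * coeff g i" using p_nonzero by (simp add: g_def)
      then show ?thesis using b by (auto simp: mult_ac)
    qed
    then have "D (Suc l)" by (simp add: D_def)
    then show False using m l by simp
  qed
  ultimately show ?thesis using that by blast
qed

section \<open>Integral elements and the valuation ring property\<close>

definition integral :: "'a \<Rightarrow> bool" where
  "integral x \<longleftrightarrow> (\<exists>f\<in>Zpoly. lead_coeff f = 1 \<and> poly f x = 0)"

lemma integralI_power:
  assumes "x ^ r = (\<Sum>i<r. c i * x ^ i)" "\<And>i. c i \<in> Z"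
  shows "integral x"
proof -
  let ?g = "\<Sum>i<r. monom (c i) i"
  define f where "f = monom 1 r - ?g"
  have cg: "coeff ?g i = (if i < r then c i else 0)" for i
    by (simp add: coeff_sum sum.delta')
  have "f \<in> Zpoly"
    unfolding f_def by (intro Zpoly_diff Zpoly_sum Zpoly_monom assms Z_1)
  moreover have "poly f x = 0"
    using assms(1) by (simp add: f_def poly_sum poly_monom)
  moreover have "coeff f r = 1" "\<And>i. i > r \<Longrightarrow> coeff f i = 0"
    by (simp_all add: f_def cg)
  then have "degree f = r"
    by (intro antisym degree_le le_degree) auto
  with \<open>coeff f r = 1\<close> have "lead_coeff f = 1" by simp
  ultimately show ?thesis unfolding integral_def by blast
qed

text \<open>If \<open>r\<close> is the largest index of a unit coefficient, \<open>Z[x]\<close> is spanned modulo \<open>p\<close> by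
  \<open>x\<^sup>i\<close>, \<open>i < r\<close>. By completeness \<open>x\<^sup>r\<close> agrees up to an infinitely \<open>p\<close>-divisible
  element \<open>y\<close> of \<open>Z[x]\<close> with a \<open>Z\<close>-combination of these powers. If \<open>y \<noteq> 0\<close>, then so is
  some nonzero constant infinitely \<open>p\<close>-divisible in \<open>Z[x]\<close>. This replaces Hensel's lemma.\<close>

lemma integral_or_adjoin_inverse_p:
  "integral x \<or> (\<exists>b\<in>adjoin x. 1 = \<pi> * b)"
proof -
  obtain f where f: "f \<in> Zpoly" "poly f x = 0" "\<exists>i. \<not> (\<exists>b\<in>Z. coeff f i = \<pi> * b)"
    by (rule annihilator_primitive)
  define U where "U = {i. \<not> (\<exists>b\<in>Z. coeff f i = \<pi> * b)}"
  have U_le: "i \<le> degree f" if "i \<in> U" for i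
  proof (rule ccontr)
    assume "\<not> i \<le> degree f"
    then have "coeff f i = \<pi> * 0" by (simp add: coeff_eq_0)
    then show False using that Z_0 by (auto simp: U_def)
  qed
  then have "finite U" by (meson finite_nat_set_iff_bounded_le)
  have "U \<noteq> {}" using f(3) by (auto simp: U_def)
  define r where "r = Max U"
  have r: "r \<in> U" "\<And>i. i > r \<Longrightarrow> i \<notin> U"
    using \<open>finite U\<close> \<open>U \<noteq> {}\<close> by (auto simp: r_def dest: Max_ge)
  define u where "u = inverse (coeff f r)"
  have u: "u \<in> Z" "u * coeff f r = 1"
  proof -
    show "u \<in> Z"
      using r(1) unit_or_multiple[OF Zpoly_coeff[OF f(1)]] by (auto simp: u_def U_def)
    have "coeff f r \<noteq> 0"
    proof
      assume "coeff f r = 0"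
      then have "coeff f r = \<pi> * 0" by simp
      then show False using r(1) Z_0 unfolding U_def by blast
    qed
    then show "u * coeff f r = 1" by (simp add: u_def)
  qed
  define n where "n = degree f"
  define a where "a i = u * coeff f i" for i
  have aZ: "a i \<in> Z" for i using u(1) Zpoly_coeff[OF f(1)] by (simp add: a_def Z_mult)
  have a_r: "a r = 1" using u by (simp add: a_def)
  have "\<exists>b\<in>Z. a i = \<pi> * b" if i: "i > r" for i
  proof -
    obtain b where "b \<in> Z" "coeff f i = \<pi> * b" using r(2)[OF i] unfolding U_def by blast
    then show ?thesis using u(1) by (intro bexI[of _ "u * b"]) (auto simp: a_def Z_mult)
  qed
  then obtain w where w: "\<And>i. i > r \<Longrightarrow> w i \<in> Z \<and> a i = \<pi> * w i" by metis
  have rn: "r \<le> n" using U_le r(1) by (simp add: n_def)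
  have "(\<Sum>i\<le>n. a i * x ^ i) = u * poly f x"
    by (simp add: poly_altdef n_def a_def sum_distrib_left mult_ac)
  then have rel0: "(\<Sum>i\<le>n. a i * x ^ i) = 0" using f(2) by simp
  have "{..n} = {..<r} \<union> {r} \<union> {r<..n}" using rn by auto
  then have "(\<Sum>i\<le>n. a i * x ^ i) = (\<Sum>i<r. a i * x ^ i) + x ^ r + (\<Sum>i\<in>{r<..n}. a i * x ^ i)"
    using a_r by (simp only:) (subst sum.union_disjoint; force)+
  also have "(\<Sum>i\<in>{r<..n}. a i * x ^ i) = \<pi> * (\<Sum>i\<in>{r<..n}. w i * x ^ i)"
    unfolding sum_distrib_left by (rule sum.cong) (use w in \<open>auto simp: mult_ac\<close>)
  finally have rel: "x ^ r = - (\<Sum>i<r. a i * x ^ i) - \<pi> * (\<Sum>i\<in>{r<..n}. w i * x ^ i)"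
    using rel0 by (simp add: algebra_simps eq_neg_iff_add_eq_0)

  \<comment> \<open>Modulo \<open>\<pi>\<close> the relation \<open>rel\<close> rewrites x^j with j
    >= r by lower powers; hence every element of \<open>adjoin x\<close> will lie in
    \<open>S\<close>.\<close>
  define S where "S = {b. \<exists>c b'. (\<forall>i. c i \<in> Z) \<and> b' \<in> adjoin x \<and> b = (\<Sum>i<r. c i * x ^ i) + \<pi> * b'}"
  have S_0: "0 \<in> S"
    unfolding S_def by (rule CollectI, rule exI[of _ "\<lambda>_. 0"], rule exI[of _ 0]) (auto simp: Z_0 adjoin_Z)
  have S_add: "s + t \<in> S" if st: "s \<in> S" "t \<in> S" for s t
  proof -
    obtain c b c' b' where
      "\<forall>i. c i \<in> Z" "b \<in> adjoin x" "s = (\<Sum>i<r. c i * x ^ i) + \<pi> * b"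
      "\<forall>i. c' i \<in> Z" "b' \<in> adjoin x" "t = (\<Sum>i<r. c' i * x ^ i) + \<pi> * b'"
      using st unfolding S_def by blast
    then show ?thesis unfolding S_def
      by (intro CollectI exI[of _ "\<lambda>i. c i + c' i"] exI[of _ "b + b'"])
         (auto simp: Z_add adjoin_add algebra_simps sum.distrib)
  qed
  have S_scale: "z * s \<in> S" if st: "s \<in> S" "z \<in> Z" for s z
  proof -
    obtain c b where
      "\<forall>i. c i \<in> Z" "b \<in> adjoin x" "s = (\<Sum>i<r. c i * x ^ i) + \<pi> * b"
      using st unfolding S_def by blast
    then show ?thesis using st unfolding S_def
      by (intro CollectI exI[of _ "\<lambda>i. z * c i"] exI[of _ "z * b"])
         (auto simp: Z_mult adjoin_mult adjoin_Z algebra_simps sum_distrib_left)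
  qed
  have S_sum: "sum g A \<in> S" if "\<And>i. i \<in> A \<Longrightarrow> g i \<in> S" for g and A :: "nat set"
    using that by (induction A rule: infinite_finite_induct) (auto simp: S_0 S_add)
  have S_p: "\<pi> * b \<in> S" if "b \<in> adjoin x" for b
    using that unfolding S_def by (intro CollectI exI[of _ "\<lambda>_. 0"] exI[of _ b]) (auto simp: Z_0)
  have S_neg: "- s \<in> S" if "s \<in> S" for s
    using S_scale[OF that, of "-1"] by (simp add: Z_1 Z_uminus)
  have S_pow: "x ^ j \<in> S" for j
  proof (induction j rule: less_induct)
    case (less j)
    show ?case
    proof (cases "j < r")
      case True
      then show ?thesis unfolding S_def
        by (intro CollectI exI[of _ "\<lambda>i. if i = j then 1 else 0"] exI[of _ 0])
           (auto simp: Z_0 Z_1 adjoin_Z if_distrib[of "\<lambda>c. c * _"] cong: if_cong)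
    next
      case False
      then have j: "x ^ j = x ^ (j - r) * x ^ r" by (simp flip: power_add)
      have "x ^ j = - (\<Sum>i<r. a i * x ^ (j - r + i)) - \<pi> * (x ^ (j - r) * (\<Sum>i\<in>{r<..n}. w i * x ^ i))"
        unfolding j rel by (simp add: algebra_simps sum_distrib_left power_add)
      moreover have "(\<Sum>i<r. a i * x ^ (j - r + i)) \<in> S"
        using False by (intro S_sum S_scale less aZ) auto
      moreover have "\<pi> * (x ^ (j - r) * (\<Sum>i\<in>{r<..n}. w i * x ^ i)) \<in> S"
        using w by (intro S_p adjoin_mult adjoin_sum adjoin_power adjoin_self adjoin_Z) auto
      ultimately show ?thesis using S_add[OF S_neg S_neg] by simp
    qed
  qed
  have "adjoin x \<subseteq> S"
    using Zpoly_coeff by (auto simp: adjoin_def poly_altdef intro!: S_sum S_scale S_pow)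
  then have "\<forall>b\<in>adjoin x. \<exists>c b'. (\<forall>i. c i \<in> Z) \<and> b' \<in> adjoin x \<and> b = (\<Sum>i<r. c i * x ^ i) + \<pi> * b'"
    unfolding S_def by blast
  then obtain c \<nu> where c: "\<And>b i. b \<in> adjoin x \<Longrightarrow> c b i \<in> Z"
    and \<nu>: "\<And>b. b \<in> adjoin x \<Longrightarrow> \<nu> b \<in> adjoin x"
    and dec: "\<And>b. b \<in> adjoin x \<Longrightarrow> b = (\<Sum>i<r. c b i * x ^ i) + \<pi> * \<nu> b"
    by metis
  \<comment> \<open>The decomposition is iterated on its own remainder: \<open>b k\<close> is the
    part of \<open>x ^ r\<close> still multiplied by \<open>\<pi> ^ k\<close>, and the coefficients
    split off so far add up to \<open>C k i\<close>, which converge by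
    \<open>complete\<close>.\<close>
  define b where "b k = (\<nu> ^^ k) (x ^ r)" for k
  have b: "b k \<in> adjoin x" for k
    by (induction k) (auto simp: b_def \<nu> adjoin_power adjoin_self)
  define C where "C k i = (\<Sum>j<k. \<pi> ^ j * c (b j) i)" for k i
  have C: "C k i \<in> Z" for k i
    unfolding C_def by (intro Z_sum Z_mult Z_power Z_of_nat c b)
  have expand: "x ^ r = (\<Sum>i<r. C k i * x ^ i) + \<pi> ^ k * b k" for k
  proof (induction k)
    case 0
    show ?case by (simp add: C_def b_def)
  next
    case (Suc k)
    have bS: "b (Suc k) = \<nu> (b k)" by (simp add: b_def)
    have "\<pi> ^ k * b k = \<pi> ^ k * (\<Sum>i<r. c (b k) i * x ^ i) + \<pi> ^ Suc k * b (Suc k)"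
      unfolding bS by (subst dec[OF b[of k]]) (simp add: algebra_simps)
    moreover have "(\<Sum>i<r. C (Suc k) i * x ^ i) = (\<Sum>i<r. C k i * x ^ i) + \<pi> ^ k * (\<Sum>i<r. c (b k) i * x ^ i)"
      by (simp add: C_def sum.distrib algebra_simps sum_distrib_left)
    ultimately show ?case using Suc by (simp add: algebra_simps)
  qed
  have "\<exists>z\<in>Z. \<forall>k. \<exists>d\<in>Z. z - C k i = \<pi> ^ k * d" for i
    by (rule complete) (use C c[OF b] in \<open>auto simp: C_def\<close>)
  then obtain L where L: "\<And>i. L i \<in> Z" and "\<forall>i k. \<exists>d\<in>Z. L i - C k i = \<pi> ^ k * d" by metis
  then obtain D where D: "\<And>i k. D i k \<in> Z" "\<And>i k. L i - C k i = \<pi> ^ k * D i k" by metis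
  define y where "y = x ^ r - (\<Sum>i<r. L i * x ^ i)"
  have y: "\<exists>d\<in>adjoin x. y = \<pi> ^ k * d" for k
  proof
    have "y = \<pi> ^ k * b k - (\<Sum>i<r. (L i - C k i) * x ^ i)"
      unfolding y_def by (subst expand[of k]) (simp add: sum_subtractf algebra_simps)
    also have "(\<Sum>i<r. (L i - C k i) * x ^ i) = \<pi> ^ k * (\<Sum>i<r. D i k * x ^ i)"
      by (simp add: D(2) sum_distrib_left mult_ac)
    finally show "y = \<pi> ^ k * (b k - (\<Sum>i<r. D i k * x ^ i))" by (simp add: algebra_simps)
    show "b k - (\<Sum>i<r. D i k * x ^ i) \<in> adjoin x"
      by (intro adjoin_diff b adjoin_sum adjoin_mult adjoin_Z D adjoin_power adjoin_self)
  qed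
  show ?thesis
  proof (cases "y = 0")
    case True
    then have "integral x" by (intro integralI_power[of x r L]) (auto simp: y_def L)
    then show ?thesis ..
  next
    case False
    then obtain c0 h where c0: "c0 \<in> Z" "c0 \<noteq> 0" "h \<in> Zpoly" "c0 + y * poly h y = 0"
      by (rule annihilator_nonzero_const)
    obtain k v where k: "c0 = \<pi> ^ k * v" "v \<in> Z" "inverse v \<in> Z"
      using Z_factor c0 by metis
    \<comment> \<open>One power of \<open>\<pi>\<close> more than \<open>c0\<close> contains: as
      \<open>y\<close> divides \<open>c0\<close> in \<open>adjoin x\<close>, cancelling
      \<open>\<pi> ^ k\<close> leaves the unit \<open>v\<close>, and hence 1, as a multiple of
      \<open>\<pi>\<close>.\<close>
    obtain d where d: "d \<in> adjoin x" "y = \<pi> ^ Suc k * d" using y by blast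
    have "y \<in> adjoin x" using y[of 0] by simp
    then have h: "poly h y \<in> adjoin x"
      by (intro poly_closed[OF c0(3)]) (auto intro: adjoin_Z adjoin_add adjoin_mult)
    have v0: "v \<noteq> 0" using k c0 by auto
    have "\<pi> ^ k * v = - (\<pi> ^ Suc k * d * poly h y)"
      using c0(4) k d(2) by (simp add: eq_neg_iff_add_eq_0)
    then have "\<pi> ^ k * v = \<pi> ^ k * (\<pi> * - (d * poly h y))" by (simp add: mult_ac)
    then have "v = \<pi> * - (d * poly h y)" using p_nonzero by (metis mult_left_cancel power_not_zero)
    then have "1 = \<pi> * (inverse v * (- 1) * (d * poly h y))"
      using v0 by (metis (no_types, lifting) field_class.field_inverse mult.assoc mult.commute mult_minus1 )
    moreover have "inverse v * (- 1) * (d * poly h y) \<in> adjoin x"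
      by (intro adjoin_mult adjoin_Z k d h Z_uminus Z_1)
    ultimately show ?thesis by blast
  qed
qed

text \<open>If \<open>x\<close> is not integral, 1 - p f annihilates it for some \<open>f\<close>
  over \<open>Z\<close>. The constant term is a unit, so the reversed polynomial, scaled to be
  monic, annihilates \<open>inverse x\<close>.\<close>

lemma integral_or_inverse_integral: "integral x \<or> integral (inverse x)"
proof (rule disjCI)
  assume "\<not> integral (inverse x)"
  show "integral x"
  proof (rule ccontr)
    assume "\<not> integral x"
    then obtain f where f: "f \<in> Zpoly" "1 = \<pi> * poly f x"
      using integral_or_adjoin_inverse_p[of x] by (auto simp: adjoin_def)
    have x0: "x \<noteq> 0"
    proof
      assume "x = 0"
      then have "integral x" by (intro integralI_power[of x 1 "\<lambda>_. 0"]) (auto simp: Z_0)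
      with \<open>\<not> integral x\<close> show False ..
    qed
    define g where "g = 1 - smult \<pi> f"
    have g: "g \<in> Zpoly" "poly g x = 0"
      using f by (auto simp: g_def intro: Zpoly_diff Zpoly_1 Zpoly_smult Z_of_nat)
    define u where "u = inverse (coeff g 0)"
    have u: "u \<in> Z" "coeff g 0 \<noteq> 0"
      using one_minus_unit[OF Zpoly_coeff[OF f(1), of 0]] by (auto simp: u_def g_def)
    define h where "h = smult u (reflect_poly g)"
    have "h \<in> Zpoly"
      using u g Zpoly_coeff[OF g(1)] Z_0 by (auto simp: h_def Zpoly_def coeff_reflect_poly intro!: Z_mult)
    moreover have "poly h (inverse x) = 0"
      using x0 g by (simp add: h_def poly_reflect_poly_nz)
    moreover have "lead_coeff h = 1"
      using u by (simp add: h_def u_def coeff_reflect_poly)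
    ultimately have "integral (inverse x)" unfolding integral_def by blast
    with \<open>\<not> integral (inverse x)\<close> show False ..
  qed
qed

text \<open>Nakayama's lemma for the maximal ideal \<open>p Z\<close>.\<close>

lemma Zspan_eq_zero:
  assumes "\<And>m. m \<in> Zspan ms \<Longrightarrow> \<exists>v\<in>Zspan ms. m = \<pi> * v"
  shows "Zspan ms = {0}"
  using assms
proof (induction ms)
  case (Cons m ms)
  obtain v where "v \<in> Zspan (m # ms)" "m = \<pi> * v"
    using Cons.prems[OF Zspan_generator[of m "m # ms"]] by auto
  then obtain c w where cw: "c \<in> Z" "w \<in> Zspan ms" "m = \<pi> * (c * m + w)"
    by auto
  \<comment> \<open>The factor on the left is a unit, so the first generator is redundant and the
    induction hypothesis applies to the shorter list.\<close>
  have "(1 - \<pi> * c) * m = \<pi> * w" using cw(3) by (simp add: algebra_simps)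
  then have "m = (inverse (1 - \<pi> * c) * \<pi>) * w"
    using one_minus_unit(2)[OF cw(1)]
    by (metis (no_types, lifting) field_class.field_inverse mult.assoc mult_1)
  moreover have "inverse (1 - \<pi> * c) * \<pi> \<in> Z"
    by (intro Z_mult one_minus_unit cw Z_of_nat)
  ultimately have "m \<in> Zspan ms" using ZmoduleD(3)[OF Zmodule_Zspan] cw(2) by metis
  then have "Zspan (m # ms) \<subseteq> Zspan ms"
    by (intro Zspan_least Zmodule_Zspan) (auto intro: Zspan_generator)
  then have eq: "Zspan (m # ms) = Zspan ms" using Zspan_mono by blast
  show ?case using Cons.IH Cons.prems unfolding eq by blast
qed simp

text \<open>Otherwise 1 = p f(x) for some \<open>f\<close> over \<open>Z\<close>. The span is stable
  under f(x), so it equals p times itself and vanishes by Nakayama, although it contains the nonzero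
  \<open>m\<close>.\<close>

lemma integral_if_stable:
  assumes "m \<in> Zspan ms" "m \<noteq> 0" "\<And>g. g \<in> set ms \<Longrightarrow> x * g \<in> Zspan ms"
  shows "integral x"
proof (rule ccontr)
  assume "\<not> integral x"
  then obtain f where f: "f \<in> Zpoly" "1 = \<pi> * poly f x"
    using integral_or_adjoin_inverse_p[of x] by (auto simp: adjoin_def)
  have "Zmodule {v. x * v \<in> Zspan ms}"
    using Zmodule_Zspan[of ms] unfolding Zmodule_def by (auto simp: algebra_simps)
  then have "Zspan ms \<subseteq> {v. x * v \<in> Zspan ms}"
    by (rule Zspan_least) (use assms(3) in auto)
  then have stable: "x * v \<in> Zspan ms" if "v \<in> Zspan ms" for v using that by auto
  have poly_stable: "poly g x * v \<in> Zspan ms" if "g \<in> Zpoly" "v \<in> Zspan ms" for g v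
    using that
  proof (induction g)
    case (pCons a g)
    then have "a * v + x * (poly g x * v) \<in> Zspan ms"
      by (intro ZmoduleD(2)[OF Zmodule_Zspan] stable) (auto simp: Zpoly_pCons intro: ZmoduleD(3)[OF Zmodule_Zspan])
    then show ?case by (simp add: algebra_simps)
  qed (simp add: ZmoduleD(1)[OF Zmodule_Zspan])
  have "Zspan ms = {0}"
  proof (rule Zspan_eq_zero)
    fix v assume v: "v \<in> Zspan ms"
    have "v = \<pi> * (poly f x * v)" using f(2) by (metis mult.assoc mult_1)
    then show "\<exists>w\<in>Zspan ms. v = \<pi> * w" using poly_stable[OF f(1) v] by blast
  qed
  then show False using assms by auto
qed

lemma integralE_power:
  assumes "integral x"
  obtains n c where "n > 0" "x ^ n = (\<Sum>i<n. c i * x ^ i)" "\<And>i. c i \<in> Z"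
proof -
  obtain f where f: "f \<in> Zpoly" "lead_coeff f = 1" "poly f x = 0"
    using assms unfolding integral_def by blast
  define n where "n = degree f"
  have "n > 0"
  proof (rule ccontr)
    assume "\<not> n > 0"
    then have "f = [:1:]" using f(2) by (auto simp: n_def elim!: degree_eq_zeroE)
    then show False using f(3) by simp
  qed
  moreover have "(\<Sum>i\<le>n. coeff f i * x ^ i) = 0"
    using f(3) by (simp add: poly_altdef n_def)
  then have "x ^ n = (\<Sum>i<n. - coeff f i * x ^ i)"
    using f(2) by (simp add: lessThan_Suc_atMost[symmetric] n_def sum_negf eq_neg_iff_add_eq_0 add.commute)
  ultimately show ?thesis
    using that[of n "\<lambda>i. - coeff f i"] Zpoly_coeff[OF f(1)] Z_uminus by blast
qed

text \<open>The last hypothesis expresses that \<open>z\<close> is a polynomial in \<open>x\<close>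
  and \<open>y\<close>. It is applied to the span of the products x^i y^j with exponents below the
  degrees of the two monic equations.\<close>

lemma integral_bivariate:
  assumes "integral x" "integral y"
    and z: "\<And>M. Zmodule M \<Longrightarrow> (\<And>v. v \<in> M \<Longrightarrow> x * v \<in> M) \<Longrightarrow> (\<And>v. v \<in> M \<Longrightarrow> y * v \<in> M) \<Longrightarrow>
      (\<And>v. v \<in> M \<Longrightarrow> z * v \<in> M)"
  shows "integral z"
proof -
  obtain n c where n: "n > 0" "x ^ n = (\<Sum>i<n. c i * x ^ i)" "\<And>i. c i \<in> Z"
    using integralE_power[OF assms(1)] by blast
  obtain k d where k: "k > 0" "y ^ k = (\<Sum>i<k. d i * y ^ i)" "\<And>i. d i \<in> Z"
    using integralE_power[OF assms(2)] by blast
  define ms where "ms = [x ^ i * y ^ j. i \<leftarrow> [0..<n], j \<leftarrow> [0..<k]]"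
  have ms: "set ms = {x ^ i * y ^ j | i j. i < n \<and> j < k}"
    unfolding ms_def by (auto simp: image_iff) (metis atLeastLessThan_iff le0)+
  note M = Zmodule_Zspan[of ms]
  have gen: "x ^ i * y ^ j \<in> Zspan ms" if "i < n" "j < k" for i j
    using that by (intro Zspan_generator) (auto simp: ms)
  have stab: "Zspan ms \<subseteq> {v. w * v \<in> Zspan ms}"
    if "\<And>i j. i < n \<Longrightarrow> j < k \<Longrightarrow> w * (x ^ i * y ^ j) \<in> Zspan ms" for w
    by (rule Zspan_least) (use that M in \<open>auto simp: ms Zmodule_def algebra_simps\<close>)
  have "x * (x ^ i * y ^ j) \<in> Zspan ms" if ij: "i < n" "j < k" for i j
  proof (cases "Suc i < n")
    case True
    then show ?thesis using gen[of "Suc i" j] ij by (simp add: mult_ac)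
  next
    case False
    then have "n = Suc i" using ij by simp
    then have "x * (x ^ i * y ^ j) = x ^ n * y ^ j"
      by (auto simp: mult_ac)
    also have "\<dots> = (\<Sum>l<n. c l * (x ^ l * y ^ j))"
      unfolding n(2) sum_distrib_right by (simp add: mult_ac)
    also have "\<dots> \<in> Zspan ms"
      by (intro Zmodule_sum[OF M] ZmoduleD(3)[OF M] n gen ij) auto
    finally show ?thesis .
  qed
  from stab[OF this] have X: "x * v \<in> Zspan ms" if "v \<in> Zspan ms" for v using that by auto
  have "y * (x ^ i * y ^ j) \<in> Zspan ms" if ij: "i < n" "j < k" for i j
  proof (cases "Suc j < k")
    case True
    then show ?thesis using gen[of i "Suc j"] ij by (simp add: mult_ac)
  next
    case False
    then have "Suc j = k" using ij by simp
    then have "y * (x ^ i * y ^ j) = x ^ i * y ^ k" by (auto simp: mult_ac)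
    also have "\<dots> = (\<Sum>l<k. d l * (x ^ i * y ^ l))"
      unfolding k(2) sum_distrib_left by (simp add: mult_ac)
    also have "\<dots> \<in> Zspan ms"
      by (intro Zmodule_sum[OF M] ZmoduleD(3)[OF M] k gen ij) auto
    finally show ?thesis .
  qed
  from stab[OF this] have Y: "y * v \<in> Zspan ms" if "v \<in> Zspan ms" for v using that by auto
  show ?thesis
    by (rule integral_if_stable[of 1 ms]) (use gen[of 0 0] n(1) k(1) z[OF M X Y] Zspan_generator in auto)
qed

lemma integral_add: "integral x \<Longrightarrow> integral y \<Longrightarrow> integral (x + y)"
  by (rule integral_bivariate[of x y]) (auto simp: Zmodule_def algebra_simps)

lemma integral_mult: "integral x \<Longrightarrow> integral y \<Longrightarrow> integral (x * y)"
  by (rule integral_bivariate[of x y]) (auto simp: mult.assoc)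

lemma integral_Z: "a \<in> Z \<Longrightarrow> integral a"
  by (rule integralI_power[of a 1 "\<lambda>_. a"]) auto

lemma integral_uminus: "integral x \<Longrightarrow> integral (- x)"
  using integral_mult[OF integral_Z[of "-1"], of x] by (simp add: Z_1 Z_uminus)

lemma integral_diff: "integral x \<Longrightarrow> integral y \<Longrightarrow> integral (x - y)"
  using integral_add[of x "- y"] integral_uminus by simp

lemma integral_power: "integral x \<Longrightarrow> integral (x ^ n)"
  by (induction n) (auto intro: integral_mult integral_Z Z_1)

lemma integral_prod: "(\<And>i. i \<in> A \<Longrightarrow> integral (f i)) \<Longrightarrow> integral (prod f A)"
  by (induction A rule: infinite_finite_induct) (auto intro: integral_Z Z_1 integral_mult)

text \<open>Multiplying a monic equation of degree n for 1/p by p^n gives 1 = p a with a in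
  \<open>Z\<close>, which \<open>one_minus_unit\<close> excludes.\<close>

lemma inverse_p_not_integral: "\<not> integral (inverse \<pi>)"
proof
  assume "integral (inverse \<pi>)"
  then obtain n c where n: "n > 0" "inverse \<pi> ^ n = (\<Sum>i<n. c i * inverse \<pi> ^ i)" "\<And>i. c i \<in> Z"
    by (rule integralE_power) blast
  have "1 = \<pi> ^ n * inverse \<pi> ^ n" using p_nonzero by (simp flip: power_mult_distrib)
  also have "\<dots> = (\<Sum>i<n. c i * (\<pi> ^ n * inverse \<pi> ^ i))"
    unfolding n(2) sum_distrib_left by (simp add: mult_ac)
  also have "\<dots> = (\<Sum>i<n. c i * (\<pi> * \<pi> ^ (n - Suc i)))"
  proof (rule sum.cong)
    fix i assume "i \<in> {..<n}"
    then have "n = Suc (n - Suc i) + i" by simp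
    then have "\<pi> ^ n = \<pi> * \<pi> ^ (n - Suc i) * \<pi> ^ i" by (metis power_Suc power_add)
    then show "c i * (\<pi> ^ n * inverse \<pi> ^ i) = c i * (\<pi> * \<pi> ^ (n - Suc i))"
      using p_nonzero by (simp add: mult.assoc flip: power_mult_distrib)
  qed simp
  also have "\<dots> = \<pi> * (\<Sum>i<n. c i * \<pi> ^ (n - Suc i))"
    by (simp add: sum_distrib_left mult_ac)
  finally have "1 - \<pi> * (\<Sum>i<n. c i * \<pi> ^ (n - Suc i)) = 0" by simp
  moreover have "(\<Sum>i<n. c i * \<pi> ^ (n - Suc i)) \<in> Z"
    by (intro Z_sum Z_mult n Z_power Z_of_nat)
  ultimately show False using one_minus_unit(2) by blast
qed

text \<open>One factor p is cancelled at a time. If p did not divide \<open>m\<close>, a Bezout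
  relation u p + v m = 1 would make 1/p integral.\<close>

lemma multiplicity_of_integral_quotient:
  assumes "of_int m = \<pi> ^ k * a" "integral a" "prime p"
  shows "int p ^ k dvd m"
  using assms(1,2)
proof (induction k arbitrary: m)
  case (Suc k)
  have "int p dvd m"
  proof (rule ccontr)
    assume "\<not> int p dvd m"
    then have "coprime (int p) m"
      using assms(3) by (intro prime_imp_coprime) auto
    then obtain u v where "u * int p + v * m = 1"
      using bezout_int[of "int p" m] by auto
    then have "of_int u * \<pi> + of_int v * of_int m = (1 :: 'a)"
      by (metis of_int_1 of_int_add of_int_mult of_int_of_nat_eq)
    then have "1 = \<pi> * (of_int u + of_int v * (\<pi> ^ k * a))"
      unfolding Suc.prems by (simp add: algebra_simps)
    then have "inverse \<pi> = of_int u + of_int v * (\<pi> ^ k * a)" by (metis inverse_unique)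
    moreover have "integral (of_int u + of_int v * (\<pi> ^ k * a))"
      by (intro integral_add integral_mult integral_Z Z_of_int Z_power Z_of_nat Suc.prems)
    ultimately show False using inverse_p_not_integral by simp
  qed
  then obtain l where l: "m = int p * l" by blast
  have "\<pi> * of_int l = \<pi> * (\<pi> ^ k * a)" using Suc.prems(1) l by (simp add: mult_ac)
  then have "of_int l = \<pi> ^ k * a" using p_nonzero by simp
  from Suc.IH[OF this Suc.prems(2)] show ?case using l by simp
qed simp

text \<open>The fraction field of \<open>Z\<close>: by \<open>Z_factor\<close>, inverting p inverts
  every nonzero element.\<close>

definition Q :: "'a set" where "Q = {q. \<exists>k. \<pi> ^ k * q \<in> Z}"

lemma Z_subset_Q: "a \<in> Z \<Longrightarrow> a \<in> Q"
  unfolding Q_def by (auto intro!: exI[of _ 0])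

lemma Q_factor:
  assumes "q \<in> Q" "q \<noteq> 0"
  obtains k l u where "\<pi> ^ k * q = \<pi> ^ l * u" "u \<in> Z" "inverse u \<in> Z" "u \<noteq> 0"
proof -
  obtain k where k: "\<pi> ^ k * q \<in> Z" using assms by (auto simp: Q_def)
  moreover have "\<pi> ^ k * q \<noteq> 0" using assms p_nonzero by simp
  ultimately obtain l u where "\<pi> ^ k * q = \<pi> ^ l * u" "u \<in> Z" "inverse u \<in> Z" by (rule Z_factor)
  moreover from this have "u \<noteq> 0" using \<open>\<pi> ^ k * q \<noteq> 0\<close> by auto
  ultimately show ?thesis using that by blast
qed

lemma Q_inverse:
  assumes "q \<in> Q" shows "inverse q \<in> Q"
proof (cases "q = 0")
  case True
  then show ?thesis using Z_subset_Q[OF Z_0] by simp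
next
  case False
  then obtain k l u where u: "\<pi> ^ k * q = \<pi> ^ l * u" "u \<in> Z" "inverse u \<in> Z" "u \<noteq> 0"
    using Q_factor assms by metis
  have "\<pi> ^ l * inverse q = \<pi> ^ k * inverse u"
    using u False by (simp add: field_simps)
  also have "\<dots> \<in> Z" by (intro Z_mult Z_power Z_of_nat u)
  finally show ?thesis by (auto simp: Q_def)
qed

sublocale Q: field_subring Q
proof
  show "0 \<in> Q" "1 \<in> Q" by (auto intro: Z_subset_Q Z_0 Z_1)
next
  fix a b assume "a \<in> Q" "b \<in> Q"
  then obtain k l where kl: "\<pi> ^ k * a \<in> Z" "\<pi> ^ l * b \<in> Z" by (auto simp: Q_def)
  have "\<pi> ^ (k + l) * (a + b) = \<pi> ^ l * (\<pi> ^ k * a) + \<pi> ^ k * (\<pi> ^ l * b)"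
    by (simp add: algebra_simps power_add)
  also have "\<dots> \<in> Z" by (intro Z_add Z_mult Z_power Z_of_nat kl)
  finally show "a + b \<in> Q" by (auto simp: Q_def)
  have "\<pi> ^ (k + l) * (a * b) = (\<pi> ^ k * a) * (\<pi> ^ l * b)"
    by (simp add: algebra_simps power_add)
  also have "\<dots> \<in> Z" by (intro Z_mult kl)
  finally show "a * b \<in> Q" by (auto simp: Q_def)
next
  fix a assume "a \<in> Q"
  then show "- a \<in> Q" using Z_uminus by (fastforce simp: Q_def)
qed

text \<open>A comparison of valuations without a valuation: the first case is v(a) >= v(b), the
  second v(b) > v(a), where the extra \<open>\<pi>\<close> records strictness.\<close>

lemma Q_comparable:
  assumes "a \<in> Q" "b \<in> Q" "a \<noteq> 0" "b \<noteq> 0"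
  shows "(\<exists>z\<in>Z. a = z * b) \<or> (\<exists>z\<in>Z. b = \<pi> * (z * a))"
proof -
  obtain k i u where u: "\<pi> ^ k * a = \<pi> ^ i * u" "u \<in> Z" "inverse u \<in> Z" "u \<noteq> 0"
    using Q_factor[OF assms(1,3)] by metis
  obtain l j v where v: "\<pi> ^ l * b = \<pi> ^ j * v" "v \<in> Z" "inverse v \<in> Z" "v \<noteq> 0"
    using Q_factor[OF assms(2,4)] by metis
  have eq: "\<pi> ^ (k + j) * (v * a) = \<pi> ^ (i + l) * (u * b)"
  proof -
    have "\<pi> ^ (k + j) * (v * a) = (\<pi> ^ k * a) * (\<pi> ^ j * v)" by (simp add: power_add)
    also have "\<dots> = \<pi> ^ (i + l) * (u * b)" unfolding u(1) v(1)[symmetric] by (simp add: power_add)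
    finally show ?thesis .
  qed
  show ?thesis
  proof (cases "k + j \<le> i + l")
    case True
    then have "\<pi> ^ (i + l) = \<pi> ^ (k + j) * \<pi> ^ (i + l - (k + j))" by (simp flip: power_add)
    then have "v * a = \<pi> ^ (i + l - (k + j)) * (u * b)" using eq p_nonzero by simp
    then have "a = (inverse v * \<pi> ^ (i + l - (k + j)) * u) * b"
      using v(4) by (simp add: field_simps)
    moreover have "inverse v * \<pi> ^ (i + l - (k + j)) * u \<in> Z"
      by (intro Z_mult Z_power Z_of_nat u v)
    ultimately show ?thesis by blast
  next
    case False
    define m where "m = k + j - Suc (i + l)"
    have "k + j = i + l + Suc m" using False by (simp add: m_def)
    then have "\<pi> ^ (k + j) = \<pi> ^ (i + l) * \<pi> ^ Suc m" by (simp flip: power_add)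
    then have "\<pi> ^ Suc m * (v * a) = u * b" using eq p_nonzero by (simp add: mult.assoc)
    then have "b = \<pi> * ((inverse u * \<pi> ^ m * v) * a)"
      using u(4) by (simp add: field_simps)
    moreover have "inverse u * \<pi> ^ m * v \<in> Z"
      by (intro Z_mult Z_power Z_of_nat u v)
    ultimately show ?thesis by blast
  qed
qed

lemma Q_Zmodule: "Q.Zmodule M \<Longrightarrow> Zmodule M"
  by (auto simp: Q.Zmodule_def Zmodule_def Z_subset_Q)

text \<open>Finiteness of T/pT for a \<open>Z\<close>-submodule \<open>T\<close> of a
  finite-dimensional space over \<open>Q\<close>, by induction on the spanning list.
  \<open>T\<close> is split into its part inside the span of the remaining vectors and the
  fractional ideal \<open>I\<close> of coefficients at \<open>b\<close>. Either I = p I, and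
  \<open>I\<close> contributes nothing, or \<open>I\<close> has one generator and contributes at
  most p classes.\<close>

lemma finite_mod_p:
  assumes "Zmodule T" "T \<subseteq> Q.Zspan bs"
  shows "\<exists>S. finite S \<and> S \<subseteq> T \<and> (\<forall>t\<in>T. \<exists>s\<in>S. \<exists>t'\<in>T. t = s + \<pi> * t')"
  using assms
proof (induction bs arbitrary: T)
  case Nil
  then have "T = {0}" using ZmoduleD(1)[OF Nil(1)] by auto
  then show ?case by (intro exI[of _ "{0}"]) auto
next
  case (Cons b bs)
  note T = ZmoduleD[OF Cons.prems(1)]
  define V where "V = Q.Zspan bs"
  have VM: "Q.Zmodule V" unfolding V_def by (rule Q.Zmodule_Zspan)
  note V = Q.ZmoduleD[OF VM] ZmoduleD(3)[OF Q_Zmodule[OF VM]]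
  have "Zmodule (T \<inter> V)"
    using Cons.prems(1) Q_Zmodule[OF VM] by (auto simp: Zmodule_def)
  from Cons.IH[OF this] have "\<exists>S. finite S \<and> S \<subseteq> T \<inter> V \<and> (\<forall>t\<in>T \<inter> V. \<exists>s\<in>S. \<exists>t'\<in>T \<inter> V. t = s + \<pi> * t')"
    by (simp add: V_def)
  then obtain S0 where S0: "finite S0" "S0 \<subseteq> T \<inter> V"
    "\<And>t. t \<in> T \<inter> V \<Longrightarrow> \<exists>s\<in>S0. \<exists>t'\<in>T. t = s + \<pi> * t'"
    by (metis IntD1)
  define I where "I = {q \<in> Q. \<exists>t\<in>T. t - q * b \<in> V}"
  have I: "\<exists>q\<in>I. t - q * b \<in> V" if t: "t \<in> T" for t
  proof -
    obtain q v where "t = q * b + v" "q \<in> Q" "v \<in> V"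
      using t Cons.prems(2) by (auto simp: V_def)
    then show ?thesis using t unfolding I_def by (intro bexI[of _ q] CollectI conjI bexI[of _ t]) auto
  qed
  have I_scale: "z * q \<in> I" if zq: "z \<in> Z" "q \<in> I" for z q
  proof -
    obtain t where t: "t \<in> T" "t - q * b \<in> V" using zq by (auto simp: I_def)
    have "z * t - (z * q) * b = z * (t - q * b)" by (simp add: algebra_simps)
    then have "\<exists>t\<in>T. t - z * q * b \<in> V"
      using zq t T(3)[of z t] V(6)[of z "t - q * b"] by metis
    moreover have "z * q \<in> Q" using zq by (auto simp: I_def intro: Q.Z_mult Z_subset_Q)
    ultimately show ?thesis by (simp add: I_def)
  qed
  have "\<exists>S1. finite S1 \<and> S1 \<subseteq> T \<and> (\<forall>t\<in>T. \<exists>s\<in>S1. \<exists>t'\<in>T. t - s - \<pi> * t' \<in> V)"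
  proof (cases "\<forall>q\<in>I. \<exists>q'\<in>I. q = \<pi> * q'")
    case True
    have "\<exists>t'\<in>T. t - 0 - \<pi> * t' \<in> V" if t: "t \<in> T" for t
    proof -
      obtain q where q: "q \<in> I" "t - q * b \<in> V" using I[OF t] by blast
      obtain q' where q': "q' \<in> I" "q = \<pi> * q'" using True q(1) by blast
      then obtain t' where t': "t' \<in> T" "t' - q' * b \<in> V" by (auto simp: I_def)
      have "t - 0 - \<pi> * t' = (t - q * b) - \<pi> * (t' - q' * b)" using q' by (simp add: algebra_simps)
      also have "\<dots> \<in> V" by (rule V(5)[OF q(2) V(6)[OF Z_of_nat t'(2)]])
      finally show ?thesis using t' by blast
    qed
    then show ?thesis using T(1) by (intro exI[of _ "{0}"]) auto
  next
    case False
    \<comment> \<open>An element of \<open>I\<close> outside p I has least valuation in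
      \<open>I\<close>, so \<open>Q_comparable\<close> makes it a generator.\<close>
    then obtain c where c: "c \<in> I" "\<And>q. q \<in> I \<Longrightarrow> c \<noteq> \<pi> * q" by blast
    obtain tc where tc: "tc \<in> T" "tc - c * b \<in> V" using c(1) by (auto simp: I_def)
    have c0: "c \<noteq> 0" using c(2)[OF I_scale[OF Z_0 c(1)]] by simp
    have mult: "\<exists>z\<in>Z. q = z * c" if q: "q \<in> I" for q
    proof (cases "q = 0")
      case True
      then show ?thesis using Z_0 by (intro bexI[of _ 0]) auto
    next
      case False
      with Q_comparable[of q c] q c c0 I_scale show ?thesis by (auto simp: I_def)
    qed
    have "\<exists>s\<in>(\<lambda>k. of_nat k * tc) ` {..<p}. \<exists>t'\<in>T. t - s - \<pi> * t' \<in> V" if t: "t \<in> T" for t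
    proof -
      obtain q where q: "q \<in> I" "t - q * b \<in> V" using I[OF t] by blast
      then obtain z where z: "z \<in> Z" "q = z * c" using mult by blast
      obtain k z' where k: "k < p" "z' \<in> Z" "z = of_nat k + \<pi> * z'" using residues[OF z(1)] by blast
      have "t - of_nat k * tc - \<pi> * (z' * tc) = (t - q * b) - z * (tc - c * b)"
        using k z by (simp add: algebra_simps)
      also have "\<dots> \<in> V" by (rule V(5)[OF q(2) V(6)[OF z(1) tc(2)]])
      finally show ?thesis using k(1) T(3)[OF k(2) tc(1)] by blast
    qed
    then show ?thesis using T(3)[OF Z_of_nat tc(1)] by (intro exI[of _ "(\<lambda>k. of_nat k * tc) ` {..<p}"]) auto
  qed
  then obtain S1 where S1: "finite S1" "S1 \<subseteq> T" "\<And>t. t \<in> T \<Longrightarrow> \<exists>s\<in>S1. \<exists>t'\<in>T. t - s - \<pi> * t' \<in> V"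
    by blast
  \<comment> \<open>After a representative for the coefficient is subtracted, the remainder lies in
    \<open>T \<inter> V\<close>, where the induction hypothesis supplies the second summand.\<close>
  have "\<exists>s\<in>(\<lambda>(s, s'). s + s') ` (S1 \<times> S0). \<exists>t'\<in>T. t = s + \<pi> * t'" if t: "t \<in> T" for t
  proof -
    obtain s t1 where s: "s \<in> S1" "t1 \<in> T" "t - s - \<pi> * t1 \<in> V" using S1(3)[OF t] by blast
    have "t - s - \<pi> * t1 \<in> T" using t s S1(2) by (intro T(5) T(3) Z_of_nat) auto
    then obtain s' t2 where s': "s' \<in> S0" "t2 \<in> T" "t - s - \<pi> * t1 = s' + \<pi> * t2" using S0(3) s(3) by blast
    have "t = s + s' + \<pi> * (t1 + t2)" using s'(3) by (simp add: algebra_simps)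
    then show ?thesis using s s' T(2) by force
  qed
  moreover have "(\<lambda>(s, s'). s + s') ` (S1 \<times> S0) \<subseteq> T"
    using S0(2) S1(2) by (auto intro!: T(2))
  ultimately show ?case using S0(1) S1(1) by (intro exI[of _ "(\<lambda>(s, s'). s + s') ` (S1 \<times> S0)"]) auto
qed

text \<open>The powers of \<open>x\<close> below the degree of its monic equation span a ring. It is
  a field because a nonzero element divides in it a nonzero constant of \<open>Z\<close>, which is
  invertible in \<open>Q\<close>.\<close>

lemma simple_extension_span:
  assumes "integral x"
  obtains bs where "x \<in> Q.Zspan bs" "Q \<subseteq> Q.Zspan bs"
    "\<And>v w. v \<in> Q.Zspan bs \<Longrightarrow> w \<in> Q.Zspan bs \<Longrightarrow> v * w \<in> Q.Zspan bs"
    "\<And>v. v \<in> Q.Zspan bs \<Longrightarrow> inverse v \<in> Q.Zspan bs"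
proof -
  obtain n c where n: "n > 0" "x ^ n = (\<Sum>i<n. c i * x ^ i)" "\<And>i. c i \<in> Z"
    using integralE_power[OF assms] by blast
  define bs where "bs = map (\<lambda>i. x ^ i) [0..<n]"
  define K where "K = Q.Zspan bs"
  have KM: "Q.Zmodule K" unfolding K_def by (rule Q.Zmodule_Zspan)
  note K = Q.ZmoduleD[OF KM]
  have gen: "x ^ i \<in> K" if "i < n" for i
    unfolding K_def using that by (intro Q.Zspan_generator) (auto simp: bs_def)
  have least: "K \<subseteq> M" if "Q.Zmodule M" "\<And>i. i < n \<Longrightarrow> x ^ i \<in> M" for M
    unfolding K_def using that by (intro Q.Zspan_least) (auto simp: bs_def)
  have QK: "Q \<subseteq> K" using K(3)[OF _ gen[OF n(1)]] by auto
  have mod: "Q.Zmodule {w. w * v \<in> K}" for v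
    using KM by (auto simp: Q.Zmodule_def algebra_simps)
  have "x ^ i * x \<in> K" if i: "i < n" for i
  proof (cases "Suc i < n")
    case True
    then show ?thesis using gen[of "Suc i"] by (simp add: mult_ac)
  next
    case False
    then have "n = Suc i" using i by simp
    then have "x ^ i * x = x ^ n" by (auto simp: mult_ac)
    also have "\<dots> \<in> K"
      unfolding n(2) by (intro Q.Zmodule_sum[OF KM] K(3) gen Z_subset_Q n) auto
    finally show ?thesis .
  qed
  then have Kx: "v * x \<in> K" if "v \<in> K" for v using least[OF mod] that by blast
  have Kpow: "x ^ i * v \<in> K" if "v \<in> K" for v i
  proof (induction i)
    case (Suc i)
    then show ?case using Kx[of "x ^ i * v"] by (simp add: mult_ac)
  qed (use that in simp)
  have mult: "w * v \<in> K" if "v \<in> K" "w \<in> K" for v w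
    using least[OF mod, of v] Kpow that by blast
  have xK: "x \<in> K" using Kx[OF gen[OF n(1)]] by simp
  have inv: "inverse v \<in> K" if v: "v \<in> K" for v
  proof (cases "v = 0")
    case False
    then obtain c0 h where c: "c0 \<in> Z" "c0 \<noteq> 0" "h \<in> Zpoly" "c0 + v * poly h v = 0"
      by (rule annihilator_nonzero_const)
    have "poly h v \<in> K"
      by (rule poly_closed[OF c(3) v]) (use QK Z_subset_Q K mult in auto)
    then have "- inverse c0 * poly h v \<in> K"
      using c(1) by (intro K(3) Q.Z_uminus Q_inverse Z_subset_Q)
    moreover have "- inverse c0 * poly h v = inverse v"
      using c False by (simp add: field_simps add_eq_0_iff)
    ultimately show ?thesis by simp
  qed (use v in simp)
  show ?thesis using that[of bs] xK QK mult inv unfolding K_def by blast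
qed

end

section \<open>Valuation rings with finite residue field\<close>

text \<open>\<open>ram_index\<close> is phrased with powers of the maximal ideal in
  \<open>ideals_set\<close>; for a principal ideal these become powers of a generator.\<close>

lemma (in cring) PIdl_pow:
  assumes "x \<in> carrier R"
  shows "(PIdl x) [^]\<^bsub>ideals_set R\<^esub> (n::nat) = PIdl (x [^] n)"
proof (induction n)
  case 0
  have "a \<in> PIdl \<one>" if "a \<in> carrier R" for a
    using that by (auto simp: cgenideal_def intro!: exI[of _ a])
  then show ?case
    using ideal.Icarr[OF cgenideal_ideal[OF one_closed]]
    by (auto simp: nat_pow_def ideals_set_def)
next
  case (Suc n)
  have I: "ideal (PIdl (x [^] Suc n)) R" by (intro cgenideal_ideal nat_pow_closed assms)
  have "(PIdl x) [^]\<^bsub>ideals_set R\<^esub> Suc n = ideal_prod R (PIdl (x [^] n)) (PIdl x)"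
    using Suc by (simp add: nat_pow_def ideals_set_def)
  also have "\<dots> = PIdl (x [^] Suc n)"
  proof (intro equalityI subsetI)
    fix a assume "a \<in> ideal_prod R (PIdl (x [^] n)) (PIdl x)"
    then show "a \<in> PIdl (x [^] Suc n)"
    proof (induction rule: ideal_prod.induct)
      case (prod i j)
      then obtain b c where bc: "i = b \<otimes> x [^] n" "b \<in> carrier R" "j = c \<otimes> x" "c \<in> carrier R"
        by (auto simp: cgenideal_def)
      then have "i \<otimes> j = (b \<otimes> c) \<otimes> x [^] Suc n"
        using assms by (simp add: m_ac)
      then show ?case using bc by (auto simp: cgenideal_def)
    next
      case (sum a b)
      then show ?case using additive_subgroup.a_closed[OF ideal.axioms(1)[OF I]] by blast
    qed
  next
    fix a assume "a \<in> PIdl (x [^] Suc n)"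
    then obtain b where b: "b \<in> carrier R" "a = b \<otimes> x [^] Suc n" by (auto simp: cgenideal_def)
    then have "a = (b \<otimes> x [^] n) \<otimes> (\<one> \<otimes> x)" using assms by (simp add: m_ac)
    moreover have "b \<otimes> x [^] n \<in> PIdl (x [^] n)" "\<one> \<otimes> x \<in> PIdl x"
      using b by (auto simp: cgenideal_def)
    ultimately show "a \<in> ideal_prod R (PIdl (x [^] n)) (PIdl x)"
      using ideal_prod.prod by metis
  qed
  finally show ?case .
qed

context domain begin

abbreviation "nonunits \<equiv> carrier R - Units R"

lemma unit_if_factor_unit:
  assumes "a \<in> carrier R" "b \<in> carrier R" "a \<otimes> b \<in> Units R" shows "a \<in> Units R"
  using assms by (metis Units_inv_closed Units_r_inv m_assoc m_closed prod_unit_l unit_factor)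

context
  fixes p S
  assumes p: "p \<in> carrier R" "p \<noteq> \<zero>" "p \<notin> Units R"
    and total: "\<And>a b. a \<in> carrier R \<Longrightarrow> b \<in> carrier R \<Longrightarrow> a divides b \<or> b divides a"
    and S: "finite S" "S \<subseteq> carrier R"
      "\<And>x. x \<in> carrier R \<Longrightarrow> \<exists>s\<in>S. \<exists>y\<in>carrier R. x = s \<oplus> p \<otimes> y"
begin

text \<open>For sums, totality of divisibility lets one summand divide the other, and a + a c = a (1
  + c) is a multiple of a nonunit.\<close>

lemma nonunits_ideal: "ideal nonunits R"
proof -
  have mult: "x \<otimes> a \<in> nonunits" if "a \<in> nonunits" "x \<in> carrier R" for a x
    using that unit_if_factor_unit[of a x] by (auto simp: m_comm)
  have add': "a \<oplus> b \<in> nonunits" if ab: "a \<in> nonunits" "b \<in> nonunits" "a divides b" for a b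
  proof -
    obtain c where c: "c \<in> carrier R" "b = a \<otimes> c" using ab by (auto elim: dividesE)
    then have "a \<oplus> b = a \<otimes> (\<one> \<oplus> c)" using ab by (simp add: r_distr)
    then show ?thesis using mult[of a "\<one> \<oplus> c"] ab c m_comm[of a "\<one> \<oplus> c"] by simp
  qed
  have add: "a \<oplus> b \<in> nonunits" if "a \<in> nonunits" "b \<in> nonunits" for a b
    using add'[of a b] add'[of b a] that total[of a b] by (auto simp: a_comm)
  have zero: "\<zero> \<in> nonunits" by (auto simp: Units_def)
  show ?thesis
  proof (rule idealI)
    show "subgroup nonunits (add_monoid R)"
    proof (rule add.subgroupI)
      fix a assume "a \<in> nonunits"
      then show "\<ominus> a \<in> nonunits"
        using mult[of a "\<ominus> \<one>"] by (simp add: l_minus)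
    qed (use zero add in auto)
  qed (use mult in \<open>auto simp: ring_axioms m_comm\<close>)
qed

lemma ideal_nonunits:
  assumes "ideal J R" "J \<noteq> carrier R" shows "J \<subseteq> nonunits"
proof
  fix a assume a: "a \<in> J"
  then have "a \<in> carrier R" by (rule ideal.Icarr[OF assms(1)])
  moreover have "a \<notin> Units R"
  proof
    assume "a \<in> Units R"
    then have "\<one> \<in> J" using ideal.I_l_closed[OF assms(1) a, of "inv a"] by simp
    then show False using ideal.one_imp_carrier[OF assms(1)] assms(2) by simp
  qed
  ultimately show "a \<in> nonunits" by simp
qed

lemma nonunits_maximal: "maximalideal nonunits R"
proof (rule maximalidealI[OF nonunits_ideal])
  show "carrier R \<noteq> nonunits" by (metis DiffD2 Units_one_closed one_closed)
  fix J assume "ideal J R" "nonunits \<subseteq> J" "J \<subseteq> carrier R"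
  then show "J = nonunits \<or> J = carrier R" using ideal_nonunits by blast
qed

lemma maximalideal_unique: "maximalideal M R \<Longrightarrow> M = nonunits"
  by (metis ideal_nonunits maximalideal.I_maximal maximalideal.I_notcarr maximalideal.axioms(1)
      nonunits_ideal nonunits_maximal Diff_subset)

text \<open>Every nonunit is a nonunit from \<open>S\<close> plus a multiple of \<open>p\<close>. By
  totality the finite set of these representatives together with \<open>p\<close> contains an
  element dividing all the others, and this one generates.\<close>

lemma nonunits_principal:
  obtains \<pi> where "\<pi> \<in> nonunits" "\<And>x. x \<in> nonunits \<Longrightarrow> \<pi> divides x"
proof -
  interpret M: ideal nonunits R by (rule nonunits_ideal)
  have "\<exists>m\<in>F. \<forall>x\<in>F. m divides x" if "finite F" "F \<noteq> {}" "F \<subseteq> carrier R" for F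
    using that
  proof (induction F rule: finite_ne_induct)
    case (singleton a)
    then show ?case by (auto intro: divides_refl)
  next
    case (insert a F)
    then obtain m where m: "m \<in> F" "\<forall>x\<in>F. m divides x" by auto
    have am: "a \<in> carrier R" "m \<in> carrier R" using insert m by auto
    from total[OF am] show ?case
    proof
      assume "a divides m"
      then show ?thesis using m am divides_trans[of a m] by (auto intro: divides_refl)
    next
      assume "m divides a"
      then show ?thesis using m by auto
    qed
  qed
  moreover have "finite (insert p (S \<inter> nonunits))" "insert p (S \<inter> nonunits) \<subseteq> carrier R"
    using S(1) p by auto
  ultimately obtain \<pi>
    where \<pi>: "\<pi> \<in> insert p (S \<inter> nonunits)" "\<And>x. x \<in> insert p (S \<inter> nonunits) \<Longrightarrow> \<pi> divides x"
    by (meson insert_not_empty)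
  have "\<pi> \<in> nonunits" using \<pi>(1) p by auto
  moreover have "\<pi> divides x" if x: "x \<in> nonunits" for x
  proof -
    obtain s y where s: "s \<in> S" "y \<in> carrier R" "x = s \<oplus> p \<otimes> y" using S(3) x by blast
    then have sc: "s \<in> carrier R" using S(2) by auto
    have "p \<otimes> y \<in> nonunits" using p s by (intro M.I_r_closed) auto
    moreover have "s = x \<ominus> p \<otimes> y" using s sc p by (simp add: a_minus_def a_assoc r_neg)
    ultimately have "s \<in> nonunits" using x M.a_inv_closed M.a_closed by (auto simp: a_minus_def)
    then obtain c d where "c \<in> carrier R" "d \<in> carrier R" "s = \<pi> \<otimes> c" "p = \<pi> \<otimes> d"
      using \<pi>(2)[of s] \<pi>(2)[of p] s by (auto elim!: dividesE)
    then have "x = \<pi> \<otimes> (c \<oplus> d \<otimes> y)" "c \<oplus> d \<otimes> y \<in> carrier R"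
      using s \<open>\<pi> \<in> nonunits\<close> by (auto simp: r_distr m_assoc)
    then show ?thesis by (auto intro: dividesI)
  qed
  ultimately show ?thesis using that by blast
qed

lemma not_pow_divides:
  assumes "\<pi> \<in> nonunits" "\<pi> \<noteq> \<zero>" "i < j" shows "\<not> \<pi> [^] j divides \<pi> [^] (i::nat)"
proof
  assume "\<pi> [^] j divides \<pi> [^] i"
  then obtain c where c: "c \<in> carrier R" "\<pi> [^] i = \<pi> [^] j \<otimes> c" by (auto elim: dividesE)
  have pc: "\<pi> \<in> carrier R" using assms by simp
  have "\<pi> [^] k \<noteq> \<zero>" for k :: nat
    by (induction k) (use pc assms(2) in \<open>auto simp: integral_iff\<close>)
  note nz = this[of i]
  have ij: "\<pi> [^] j = \<pi> [^] i \<otimes> (\<pi> \<otimes> \<pi> [^] (j - Suc i))"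
    using assms(3) pc by (metis Suc_diff_Suc less_imp_le nat_pow_Suc2 nat_pow_mult le_add_diff_inverse)
  have "\<pi> [^] i = \<pi> [^] i \<otimes> (\<pi> \<otimes> \<pi> [^] (j - Suc i)) \<otimes> c"
    unfolding ij[symmetric] by (rule c(2))
  moreover have "b \<otimes> c = \<one>"
    if "a \<in> carrier R" "b \<in> carrier R" "a = a \<otimes> b \<otimes> c" "a \<noteq> \<zero>" for a b
    using that c(1) by (metis m_assoc m_closed m_lcancel one_closed r_one)
  ultimately have "(\<pi> \<otimes> \<pi> [^] (j - Suc i)) \<otimes> c = \<one>"
    using nz pc by (metis m_closed nat_pow_closed)
  then have "\<one> = \<pi> \<otimes> (\<pi> [^] (j - Suc i) \<otimes> c)"
    using pc c(1) by (simp add: m_assoc)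
  then have "\<pi> \<in> Units R" using assms c by (metis DiffD1 Units_one_closed m_closed nat_pow_closed unit_if_factor_unit)
  then show False using assms by simp
qed

text \<open>A pigeonhole argument modulo \<open>p\<close> shows that not all powers of
  \<open>\<pi>\<close> divide \<open>p\<close>; the largest one that does leaves a cofactor not
  divisible by \<open>\<pi>\<close>, hence a unit.\<close>

lemma p_pow_generator:
  assumes \<pi>: "\<pi> \<in> nonunits" "\<And>x. x \<in> nonunits \<Longrightarrow> \<pi> divides x"
  obtains e :: nat and u where "e > 0" "u \<in> Units R" "p = \<pi> [^] e \<otimes> u"
proof -
  interpret M: ideal nonunits R by (rule nonunits_ideal)
  have \<pi>0: "\<pi> \<noteq> \<zero>" using \<pi>(2)[of p] p by (auto elim!: dividesE)
  have pc: "\<pi> \<in> carrier R" using \<pi> by simp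
  have "\<exists>k::nat. \<not> \<pi> [^] k divides p"
  proof (rule ccontr)
    assume "\<nexists>k::nat. \<not> \<pi> [^] k divides p"
    then have all: "\<pi> [^] k divides p" for k :: nat by blast
    \<comment> \<open>Two powers share a representative, say with exponents i < j. Then
      \<open>p\<close> divides \<pi>^i (1 - \<pi>^(j - i)), whose second factor is a unit; so
      \<open>p\<close>, and with it \<pi>^(i + 1), divides \<pi>^i, which is absurd.\<close>
    obtain f y where f: "\<And>k. f k \<in> S" "\<And>k. y k \<in> carrier R" "\<And>k::nat. \<pi> [^] k = f k \<oplus> p \<otimes> y k"
      using S(3)[OF nat_pow_closed[OF pc]] by metis
    have "finite (range f)" using S(1) f(1) by (metis finite_subset image_subsetI)
    then have "\<not> inj f" using finite_imageD by blast
    then obtain i j where "i \<noteq> j" "f i = f j" by (auto simp: inj_def)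
    then obtain i j where ij: "i < j" "f i = f j" by (metis linorder_neqE_nat)
    have fi: "f i \<in> carrier R" using f S by auto
    have cancel: "(a \<oplus> b) \<ominus> (a \<oplus> c) = b \<ominus> c"
      if "a \<in> carrier R" "b \<in> carrier R" "c \<in> carrier R" for a b c
    proof -
      have "(a \<oplus> b) \<ominus> (a \<oplus> c) = (a \<oplus> \<ominus> a) \<oplus> (b \<oplus> \<ominus> c)"
        using that by (simp add: a_minus_def minus_add a_ac del: r_neg)
      then show ?thesis using that by (simp add: a_minus_def r_neg)
    qed
    define d where "d = j - i"
    have d: "d > 0" "j = i + d" using ij by (auto simp: d_def)
    have eq: "\<pi> [^] i \<otimes> (\<one> \<ominus> \<pi> [^] d) = p \<otimes> (y i \<ominus> y j)"
    proof -
      have "\<pi> [^] i \<otimes> (\<one> \<ominus> \<pi> [^] d) = \<pi> [^] i \<ominus> \<pi> [^] j"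
        using pc d by (simp add: a_minus_def r_distr r_minus nat_pow_mult)
      also have "\<dots> = (f i \<oplus> p \<otimes> y i) \<ominus> (f i \<oplus> p \<otimes> y j)" using f(3) ij(2) by metis
      also have "\<dots> = p \<otimes> (y i \<ominus> y j)"
        using cancel[OF fi, of "p \<otimes> y i" "p \<otimes> y j"] f(2) p(1)
        by (simp add: a_minus_def r_distr r_minus)
      finally show ?thesis .
    qed
    have "\<pi> [^] d \<in> nonunits"
      using d \<pi> by (metis M.I_l_closed gr0_conv_Suc nat_pow_Suc nat_pow_closed pc)
    moreover have "\<one> = (\<one> \<ominus> \<pi> [^] d) \<oplus> \<pi> [^] d"
      using pc by (simp add: a_minus_def a_assoc l_neg)
    ultimately have "\<one> \<ominus> \<pi> [^] d \<notin> nonunits"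
      by (metis DiffD2 M.a_closed Units_one_closed)
    then have u: "\<one> \<ominus> \<pi> [^] d \<in> Units R" using pc by simp
    then have "\<pi> [^] i = (\<pi> [^] i \<otimes> (\<one> \<ominus> \<pi> [^] d)) \<otimes> inv (\<one> \<ominus> \<pi> [^] d)"
      using pc by (simp add: m_assoc)
    also have "\<dots> = p \<otimes> ((y i \<ominus> y j) \<otimes> inv (\<one> \<ominus> \<pi> [^] d))"
      unfolding eq using u p(1) f(2) by (simp add: m_assoc)
    finally have "p divides \<pi> [^] i" using u f(2) by (auto intro: dividesI)
    then have "\<pi> [^] Suc i divides \<pi> [^] i" using all[of "Suc i"] divides_trans[OF _ _ nat_pow_closed[OF pc]] by blast
    then show False using not_pow_divides[OF \<pi>(1) \<pi>0, of i "Suc i"] by simp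
  qed
  then have nd: "\<not> \<pi> [^] (LEAST k. \<not> \<pi> [^] (k::nat) divides p) divides p" by (rule LeastI_ex)
  have "\<pi> [^] (0::nat) divides p" using p by (auto intro: dividesI)
  then obtain e where e: "(LEAST k. \<not> \<pi> [^] (k::nat) divides p) = Suc e"
    using nd by (metis not0_implies_Suc)
  have "\<pi> [^] e divides p" using not_less_Least[of e "\<lambda>k. \<not> \<pi> [^] (k::nat) divides p"] e by auto
  then obtain u where u: "u \<in> carrier R" "p = \<pi> [^] e \<otimes> u" by (auto elim: dividesE)
  have "u \<in> Units R"
  proof (rule ccontr)
    assume "u \<notin> Units R"
    then obtain c where "c \<in> carrier R" "u = \<pi> \<otimes> c" using \<pi>(2)[of u] u by (auto elim: dividesE)
    then have "p = \<pi> [^] Suc e \<otimes> c" using u pc by (simp add: m_assoc)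
    then have "\<pi> [^] Suc e divides p" using dividesI[OF \<open>c \<in> carrier R\<close>] by blast
    then show False using nd[unfolded e] by contradiction
  qed
  moreover have "e > 0"
  proof (rule ccontr)
    assume "\<not> e > 0"
    then show False using u p \<open>u \<in> Units R\<close> by simp
  qed
  ultimately show ?thesis using that u(2) by blast
qed

text \<open>The equivalence for \<open>n\<close> evaluates the definite description in
  \<open>ram_index\<close>; the last claim is the form in which the exponent enters the local
  bound.\<close>

lemma ramification:
  obtains e :: nat where "e > 0"
    "\<And>n::nat. PIdl p = nonunits [^]\<^bsub>ideals_set R\<^esub> n \<longleftrightarrow> n = e"
    "\<And>x. x \<in> nonunits \<Longrightarrow> p divides x [^] e"
proof -
  obtain \<pi> where \<pi>: "\<pi> \<in> nonunits" "\<And>x. x \<in> nonunits \<Longrightarrow> \<pi> divides x"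
    using nonunits_principal by blast
  have pc: "\<pi> \<in> carrier R" using \<pi> by simp
  have \<pi>0: "\<pi> \<noteq> \<zero>" using \<pi>(2)[of p] p by (auto elim!: dividesE)
  obtain e :: nat and u where e: "e > 0" "u \<in> Units R" "p = \<pi> [^] e \<otimes> u"
    using p_pow_generator[OF \<pi>] by blast
  have PIdl_le: "PIdl a \<subseteq> PIdl b \<longleftrightarrow> b divides a" if "a \<in> carrier R" "b \<in> carrier R" for a b
    using that to_contain_is_to_divide by blast
  have p\<pi>: "p divides \<pi> [^] e"
  proof (rule dividesI)
    show "\<pi> [^] e = p \<otimes> inv u" using e pc Units_closed[OF e(2)] by (simp add: m_assoc)
  qed (use e in simp)
  have \<pi>p: "\<pi> [^] e divides p" using e by (auto intro: dividesI)
  have M: "nonunits = PIdl \<pi>"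
  proof
    show "nonunits \<subseteq> PIdl \<pi>"
    proof
      fix x assume "x \<in> nonunits"
      with \<pi>(2)[OF this] show "x \<in> PIdl \<pi>" using pc
        by (auto simp: cgenideal_def m_comm elim!: dividesE)
    qed
    show "PIdl \<pi> \<subseteq> nonunits" using cgenideal_minimal[OF nonunits_ideal \<pi>(1)] .
  qed
  have "PIdl p = nonunits [^]\<^bsub>ideals_set R\<^esub> n \<longleftrightarrow> n = e" for n :: nat
  proof -
    have "PIdl p = PIdl (\<pi> [^] n) \<longleftrightarrow> n = e"
    proof
      assume "PIdl p = PIdl (\<pi> [^] n)"
      then have "PIdl p \<subseteq> PIdl (\<pi> [^] n)" "PIdl (\<pi> [^] n) \<subseteq> PIdl p" by blast+
      then have "p divides \<pi> [^] n" "\<pi> [^] n divides p"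
        using PIdl_le[OF p(1) nat_pow_closed[OF pc]] PIdl_le[OF nat_pow_closed[OF pc] p(1)] by auto
      then have "\<pi> [^] e divides \<pi> [^] n" "\<pi> [^] n divides \<pi> [^] e"
        using divides_trans[OF \<pi>p] divides_trans[OF _ p\<pi>] pc by auto
      then show "n = e" using not_pow_divides[OF \<pi>(1) \<pi>0] by (metis linorder_neqE_nat)
    next
      assume "n = e"
      then show "PIdl p = PIdl (\<pi> [^] n)"
        using PIdl_le[OF p(1) nat_pow_closed[OF pc]] PIdl_le[OF nat_pow_closed[OF pc] p(1)] \<pi>p p\<pi> by auto
    qed
    then show ?thesis unfolding M PIdl_pow[OF pc] .
  qed
  moreover have "p divides x [^] e" if x: "x \<in> nonunits" for x
  proof -
    obtain c where "c \<in> carrier R" "x = \<pi> \<otimes> c" using \<pi>(2)[OF x] by (auto elim: dividesE)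
    then have "x [^] e = \<pi> [^] e \<otimes> c [^] e" "c [^] e \<in> carrier R" using pc by (auto simp: nat_pow_distrib)
    then have "\<pi> [^] e divides x [^] e" by (auto intro: dividesI)
    then show ?thesis using p\<pi> p divides_trans by blast
  qed
  ultimately show ?thesis using e(1) that by blast
qed

text \<open>The nonunits contain all multiples of \<open>p\<close>, so \<open>S\<close> meets every
  coset. Finiteness matters because \<open>residue_card\<close> is a \<open>card\<close>, which
  would be 0 for an infinite field.\<close>

lemma finite_residue_field: "finite (carrier (R Quot nonunits))"
proof -
  interpret M: ideal nonunits R by (rule nonunits_ideal)
  have "carrier (R Quot nonunits) \<subseteq> (\<lambda>s. nonunits +> s) ` S"
  proof
    fix A assume "A \<in> carrier (R Quot nonunits)"
    then obtain x where x: "x \<in> carrier R" "A = nonunits +> x"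
      by (auto simp: FactRing_def A_RCOSETS_def')
    obtain s y where s: "s \<in> S" "y \<in> carrier R" "x = s \<oplus> p \<otimes> y" using S(3) x by blast
    have sc: "s \<in> carrier R" using s S by auto
    have "p \<otimes> y \<in> nonunits" using p s by (intro M.I_r_closed) auto
    then have "x \<in> nonunits +> s"
      using s sc p unfolding a_r_coset_def' by (auto simp: a_comm intro!: bexI[of _ "p \<otimes> y"])
    then have "A = nonunits +> s" using x(2) M.a_repr_independence' sc by simp
    then show "A \<in> (\<lambda>s. nonunits +> s) ` S" using s by auto
  qed
  then show ?thesis using S(1) finite_surj by blast
qed

end
end

section \<open>The field of \<open>p\<close>-adic numbers\<close>

locale prime_nat =
  fixes p :: nat
  assumes prime_p: "prime p"
begin

lemma p_gt_1: "p > 1" using prime_p by (rule prime_gt_1_nat)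

text \<open>The definition reads the reduced fraction; cross-multiplication shows that any other
  fraction gives the same difference of multiplicities.\<close>

lemma padic_val_rat_quotient:
  assumes "a \<noteq> 0" "b \<noteq> 0"
  shows "padic_val_rat p (of_int a / of_int b) = int (multiplicity (int p) a) - int (multiplicity (int p) b)"
proof -
  obtain c d where cd: "quotient_of (of_int a / of_int b) = (c, d)" by (cases "quotient_of (of_int a / of_int b)")
  have d: "d > 0" using quotient_of_denom_pos[OF cd] .
  have eq: "of_int a / of_int b = (of_int c / of_int d :: rat)" using quotient_of_div[OF cd] .
  then have "(of_int (a * d) :: rat) = of_int (c * b)" using assms d by (simp add: field_simps)
  then have ad: "a * d = c * b" by (simp only: of_int_eq_iff)
  have "c \<noteq> 0" using eq assms d by auto
  have pe: "prime_elem (int p)" using prime_p by simp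
  have "multiplicity (int p) a + multiplicity (int p) d = multiplicity (int p) c + multiplicity (int p) b"
    using arg_cong[OF ad, of "multiplicity (int p)"] assms d \<open>c \<noteq> 0\<close>
    by (simp add: prime_elem_multiplicity_mult_distrib[OF pe])
  then show ?thesis unfolding padic_val_rat_def cd by simp
qed

lemma rat_as_quotient:
  fixes x :: rat
  obtains a b where "b > 0" "x = of_int a / of_int b"
  by (metis prod.exhaust quotient_of_denom_pos quotient_of_div)

text \<open>Gives 0 infinite valuation, although \<open>padic_val_rat p 0\<close> evaluates to 0.
  Integer thresholds replace real absolute values in most of the convergence arguments.\<close>

definition val_ge :: "int \<Rightarrow> rat \<Rightarrow> bool" where
  "val_ge k x \<longleftrightarrow> x = 0 \<or> padic_val_rat p x \<ge> k"

lemma val_mult: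
  assumes "x \<noteq> 0" "y \<noteq> 0"
  shows "padic_val_rat p (x * y) = padic_val_rat p x + padic_val_rat p y"
proof -
  obtain a b where ab: "b > 0" "x = of_int a / of_int b" by (rule rat_as_quotient)
  obtain c d where cd: "d > 0" "y = of_int c / of_int d" by (rule rat_as_quotient)
  have nz: "a \<noteq> 0" "b \<noteq> 0" "c \<noteq> 0" "d \<noteq> 0" using ab cd assms by auto
  have pe: "prime_elem (int p)" using prime_p by simp
  have e: "x * y = of_int (a * c) / of_int (b * d)" using ab cd by simp
  have "padic_val_rat p (x * y) = int (multiplicity (int p) (a * c)) - int (multiplicity (int p) (b * d))"
    unfolding e by (rule padic_val_rat_quotient) (use nz in auto)
  then show ?thesis using padic_val_rat_quotient[of a b] padic_val_rat_quotient[of c d] nz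
    unfolding ab(2) cd(2) by (simp add: prime_elem_multiplicity_mult_distrib[OF pe])
qed

lemma val_ge_mult: "val_ge k x \<Longrightarrow> val_ge l y \<Longrightarrow> val_ge (k + l) (x * y)"
  using val_mult[of x y] by (cases "x = 0 \<or> y = 0") (auto simp: val_ge_def)

lemma val_ge_0: "val_ge k 0" by (simp add: val_ge_def)

lemma val_ge_mono: "val_ge k x \<Longrightarrow> l \<le> k \<Longrightarrow> val_ge l x" by (auto simp: val_ge_def)

lemma val_of_int: "padic_val_rat p (of_int m) = int (multiplicity (int p) m)" if "m \<noteq> 0"
  using padic_val_rat_quotient[OF that, of 1] by simp

lemma val_ge_of_int: "val_ge 0 (of_int m)"
  using val_of_int[of m] by (cases "m = 0") (auto simp: val_ge_def)

lemma val_ge_of_int_iff: "val_ge (int k) (of_int m) \<longleftrightarrow> int p ^ k dvd m"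
proof (cases "m = 0")
  case False
  have "int p ^ k dvd m \<longleftrightarrow> k \<le> multiplicity (int p) m"
    using False p_gt_1 by (intro power_dvd_iff_le_multiplicity) auto
  then show ?thesis using val_of_int[OF False] False by (simp add: val_ge_def)
qed (simp add: val_ge_def)

lemma val_ge_add:
  assumes "val_ge k x" "val_ge k y" shows "val_ge k (x + y)"
proof (cases "x = 0 \<or> y = 0 \<or> x + y = 0")
  case False
  obtain a b where ab: "b > 0" "x = of_int a / of_int b" by (rule rat_as_quotient)
  obtain c d where cd: "d > 0" "y = of_int c / of_int d" by (rule rat_as_quotient)
  have xy: "x = of_int (a * d) / of_int (b * d)" "y = of_int (c * b) / of_int (b * d)"
    "x + y = of_int (a * d + c * b) / of_int (b * d)"
    using ab cd by (simp_all add: field_simps)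
  have "a * d + c * b \<noteq> 0"
  proof
    assume "a * d + c * b = 0"
    then have "x + y = 0" by (simp only: xy(3) of_int_0 div_0)
    then show False using False by simp
  qed
  then have nz: "a * d \<noteq> 0" "c * b \<noteq> 0" "a * d + c * b \<noteq> 0" "b * d \<noteq> 0"
    using False xy(1,2) by auto
  define m where "m = min (multiplicity (int p) (a * d)) (multiplicity (int p) (c * b))"
  have "int p ^ m dvd a * d" "int p ^ m dvd c * b"
    unfolding m_def by (auto intro: multiplicity_dvd')
  then have "int p ^ m dvd a * d + c * b" by (rule dvd_add)
  then have "m \<le> multiplicity (int p) (a * d + c * b)"
    using nz p_gt_1 by (intro multiplicity_geI) auto
  moreover have "k \<le> int (multiplicity (int p) (a * d)) - int (multiplicity (int p) (b * d))"
    using assms(1) False padic_val_rat_quotient[OF nz(1,4)] unfolding xy(1)[symmetric] by (simp add: val_ge_def)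
  moreover have "k \<le> int (multiplicity (int p) (c * b)) - int (multiplicity (int p) (b * d))"
    using assms(2) False padic_val_rat_quotient[OF nz(2,4)] unfolding xy(2)[symmetric] by (simp add: val_ge_def)
  ultimately have "k \<le> int (multiplicity (int p) (a * d + c * b)) - int (multiplicity (int p) (b * d))"
    unfolding m_def by linarith
  then show ?thesis
    using padic_val_rat_quotient[OF nz(3,4)] unfolding xy(3)[symmetric] by (simp add: val_ge_def)
qed (use assms in \<open>auto simp: val_ge_0\<close>)

lemma val_ge_uminus: "val_ge k x \<Longrightarrow> val_ge k (- x)"
  using val_ge_mult[OF val_ge_of_int[of "-1"], of k x] by simp

lemma val_ge_diff: "val_ge k x \<Longrightarrow> val_ge k y \<Longrightarrow> val_ge k (x - y)"
  using val_ge_add[of k x "- y"] val_ge_uminus by simp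

lemma val_p_power: "padic_val_rat p (of_nat p ^ k) = int k"
proof -
  have "padic_val_rat p (of_int (int p ^ k)) = int (multiplicity (int p) (int p ^ k))"
    using p_gt_1 by (intro val_of_int) auto
  then show ?thesis using p_gt_1 prime_p by (simp add: multiplicity_same_power)
qed

lemma val_ge_p_power_mult: "val_ge (int k + l) (of_nat p ^ k * x) \<longleftrightarrow> val_ge l x"
  using val_mult[of "of_nat p ^ k" x] p_gt_1 by (cases "x = 0") (auto simp: val_ge_def val_p_power)

lemma val_ge_1_1: "\<not> val_ge 1 1"
  using val_ge_of_int_iff[of 1 1] p_gt_1 by simp

lemma val_ge_inverse:
  assumes "\<not> val_ge (k + 1) x" shows "val_ge (- k) (inverse x)"
proof -
  have x: "x \<noteq> 0" using assms by (auto simp: val_ge_0)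
  have "padic_val_rat p 1 = 0" using val_of_int[of 1] by simp
  then have "padic_val_rat p x + padic_val_rat p (inverse x) = 0"
    using val_mult[of x "inverse x"] x by simp
  then show ?thesis using assms x by (auto simp: val_ge_def)
qed

text \<open>In lowest terms the denominator \<open>b\<close> is prime to p. With \<open>u\<close>
  inverse to \<open>b\<close> modulo p, taken from a Bezout relation, the residue is a u mod
  p.\<close>

lemma val_ge_residue:
  assumes "val_ge 0 x" shows "\<exists>c<p. val_ge 1 (x - of_nat c)"
proof -
  obtain a b where ab: "b > 0" "x = of_int a / of_int b" "coprime a b"
    by (metis prod.exhaust quotient_of_coprime quotient_of_denom_pos quotient_of_div)
  have "\<not> int p dvd b"
  proof
    assume pb: "int p dvd b"
    then have "\<not> int p dvd a" using coprime_common_divisor[OF ab(3), of "int p"] p_gt_1 by auto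
    then have "multiplicity (int p) a = 0" "a \<noteq> 0" by (auto simp: not_dvd_imp_multiplicity_0)
    moreover have "multiplicity (int p) b > 0"
      using pb ab(1) p_gt_1 by (simp add: multiplicity_gt_zero_iff)
    ultimately show False using assms padic_val_rat_quotient[of a b] ab by (auto simp: val_ge_def)
  qed
  then have cop: "coprime b (int p)" using prime_p
    by (metis coprime_commute prime_imp_coprime prime_nat_int_transfer)
  then obtain u v where uv: "u * b + v * int p = 1" using bezout_int[of b "int p"] by auto
  define c where "c = nat ((a * u) mod int p)"
  have c: "int c = (a * u) mod int p" using p_gt_1 by (simp add: c_def)
  have "a * u = int p * (a * u div int p) + int c" unfolding c by simp
  then have "a * u * b = int p * (a * u div int p) * b + int c * b" by (metis distrib_right)
  moreover have "a * u * b + a * v * int p = a" using uv by (metis distrib_left mult.assoc mult.right_neutral)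
  ultimately have "a - int c * b = int p * (a * v + (a * u div int p) * b)"
    by (simp add: algebra_simps)
  then have "val_ge 1 (of_int (a - int c * b))" using val_ge_of_int_iff[of 1 "a - int c * b"] by simp
  moreover have "val_ge 0 (inverse (of_int b))"
  proof -
    have "\<not> val_ge (0 + 1) (of_int b)" using val_ge_of_int_iff[of 1 b] \<open>\<not> int p dvd b\<close> by simp
    from val_ge_inverse[OF this] show ?thesis by simp
  qed
  ultimately have "val_ge (1 + 0) (of_int (a - int c * b) * inverse (of_int b))" by (rule val_ge_mult)
  moreover have "of_int (a - int c * b) * inverse (of_int b) = x - of_nat c"
    using ab by (simp add: field_simps)
  moreover have "c < p" using p_gt_1 c by (simp add: c_def nat_less_iff)
  ultimately show ?thesis by auto
qed

lemma abs_rat_le_iff: "padic_abs_rat p x \<le> real p powi (- k) \<longleftrightarrow> val_ge k x"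
proof (cases "x = 0")
  case False
  have "real p > 1" using p_gt_1 by simp
  then show ?thesis
    using False power_int_increasing[of "- padic_val_rat p x" "- k" "real p"]
      power_int_strict_increasing[of "- k" "- padic_val_rat p x" "real p"]
    by (auto simp: padic_abs_rat_def val_ge_def linorder_not_le[symmetric])
qed (use p_gt_1 in \<open>simp add: padic_abs_rat_def val_ge_def\<close>)

lemma abs_rat_less_iff: "padic_abs_rat p x < real p powi (- k) \<longleftrightarrow> val_ge (k + 1) x"
proof (cases "x = 0")
  case False
  have "real p > 1" using p_gt_1 by simp
  then show ?thesis
    using False power_int_strict_increasing[of "- padic_val_rat p x" "- k" "real p"]
      power_int_increasing[of "- k" "- padic_val_rat p x" "real p"]
    by (cases "padic_val_rat p x \<ge> k + 1") (auto simp: padic_abs_rat_def val_ge_def)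
qed (use p_gt_1 in \<open>simp add: padic_abs_rat_def val_ge_def\<close>)

lemma abs_rat_nonneg: "padic_abs_rat p x \<ge> 0"
  by (simp add: padic_abs_rat_def)

lemma small_power: "\<epsilon> > 0 \<Longrightarrow> \<exists>k::nat. real p powi (- int k) < \<epsilon>"
  using real_arch_pow_inv[of \<epsilon> "1 / real p"] p_gt_1
  by (auto simp: power_int_minus field_simps)

lemma abs_rat_triangle: "padic_abs_rat p (x + y) \<le> padic_abs_rat p x + padic_abs_rat p y"
proof -
  have *: "padic_abs_rat p (x + y) \<le> padic_abs_rat p x"
    if "y = 0 \<or> (x \<noteq> 0 \<and> padic_val_rat p x \<le> padic_val_rat p y)" for x y
  proof (cases "y = 0 \<or> x = 0")
    case False
    with that have le: "x \<noteq> 0" "padic_val_rat p x \<le> padic_val_rat p y" by auto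
    then have "val_ge (padic_val_rat p x) (x + y)" by (intro val_ge_add) (auto simp: val_ge_def)
    then show ?thesis using le abs_rat_le_iff by (metis padic_abs_rat_def)
  qed (use that in auto)
  have "padic_abs_rat p (x + y) \<le> padic_abs_rat p x \<or> padic_abs_rat p (x + y) \<le> padic_abs_rat p y"
    using *[of y x] *[of x y] by (metis add.commute linear)
  then show ?thesis using abs_rat_nonneg[of x] abs_rat_nonneg[of y] by linarith
qed

section \<open>Cauchy sequences and null sequences for the p-adic absolute value\<close>

abbreviation ev_ge :: "int \<Rightarrow> (nat \<Rightarrow> rat) \<Rightarrow> bool" where
  "ev_ge k x \<equiv> \<forall>\<^sub>F n in sequentially. val_ge k (x n)"

lemma padic_Cauchy_iff:
  "padic_Cauchy p x \<longleftrightarrow> (\<forall>k. \<exists>N. \<forall>m\<ge>N. \<forall>n\<ge>N. val_ge k (x m - x n))"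
proof
  assume L: "padic_Cauchy p x"
  show "\<forall>k. \<exists>N. \<forall>m\<ge>N. \<forall>n\<ge>N. val_ge k (x m - x n)"
  proof
    fix k
    have "real p powi (- (k - 1)) > 0" using p_gt_1 by simp
    then obtain N where "\<forall>m\<ge>N. \<forall>n\<ge>N. padic_abs_rat p (x m - x n) < real p powi (- (k - 1))"
      using L unfolding padic_Cauchy_def by blast
    then show "\<exists>N. \<forall>m\<ge>N. \<forall>n\<ge>N. val_ge k (x m - x n)"
      unfolding abs_rat_less_iff by auto
  qed
next
  assume R: "\<forall>k. \<exists>N. \<forall>m\<ge>N. \<forall>n\<ge>N. val_ge k (x m - x n)"
  show "padic_Cauchy p x" unfolding padic_Cauchy_def
  proof (intro allI impI)
    fix \<epsilon> :: real assume "\<epsilon> > 0"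
    then obtain k where "real p powi (- int k) < \<epsilon>" using small_power by blast
    moreover obtain N where "\<forall>m\<ge>N. \<forall>n\<ge>N. val_ge (int k) (x m - x n)" using R by blast
    ultimately show "\<exists>N. \<forall>m\<ge>N. \<forall>n\<ge>N. padic_abs_rat p (x m - x n) < \<epsilon>"
      using abs_rat_le_iff by (meson order_le_less_trans)
  qed
qed

lemma padic_null_iff:
  "x \<in> padic_null p \<longleftrightarrow> (\<forall>k. ev_ge k x)"
proof -
  have "x \<in> padic_null p \<longleftrightarrow> (\<forall>\<epsilon>>0. eventually (\<lambda>n. padic_abs_rat p (x n) < \<epsilon>) sequentially)"
    by (simp add: padic_null_def tendsto_iff dist_real_def abs_rat_nonneg)
  also have "\<dots> \<longleftrightarrow> (\<forall>k. ev_ge k x)"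
  proof
    assume L: "\<forall>\<epsilon>>0. eventually (\<lambda>n. padic_abs_rat p (x n) < \<epsilon>) sequentially"
    show "\<forall>k. ev_ge k x"
    proof
      fix k
      have "real p powi (- (k - 1)) > 0" using p_gt_1 by simp
      then show "ev_ge k x"
        using L abs_rat_less_iff[of _ "k - 1"] by force
    qed
  next
    assume R: "\<forall>k. ev_ge k x"
    show "\<forall>\<epsilon>>0. eventually (\<lambda>n. padic_abs_rat p (x n) < \<epsilon>) sequentially"
    proof (intro allI impI)
      fix \<epsilon> :: real assume "\<epsilon> > 0"
      then obtain k where k: "real p powi (- int k) < \<epsilon>" using small_power by blast
      show "eventually (\<lambda>n. padic_abs_rat p (x n) < \<epsilon>) sequentially"
        using spec[OF R, of "int k"]
        by eventually_elim (use abs_rat_le_iff k in \<open>meson order_le_less_trans\<close>)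
    qed
  qed
  finally show ?thesis .
qed

lemma Cauchy_const: "padic_Cauchy p (\<lambda>_. c)"
  by (simp add: padic_Cauchy_iff val_ge_0)

lemma Cauchy_add:
  assumes "padic_Cauchy p x" "padic_Cauchy p y" shows "padic_Cauchy p (\<lambda>n. x n + y n)"
  unfolding padic_Cauchy_iff
proof
  fix k
  obtain N M where "\<forall>m\<ge>N. \<forall>n\<ge>N. val_ge k (x m - x n)" "\<forall>m\<ge>M. \<forall>n\<ge>M. val_ge k (y m - y n)"
    using assms unfolding padic_Cauchy_iff by meson
  then have "\<forall>m\<ge>max N M. \<forall>n\<ge>max N M. val_ge k ((x m - x n) + (y m - y n))"
    by (auto intro: val_ge_add)
  then show "\<exists>N. \<forall>m\<ge>N. \<forall>n\<ge>N. val_ge k (x m + y m - (x n + y n))"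
    by (auto simp: algebra_simps intro!: exI[of _ "max N M"])
qed

text \<open>Beyond an index where all differences are integral, the valuations are bounded below
  through a single term. The bound is made nonpositive so that its negative can serve as an exponent
  clearing denominators.\<close>

lemma Cauchy_bounded:
  assumes "padic_Cauchy p x" shows "\<exists>k\<le>0. ev_ge k x"
proof -
  obtain N where N: "\<forall>m\<ge>N. \<forall>n\<ge>N. val_ge 0 (x m - x n)"
    using assms unfolding padic_Cauchy_iff by meson
  define k where "k = min 0 (padic_val_rat p (x N))"
  have "val_ge k (x n)" if "n \<ge> N" for n
  proof -
    have "val_ge k (x n - x N)" using N that by (auto intro: val_ge_mono[of 0] simp: k_def)
    moreover have "val_ge k (x N)" by (auto simp: val_ge_def k_def)
    ultimately show ?thesis using val_ge_add by fastforce
  qed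
  then show ?thesis unfolding eventually_sequentially by (intro exI[of _ k]) (auto simp: k_def)
qed

lemma Cauchy_mult:
  assumes "padic_Cauchy p x" "padic_Cauchy p y" shows "padic_Cauchy p (\<lambda>n. x n * y n)"
  unfolding padic_Cauchy_iff
proof
  fix k
  obtain i j A B where ij: "\<And>n. n \<ge> A \<Longrightarrow> val_ge i (x n)" "\<And>n. n \<ge> B \<Longrightarrow> val_ge j (y n)"
    using Cauchy_bounded[OF assms(1)] Cauchy_bounded[OF assms(2)] unfolding eventually_sequentially by blast
  obtain N M where N: "\<forall>m\<ge>N. \<forall>n\<ge>N. val_ge (k - j) (x m - x n)" and M: "\<forall>m\<ge>M. \<forall>n\<ge>M. val_ge (k - i) (y m - y n)"
    using assms unfolding padic_Cauchy_iff by meson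
  have "val_ge k (x m * y m - x n * y n)" if mn: "m \<ge> max (max A B) (max N M)" "n \<ge> max (max A B) (max N M)" for m n
  proof -
    have "val_ge (i + (k - i)) (x m * (y m - y n))" "val_ge ((k - j) + j) ((x m - x n) * y n)"
      using mn N M by (intro val_ge_mult ij; force)+
    then have "val_ge k (x m * (y m - y n) + (x m - x n) * y n)" by (intro val_ge_add) auto
    then show ?thesis by (simp add: algebra_simps)
  qed
  then show "\<exists>N. \<forall>m\<ge>N. \<forall>n\<ge>N. val_ge k (x m * y m - x n * y n)" by blast
qed

lemma Cauchy_uminus: "padic_Cauchy p x \<Longrightarrow> padic_Cauchy p (\<lambda>n. - x n)"
  using Cauchy_mult[OF Cauchy_const[of "-1"], of x] by simp

lemma Cauchy_diff: "padic_Cauchy p x \<Longrightarrow> padic_Cauchy p y \<Longrightarrow> padic_Cauchy p (\<lambda>n. x n - y n)"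
  using Cauchy_add[OF _ Cauchy_uminus, of x y] by simp

lemma null_Cauchy: "x \<in> padic_null p \<Longrightarrow> padic_Cauchy p x"
  unfolding padic_Cauchy_iff padic_null_iff eventually_sequentially by (meson val_ge_diff)

lemma null_add: "x \<in> padic_null p \<Longrightarrow> y \<in> padic_null p \<Longrightarrow> (\<lambda>n. x n + y n) \<in> padic_null p"
  unfolding padic_null_iff using eventually_elim2 val_ge_add by (smt (verit, best))

lemma null_mult:
  assumes "x \<in> padic_null p" "padic_Cauchy p y" shows "(\<lambda>n. x n * y n) \<in> padic_null p"
  unfolding padic_null_iff
proof
  fix k
  obtain j where j: "ev_ge j y" using Cauchy_bounded[OF assms(2)] by blast
  have "eventually (\<lambda>n. val_ge (k - j) (x n)) sequentially" using assms(1) by (simp add: padic_null_iff)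
  with j show "ev_ge k (\<lambda>n. (x n * y n))"
    by eventually_elim (use val_ge_mult[of "k - j" _ j] in auto)
qed

text \<open>A Cauchy sequence that is not null has valuations eventually bounded above, so only
  finitely many terms vanish. At those \<open>inverse 0 = 0\<close> and the product is not 1, so
  inverses are obtained modulo null sequences.\<close>

lemma Cauchy_inverse:
  assumes "padic_Cauchy p x" "x \<notin> padic_null p"
  shows "padic_Cauchy p (\<lambda>n. inverse (x n))" "(\<lambda>n. x n * inverse (x n) - 1) \<in> padic_null p"
proof -
  obtain k where k: "\<not> ev_ge k x"
    using assms(2) by (auto simp: padic_null_iff)
  obtain N where N: "\<forall>m\<ge>N. \<forall>n\<ge>N. val_ge k (x m - x n)"
    using assms(1) unfolding padic_Cauchy_iff by meson
  obtain M where M: "M \<ge> N" "\<not> val_ge k (x M)" using k unfolding eventually_sequentially by auto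
  have nk: "\<not> val_ge k (x n)" if "n \<ge> N" for n
    using N M that val_ge_add[of k "x M - x n" "x n"] by auto
  have nz: "x n \<noteq> 0" if "n \<ge> N" for n using nk[OF that] val_ge_0 by metis
  have iv: "val_ge (1 - k) (inverse (x n))" if "n \<ge> N" for n
    using val_ge_inverse[of "k - 1"] nk[OF that] by simp
  show "padic_Cauchy p (\<lambda>n. inverse (x n))" unfolding padic_Cauchy_iff
  proof
    fix j
    obtain L where L: "\<forall>m\<ge>L. \<forall>n\<ge>L. val_ge (j - 2 * (1 - k)) (x m - x n)"
      using assms(1) unfolding padic_Cauchy_iff by meson
    have "val_ge j (inverse (x m) - inverse (x n))" if mn: "m \<ge> max N L" "n \<ge> max N L" for m n
    proof -
      have "val_ge ((1 - k) + (1 - k) + (j - 2 * (1 - k))) (inverse (x m) * inverse (x n) * (x n - x m))"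
        using mn L by (intro val_ge_mult iv) auto
      moreover have "inverse (x m) * inverse (x n) * (x n - x m) = inverse (x m) - inverse (x n)"
        using nz[of m] nz[of n] mn by (simp add: field_simps)
      ultimately show ?thesis by simp
    qed
    then show "\<exists>N. \<forall>m\<ge>N. \<forall>n\<ge>N. val_ge j (inverse (x m) - inverse (x n))" by blast
  qed
  show "(\<lambda>n. x n * inverse (x n) - 1) \<in> padic_null p"
    unfolding padic_null_iff eventually_sequentially
    using nz val_ge_0 by (auto intro!: exI[of _ N])
qed

section \<open>The ring of Cauchy sequences modulo null sequences\<close>

abbreviation "CR \<equiv> padic_Cauchy_ring p"

lemma CR_simps:
  "carrier CR = {x. padic_Cauchy p x}" "x \<otimes>\<^bsub>CR\<^esub> y = (\<lambda>n. x n * y n)" "\<one>\<^bsub>CR\<^esub> = (\<lambda>n. 1)"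
  "\<zero>\<^bsub>CR\<^esub> = (\<lambda>n. 0)" "x \<oplus>\<^bsub>CR\<^esub> y = (\<lambda>n. x n + y n)"
  by (simp_all add: padic_Cauchy_ring_def)

lemma cring_CR: "cring CR"
proof (rule cringI)
  show "abelian_group CR"
  proof (rule abelian_groupI)
    fix x assume "x \<in> carrier CR"
    then show "\<exists>y\<in>carrier CR. y \<oplus>\<^bsub>CR\<^esub> x = \<zero>\<^bsub>CR\<^esub>"
      by (intro bexI[of _ "\<lambda>n. - x n"]) (auto simp: CR_simps Cauchy_uminus)
  qed (auto simp: CR_simps Cauchy_add Cauchy_const algebra_simps)
  show "comm_monoid CR"
    by (rule comm_monoidI) (auto simp: CR_simps Cauchy_mult Cauchy_const algebra_simps)
qed (auto simp: CR_simps algebra_simps)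

sublocale CR: cring CR by (rule cring_CR)

lemma CR_uminus: "padic_Cauchy p x \<Longrightarrow> \<ominus>\<^bsub>CR\<^esub> x = (\<lambda>n. - x n)"
  by (intro CR.minus_equality) (auto simp: CR_simps Cauchy_uminus)

lemma null_ideal: "ideal (padic_null p) CR"
proof (rule idealI)
  show "subgroup (padic_null p) (add_monoid CR)"
  proof (rule CR.add.subgroupI)
    show "padic_null p \<subseteq> carrier CR" by (auto simp: CR_simps null_Cauchy)
    have "(\<lambda>_. 0) \<in> padic_null p" by (simp add: padic_null_iff val_ge_0)
    then show "padic_null p \<noteq> {}" by blast
  next
    fix a assume "a \<in> padic_null p"
    then show "\<ominus>\<^bsub>CR\<^esub> a \<in> padic_null p"
      using null_mult[OF _ Cauchy_const[of "-1"], of a] by (simp add: CR_uminus null_Cauchy)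
  next
    fix a b assume "a \<in> padic_null p" "b \<in> padic_null p"
    then show "a \<oplus>\<^bsub>CR\<^esub> b \<in> padic_null p" by (simp add: CR_simps null_add)
  qed
next
  fix a x assume "a \<in> padic_null p" "x \<in> carrier CR"
  then show "x \<otimes>\<^bsub>CR\<^esub> a \<in> padic_null p" "a \<otimes>\<^bsub>CR\<^esub> x \<in> padic_null p"
    using null_mult[of a x] by (auto simp: CR_simps mult.commute)
qed (rule CR.ring_axioms)

sublocale N: ideal "padic_null p" CR by (rule null_ideal)

lemma null_maximal: "maximalideal (padic_null p) CR"
proof (rule maximalidealI[OF null_ideal])
  show "carrier CR \<noteq> padic_null p"
  proof
    assume "carrier CR = padic_null p"
    then have "(\<lambda>_. 1) \<in> padic_null p" using Cauchy_const by (auto simp: CR_simps)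
    then show False using val_ge_1_1 by (auto simp: padic_null_iff dest!: spec[of _ 1])
  qed
  fix J assume J: "ideal J CR" "padic_null p \<subseteq> J" "J \<subseteq> carrier CR"
  interpret J: ideal J CR by (rule J)
  show "J = padic_null p \<or> J = carrier CR"
  proof (cases "J = padic_null p")
    case False
    then obtain x where x: "x \<in> J" "x \<notin> padic_null p" using J by blast
    then have xC: "padic_Cauchy p x" using J by (auto simp: CR_simps)
    note inv = Cauchy_inverse[OF xC x(2)]
    have "(\<lambda>n. x n * inverse (x n)) \<in> J"
      using J.I_r_closed[OF x(1), of "\<lambda>n. inverse (x n)"] inv(1) by (simp add: CR_simps)
    moreover have "(\<lambda>n. - (x n * inverse (x n) - 1)) \<in> J"
      using null_mult[OF inv(2) Cauchy_const[of "-1"]] J(2) by auto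
    ultimately have "(\<lambda>n. x n * inverse (x n)) \<oplus>\<^bsub>CR\<^esub> (\<lambda>n. - (x n * inverse (x n) - 1)) \<in> J"
      by (rule J.a_closed)
    then have "\<one>\<^bsub>CR\<^esub> \<in> J" by (simp add: CR_simps)
    then show ?thesis using J.one_imp_carrier by blast
  qed simp
qed

lemma field_Qp: "field (Qp p)"
  unfolding Qp_def by (rule maximalideal.quotient_is_field[OF null_maximal cring_CR])

definition cls :: "(nat \<Rightarrow> rat) \<Rightarrow> (nat \<Rightarrow> rat) set" where
  "cls x = padic_null p +>\<^bsub>CR\<^esub> x"

lemma cls_hom: "ring_hom_ring CR (Qp p) cls"
  unfolding Qp_def cls_def[abs_def] by (rule N.rcos_ring_hom_ring)

lemma carrier_Qp: "carrier (Qp p) = cls ` {x. padic_Cauchy p x}"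
  by (auto simp: Qp_def FactRing_def A_RCOSETS_def' cls_def CR_simps)

lemma cls_eq_zero_iff: "padic_Cauchy p x \<Longrightarrow> cls x = \<zero>\<^bsub>Qp p\<^esub> \<longleftrightarrow> x \<in> padic_null p"
  using CR.a_coset_join1[of "padic_null p" x] CR.a_coset_join2[of x "padic_null p"]
    N.a_rcos_const[of x] N.a_rcos_self[of x]
  by (auto simp: cls_def Qp_def FactRing_def CR_simps N.a_subgroup)

lemma mem_cls_iff:
  assumes "padic_Cauchy p x"
  shows "y \<in> cls x \<longleftrightarrow> (\<exists>a\<in>padic_null p. y = (\<lambda>n. a n + x n))"
  by (auto simp: cls_def a_r_coset_def' CR_simps)

text \<open>The absolute values converge in the reals by the reverse triangle inequality, and null
  sequences do not change the limit; this evaluates the definite description in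
  \<open>padic_abs\<close>.\<close>

lemma abs_cls:
  assumes "padic_Cauchy p x"
  shows "(\<lambda>n. padic_abs_rat p (x n)) \<longlonglongrightarrow> padic_abs p (cls x)"
proof -
  have tri: "\<bar>padic_abs_rat p a - padic_abs_rat p b\<bar> \<le> padic_abs_rat p (a - b)" for a b
  proof -
    have "padic_abs_rat p (- c) = padic_abs_rat p c" for c
      using val_mult[of "-1" c] val_of_int[of "-1"] by (simp add: padic_abs_rat_def)
    from this[of "a - b"] show ?thesis
      using abs_rat_triangle[of b "a - b"] abs_rat_triangle[of a "b - a"] by simp
  qed
  have "Cauchy (\<lambda>n. padic_abs_rat p (x n))"
    using assms tri unfolding padic_Cauchy_def Cauchy_def dist_real_def by (meson order_le_less_trans)
  then obtain r where r: "(\<lambda>n. padic_abs_rat p (x n)) \<longlonglongrightarrow> r"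
    using Cauchy_convergent convergent_def by blast
  have lim: "(\<lambda>n. padic_abs_rat p (y n)) \<longlonglongrightarrow> r" if y: "y \<in> cls x" for y
  proof -
    obtain a where a: "a \<in> padic_null p" "y = (\<lambda>n. a n + x n)" using y mem_cls_iff[OF assms] by blast
    have "(\<lambda>n. padic_abs_rat p (y n) - padic_abs_rat p (x n)) \<longlonglongrightarrow> 0"
    proof (rule tendsto_0_le[where K = 1])
      show "(\<lambda>n. padic_abs_rat p (a n)) \<longlonglongrightarrow> 0" using a by (simp add: padic_null_def)
      show "\<forall>\<^sub>F n in sequentially. norm (padic_abs_rat p (y n) - padic_abs_rat p (x n)) \<le> norm (padic_abs_rat p (a n)) * 1"
      proof (rule always_eventually, rule allI)
        fix n
        show "norm (padic_abs_rat p (y n) - padic_abs_rat p (x n)) \<le> norm (padic_abs_rat p (a n)) * 1"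
          using tri[of "y n" "x n"] a(2) abs_rat_nonneg[of "a n"] by simp
      qed
    qed
    from tendsto_add[OF this r] show ?thesis by simp
  qed
  have "(\<lambda>n. 0) \<in> padic_null p" by (simp add: padic_null_iff val_ge_0)
  then have "x \<in> cls x" using mem_cls_iff[OF assms, of x] by force
  have "padic_abs p (cls x) = r" unfolding padic_abs_def
  proof (rule the_equality)
    show "\<forall>y\<in>cls x. (\<lambda>n. padic_abs_rat p (y n)) \<longlonglongrightarrow> r" using lim by blast
    fix s assume "\<forall>y\<in>cls x. (\<lambda>n. padic_abs_rat p (y n)) \<longlonglongrightarrow> s"
    then show "s = r" using \<open>x \<in> cls x\<close> r LIMSEQ_unique by blast
  qed
  then show ?thesis using r by simp
qed

text \<open>The values are discrete: a limit of at most 1 lies below p, and an absolute value below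
  p already means valuation at least 0.\<close>

lemma Zp_eq: "Zp p = cls ` {x. padic_Cauchy p x \<and> ev_ge 0 x}"
proof -
  have "padic_abs p (cls x) \<le> 1 \<longleftrightarrow> ev_ge 0 x"
    if x: "padic_Cauchy p x" for x
  proof
    assume "padic_abs p (cls x) \<le> 1"
    then have "padic_abs p (cls x) < real p" using p_gt_1 by simp
    then have "eventually (\<lambda>n. padic_abs_rat p (x n) < real p) sequentially"
      using order_tendstoD(2)[OF abs_cls[OF x]] by blast
    then show "ev_ge 0 x"
      using abs_rat_less_iff[of _ "-1"] by simp
  next
    assume e: "ev_ge 0 x"
    show "padic_abs p (cls x) \<le> 1"
      by (rule tendsto_upperbound[OF abs_cls[OF x]])
         (use e abs_rat_le_iff[of _ 0] in auto)
  qed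
  then show ?thesis unfolding Zp_def carrier_Qp by auto
qed

end

text \<open>\<open>e\<close> stands for the composition of \<open>padic_Cauchy_ring p \<rightarrow> Qp p\<close> with an embedding
  of \<open>Qp p\<close> into a field of which it is a subfield with algebraic elements only.\<close>

locale padic_embedding = prime_nat p for p +
  fixes e :: "(nat \<Rightarrow> rat) \<Rightarrow> 'a::field"
  assumes e_add: "\<And>x y. padic_Cauchy p x \<Longrightarrow> padic_Cauchy p y \<Longrightarrow> e (\<lambda>n. x n + y n) = e x + e y"
    and e_mult: "\<And>x y. padic_Cauchy p x \<Longrightarrow> padic_Cauchy p y \<Longrightarrow> e (\<lambda>n. x n * y n) = e x * e y"
    and e_1: "e (\<lambda>_. 1) = 1"
    and e_0_iff: "\<And>x. padic_Cauchy p x \<Longrightarrow> e x = 0 \<longleftrightarrow> x \<in> padic_null p"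
begin

definition integers where
  "integers = e ` {x. padic_Cauchy p x \<and> ev_ge 0 x}"

lemma e_0: "e (\<lambda>_. 0) = 0"
  using e_0_iff[OF Cauchy_const[of 0]] by (simp add: padic_null_iff val_ge_0)

lemma e_uminus: "padic_Cauchy p x \<Longrightarrow> e (\<lambda>n. - x n) = - e x"
  using e_add[OF _ Cauchy_uminus, of x x] e_0 by (simp add: eq_neg_iff_add_eq_0 add.commute)

lemma e_diff: "padic_Cauchy p x \<Longrightarrow> padic_Cauchy p y \<Longrightarrow> e (\<lambda>n. x n - y n) = e x - e y"
  using e_add[OF _ Cauchy_uminus, of x y] e_uminus[of y] by simp

lemma e_of_nat: "e (\<lambda>_. of_nat k) = of_nat k"
proof (induction k)
  case (Suc k)
  then show ?case using e_add[OF Cauchy_const Cauchy_const, of 1 "of_nat k"] e_1 by simp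
qed (simp add: e_0)

lemma e_p_power: "e (\<lambda>_. of_nat p ^ k) = of_nat p ^ k"
  using e_of_nat[of "p ^ k"] by simp

lemma e_nonzero: "of_nat p \<noteq> (0 :: 'a)"
proof
  assume "of_nat p = (0 :: 'a)"
  then have "(\<lambda>_. of_nat p) \<in> padic_null p"
    using e_0_iff[OF Cauchy_const] e_of_nat[of p] by metis
  then have "val_ge 2 (of_nat p)" by (simp add: padic_null_iff)
  then show False
    using val_p_power[of 1] p_gt_1 by (simp add: val_ge_def)
qed

text \<open>Turns divisibility by p^k in the image into an eventual condition on a representing
  sequence, through which the axioms of \<open>padic_integers\<close> are checked.\<close>

lemma e_in_p_power_iff:
  assumes x: "padic_Cauchy p x"
  shows "(\<exists>b\<in>integers. e x = of_nat p ^ k * b) \<longleftrightarrow> ev_ge (int k) x"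
proof
  assume "\<exists>b\<in>integers. e x = of_nat p ^ k * b"
  then obtain y where y: "padic_Cauchy p y" "ev_ge 0 y" "e x = of_nat p ^ k * e y"
    by (auto simp: integers_def)
  have C: "padic_Cauchy p (\<lambda>n. of_nat p ^ k * y n)" by (intro Cauchy_mult Cauchy_const y)
  have "e (\<lambda>n. of_nat p ^ k * y n) = e x" using e_mult[OF Cauchy_const y(1)] e_p_power y(3) by simp
  then have "e (\<lambda>n. x n - of_nat p ^ k * y n) = 0" using e_diff[OF x C] by simp
  then have "(\<lambda>n. x n - of_nat p ^ k * y n) \<in> padic_null p" using e_0_iff[OF Cauchy_diff[OF x C]] by blast
  then have "ev_ge (int k) (\<lambda>n. (x n - of_nat p ^ k * y n))"
    by (simp add: padic_null_iff)
  with y(2) show "ev_ge (int k) x"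
  proof eventually_elim
    case (elim n)
    have "val_ge (int k) (of_nat p ^ k * y n)" using elim(1) val_ge_p_power_mult[of k 0] by simp
    from val_ge_add[OF elim(2) this] show ?case by simp
  qed
next
  assume ev: "ev_ge (int k) x"
  define y where "y n = inverse (of_nat p ^ k) * x n" for n
  have y: "padic_Cauchy p y" unfolding y_def by (intro Cauchy_mult Cauchy_const x)
  have xy: "of_nat p ^ k * y n = x n" for n using p_gt_1 by (simp add: y_def)
  have "ev_ge 0 y"
    using ev
  proof eventually_elim
    case (elim n)
    then show ?case using val_ge_p_power_mult[of k 0 "y n"] xy by simp
  qed
  then have "e y \<in> integers" using y by (auto simp: integers_def)
  moreover have "e x = of_nat p ^ k * e y"
    using e_mult[OF Cauchy_const y, of "of_nat p ^ k"] e_p_power[of k] by (simp add: xy)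
  ultimately show "\<exists>b\<in>integers. e x = of_nat p ^ k * b" by blast
qed

lemma e_const_in_p_power_iff:
  "(\<exists>b\<in>integers. e (\<lambda>_. c) = of_nat p ^ k * b) \<longleftrightarrow> val_ge (int k) c"
  using e_in_p_power_iff[OF Cauchy_const, of c k] by simp

lemma integersI: "padic_Cauchy p x \<Longrightarrow> ev_ge 0 x \<Longrightarrow> e x \<in> integers"
  by (auto simp: integers_def)

lemma integersE:
  assumes "a \<in> integers"
  obtains x where "a = e x" "padic_Cauchy p x" "ev_ge 0 x"
  using assms by (auto simp: integers_def)

lemma field_subring_integers: "field_subring integers"
proof
  have one: "val_ge 0 1" using val_ge_of_int[of 1] by simp
  show "0 \<in> integers" using integersI[OF Cauchy_const[of 0]] e_0 by (simp add: val_ge_0)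
  show "1 \<in> integers" using integersI[OF Cauchy_const[of 1]] e_1 one by simp
next
  fix a b assume "a \<in> integers" "b \<in> integers"
  then obtain x y where x: "a = e x" "padic_Cauchy p x" "ev_ge 0 x"
    and y: "b = e y" "padic_Cauchy p y" "ev_ge 0 y"
    by (metis integersE)
  have "ev_ge 0 (\<lambda>n. (x n + y n))" "ev_ge 0 (\<lambda>n. (x n * y n))"
    using x(3) y(3) by (eventually_elim; use val_ge_add val_ge_mult[of 0 _ 0] in force)+
  then show "a + b \<in> integers" "a * b \<in> integers"
    using integersI[OF Cauchy_add[OF x(2) y(2)]] integersI[OF Cauchy_mult[OF x(2) y(2)]]
      e_add[OF x(2) y(2)] e_mult[OF x(2) y(2)] x(1) y(1) by auto
next
  fix a assume "a \<in> integers"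
  then obtain x where x: "a = e x" "padic_Cauchy p x" "ev_ge 0 x"
    by (metis integersE)
  have "ev_ge 0 (\<lambda>n. (- x n))"
    using x(3) by eventually_elim (rule val_ge_uminus)
  then show "- a \<in> integers" using integersI[OF Cauchy_uminus[OF x(2)]] e_uminus[OF x(2)] x(1) by auto
qed

lemma padic_integers_integers:
  assumes alg: "\<And>x. \<exists>f. f \<noteq> 0 \<and> (\<forall>i. coeff f i \<in> integers) \<and> poly f x = 0"
  shows "padic_integers integers p"
proof -
  interpret I: field_subring integers by (rule field_subring_integers)
  show ?thesis
  proof
    show "of_nat p \<noteq> (0 :: 'a)" by (rule e_nonzero)
    show "inverse (of_nat p) \<notin> integers"
    proof
      assume a: "inverse (of_nat p) \<in> integers"
      have "e (\<lambda>_. 1) = of_nat p ^ 1 * inverse (of_nat p)" using e_nonzero e_1 by simp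
      then have "val_ge 1 1" using e_const_in_p_power_iff[of 1 1] a by auto
      then show False using val_ge_1_1 by simp
    qed
  next
    fix a assume "a \<in> integers"
    then obtain x where x: "a = e x" "padic_Cauchy p x" "ev_ge 0 x"
      by (metis integersE)
    obtain N where N: "\<forall>m\<ge>N. \<forall>n\<ge>N. val_ge 1 (x m - x n)"
      using x(2) unfolding padic_Cauchy_iff by meson
    obtain M where M: "\<forall>m\<ge>M. val_ge 0 (x m)" using x(3) unfolding eventually_sequentially by blast
    define L where "L = max M N"
    obtain c where c: "c < p" "val_ge 1 (x L - of_nat c)" using val_ge_residue[of "x L"] M by (auto simp: L_def)
    have "val_ge 1 (x m - of_nat c)" if "m \<ge> L" for m
    proof -
      have "val_ge 1 (x m - x L)" using N that by (auto simp: L_def)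
      from val_ge_add[OF this c(2)] show ?thesis by simp
    qed
    then have "ev_ge (int 1) (\<lambda>m. (x m - of_nat c))"
      unfolding eventually_sequentially by auto
    then obtain b where "b \<in> integers" "e (\<lambda>m. x m - of_nat c) = of_nat p ^ 1 * b"
      using e_in_p_power_iff[OF Cauchy_diff[OF x(2) Cauchy_const]] by metis
    then show "\<exists>c<p. \<exists>b\<in>integers. a = of_nat c + of_nat p * b"
      using c(1) e_diff[OF x(2) Cauchy_const, of "of_nat c"] e_of_nat[of c] x(1)
      by (intro exI[of _ c] conjI bexI[of _ b]) (auto simp: algebra_simps)
  next
    fix a assume "a \<in> integers"
    then obtain x where x: "a = e x" "padic_Cauchy p x" "ev_ge 0 x"
      by (metis integersE)
    show "inverse a \<in> integers \<or> (\<exists>b\<in>integers. a = of_nat p * b)"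
    proof (rule disjCI)
      assume "\<not> (\<exists>b\<in>integers. a = of_nat p * b)"
      then have ne: "\<not> ev_ge 1 x"
        using e_in_p_power_iff[OF x(2), of 1] x(1) by simp
      then have nn: "x \<notin> padic_null p" by (auto simp: padic_null_iff)
      obtain N where N: "\<forall>m\<ge>N. \<forall>n\<ge>N. val_ge 1 (x m - x n)"
        using x(2) unfolding padic_Cauchy_iff by meson
      obtain M where M: "M \<ge> N" "\<not> val_ge 1 (x M)" using ne unfolding eventually_sequentially by auto
      have "val_ge 0 (inverse (x n))" if "n \<ge> N" for n
      proof -
        have "\<not> val_ge (0 + 1) (x n)" using N M that val_ge_add[of 1 "x M - x n" "x n"] by auto
        from val_ge_inverse[OF this] show ?thesis by simp
      qed
      then have "ev_ge 0 (\<lambda>n. (inverse (x n)))"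
        unfolding eventually_sequentially by blast
      then have I: "e (\<lambda>n. inverse (x n)) \<in> integers"
        using integersI Cauchy_inverse(1)[OF x(2) nn] by blast
      have "e (\<lambda>n. x n * inverse (x n) - 1) = 0"
        using e_0_iff Cauchy_inverse(2)[OF x(2) nn] null_Cauchy by blast
      then have "a * e (\<lambda>n. inverse (x n)) = 1"
        using e_diff[OF Cauchy_mult[OF x(2) Cauchy_inverse(1)[OF x(2) nn]] Cauchy_const[of 1]]
          e_mult[OF x(2) Cauchy_inverse(1)[OF x(2) nn]] e_1 x(1) by simp
      then have "inverse a = e (\<lambda>n. inverse (x n))" by (rule inverse_unique)
      then show "inverse a \<in> integers" using I by simp
    qed
  next
    fix a assume a: "\<And>k. \<exists>b\<in>integers. a = of_nat p ^ k * b"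
    have "a \<in> integers" using a[of 0] by auto
    then obtain x where x: "a = e x" "padic_Cauchy p x" by (metis integersE)
    have nat: "ev_ge (int k) x" for k
      using a[of k] unfolding x(1) e_in_p_power_iff[OF x(2)] .
    have "x \<in> padic_null p" unfolding padic_null_iff
    proof
      fix k :: int
      show "ev_ge k x"
        using nat[of "nat k"] by eventually_elim (erule val_ge_mono, simp)
    qed
    then show "a = 0" using e_0_iff[OF x(2)] x(1) by simp
  next
    fix u assume u: "\<And>k. u k \<in> integers" "\<And>k. \<exists>b\<in>integers. u (Suc k) - u k = of_nat p ^ k * b"
    \<comment> \<open>Each \<open>u k\<close> is congruent modulo p^k to the image of a constant
      rational sequence. The sequence \<open>r\<close> of these constants is itself Cauchy and
      represents the limit, which avoids double sequences.\<close>
    have "\<exists>r. val_ge 0 r \<and> (\<exists>b\<in>integers. u k - e (\<lambda>_. r) = of_nat p ^ k * b)" for k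
    proof -
      obtain x where x: "u k = e x" "padic_Cauchy p x" "ev_ge 0 x"
        using u(1) by (metis integersE)
      obtain N where N: "\<forall>m\<ge>N. \<forall>n\<ge>N. val_ge (int k) (x m - x n)"
        using x(2) unfolding padic_Cauchy_iff by meson
      obtain M where M: "\<forall>m\<ge>M. val_ge 0 (x m)" using x(3) unfolding eventually_sequentially by blast
      define r where "r = x (max M N)"
      have "ev_ge (int k) (\<lambda>n. (x n - r))"
        using N unfolding eventually_sequentially r_def by (intro exI[of _ N]) auto
      then have "\<exists>b\<in>integers. e (\<lambda>n. x n - r) = of_nat p ^ k * b"
        using e_in_p_power_iff[OF Cauchy_diff[OF x(2) Cauchy_const]] by blast
      then show ?thesis using M e_diff[OF x(2) Cauchy_const, of r] x(1)
        by (intro exI[of _ r]) (auto simp: r_def)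
    qed
    then obtain r where r: "\<And>k. val_ge 0 (r k)"
      "\<And>k. \<exists>b\<in>integers. u k - e (\<lambda>_. r k) = of_nat p ^ k * b" by metis
    have step: "val_ge (int k) (r (Suc k) - r k)" for k
    proof -
      obtain b1 where b1: "b1 \<in> integers" "u k - e (\<lambda>_. r k) = of_nat p ^ k * b1" using r(2) by blast
      obtain b2 where b2: "b2 \<in> integers" "u (Suc k) - e (\<lambda>_. r (Suc k)) = of_nat p ^ Suc k * b2" using r(2) by blast
      obtain b3 where b3: "b3 \<in> integers" "u (Suc k) - u k = of_nat p ^ k * b3" using u(2) by blast
      have "e (\<lambda>_. r (Suc k) - r k) = of_nat p ^ k * (b3 + b1 - of_nat p * b2)"
        unfolding e_diff[OF Cauchy_const Cauchy_const] using b1(2) b2(2) b3(2) by (simp add: algebra_simps)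
      moreover have "b3 + b1 - of_nat p * b2 \<in> integers"
        by (intro I.Z_diff I.Z_add I.Z_mult I.Z_of_nat b1 b2 b3)
      ultimately show ?thesis using e_const_in_p_power_iff by blast
    qed
    have far: "val_ge (int k) (r (k + j) - r k)" for k j
    proof (induction j)
      case (Suc j)
      have "val_ge (int k) (r (Suc (k + j)) - r (k + j))"
        using step[of "k + j"] by (rule val_ge_mono) simp
      from val_ge_add[OF this Suc] show ?case by simp
    qed (simp add: val_ge_0)
    have far': "val_ge (int k) (r n - r k)" if "n \<ge> k" for n k
      using far[of k "n - k"] that by simp
    have rC: "padic_Cauchy p r" unfolding padic_Cauchy_iff
    proof
      fix k :: int
      have "val_ge k (r m - r n)" if "m \<ge> nat k" "n \<ge> nat k" for m n
        using val_ge_diff[OF far'[OF that(1)] far'[OF that(2)]]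
        by (rule val_ge_mono[THEN back_subst[of "\<lambda>x. val_ge k x"]]) auto
      then show "\<exists>N. \<forall>m\<ge>N. \<forall>n\<ge>N. val_ge k (r m - r n)" by blast
    qed
    have "\<exists>b\<in>integers. e r - u k = of_nat p ^ k * b" for k
    proof -
      obtain b1 where b1: "b1 \<in> integers" "u k - e (\<lambda>_. r k) = of_nat p ^ k * b1" using r(2) by blast
      have "ev_ge (int k) (\<lambda>n. (r n - r k))"
        using far' unfolding eventually_sequentially by blast
      then obtain b2 where b2: "b2 \<in> integers" "e (\<lambda>n. r n - r k) = of_nat p ^ k * b2"
        using e_in_p_power_iff[OF Cauchy_diff[OF rC Cauchy_const]] by metis
      have "e r - u k = of_nat p ^ k * (b2 - b1)"
        using b1(2) b2(2) unfolding e_diff[OF rC Cauchy_const] by (simp add: algebra_simps)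
      then show ?thesis using I.Z_diff[OF b2(1) b1(1)] by blast
    qed
    moreover have "e r \<in> integers" using integersI[OF rC] r(1) by simp
    ultimately show "\<exists>a\<in>integers. \<forall>k. \<exists>b\<in>integers. a - u k = of_nat p ^ k * b" by blast
  next
    fix x :: 'a
    show "\<exists>f. f \<noteq> 0 \<and> (\<forall>i. coeff f i \<in> integers) \<and> poly f x = 0" by (rule alg)
  qed
qed

end

section \<open>The algebraic closure of \<open>\<rat>\<^sub>p\<close>\<close>

text \<open>\<open>\<rho>\<close> identifies a field type with the carrier of
  \<open>Qp_bar p\<close>, so that \<open>padic_integers\<close> and the polynomials over type
  classes become applicable.\<close>

locale padic_closure_type = prime_nat p for p +
  fixes \<rho> :: "'a::field \<Rightarrow> padic_closure"
  assumes \<rho>_bij: "bij_betw \<rho> UNIV (carrier (Qp_bar p))"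
    and \<rho>_add: "\<rho> (x + y) = \<rho> x \<oplus>\<^bsub>Qp_bar p\<^esub> \<rho> y"
    and \<rho>_mult: "\<rho> (x * y) = \<rho> x \<otimes>\<^bsub>Qp_bar p\<^esub> \<rho> y"
    and \<rho>_0: "\<rho> 0 = \<zero>\<^bsub>Qp_bar p\<^esub>" and \<rho>_1: "\<rho> 1 = \<one>\<^bsub>Qp_bar p\<^esub>"
begin

abbreviation L where "L \<equiv> Qp_bar p"

sublocale Qp: field "Qp p" by (rule field_Qp)

lemma Qp_closure: "algebraic_closure L (Qp_incl p ` carrier (Qp p))" "Qp_incl p \<in> ring_hom (Qp p) L"
  using Qp.alg_closureE unfolding Qp_bar_def Qp_incl_def by auto

sublocale L: algebraic_closure L "Qp_incl p ` carrier (Qp p)" by (rule Qp_closure(1))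

lemma \<rho>_closed [simp]: "\<rho> x \<in> carrier L" using \<rho>_bij by (auto simp: bij_betw_def)

lemma \<rho>_inj [simp]: "\<rho> x = \<rho> y \<longleftrightarrow> x = y" using \<rho>_bij by (auto simp: bij_betw_def inj_def)

lemma \<rho>_surj: "a \<in> carrier L \<Longrightarrow> \<exists>x. a = \<rho> x" using \<rho>_bij by (auto simp: bij_betw_def)

lemma \<rho>_eq_0_iff [simp]: "\<rho> x = \<zero>\<^bsub>L\<^esub> \<longleftrightarrow> x = 0" using \<rho>_inj \<rho>_0 by metis

lemma \<rho>_uminus: "\<rho> (- x) = \<ominus>\<^bsub>L\<^esub> \<rho> x"
  by (rule L.minus_equality[symmetric]) (simp_all add: \<rho>_add[symmetric] \<rho>_0)

lemma \<rho>_inverse: "x \<noteq> 0 \<Longrightarrow> \<rho> (inverse x) = inv\<^bsub>L\<^esub> \<rho> x"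
  by (rule L.comm_inv_char[symmetric]) (simp_all add: \<rho>_mult[symmetric] \<rho>_1)

lemma \<rho>_power: "\<rho> (x ^ n) = \<rho> x [^]\<^bsub>L\<^esub> n"
  by (induction n) (simp_all add: \<rho>_1 \<rho>_mult L.m_comm)

lemma \<rho>_eval: "ring.eval L (map \<rho> xs) (\<rho> x) = \<rho> (poly (Poly (rev xs)) x)"
  by (induction xs)
     (simp_all add: \<rho>_0 \<rho>_add \<rho>_mult \<rho>_power Poly_append poly_monom L.a_comm L.m_comm)

definition e :: "(nat \<Rightarrow> rat) \<Rightarrow> 'a" where "e x = inv_into UNIV \<rho> (Qp_incl p (cls x))"

lemma incl_closed: "a \<in> carrier (Qp p) \<Longrightarrow> Qp_incl p a \<in> carrier L"
  using Qp_closure(2) by (auto simp: ring_hom_def)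

lemma cls_closed: "padic_Cauchy p x \<Longrightarrow> cls x \<in> carrier (Qp p)"
  by (auto simp: carrier_Qp)

lemma \<rho>_e: "padic_Cauchy p x \<Longrightarrow> \<rho> (e x) = Qp_incl p (cls x)"
  unfolding e_def using \<rho>_bij incl_closed[OF cls_closed] by (intro f_inv_into_f) (auto simp: bij_betw_def)

sublocale incl: ring_hom_ring CR L "\<lambda>x. Qp_incl p (cls x)"
proof (rule ring_hom_ringI2)
  show "ring CR" by (rule CR.ring_axioms)
  show "ring L" by (rule L.ring_axioms)
  have "cls \<in> ring_hom CR (Qp p)" using cls_hom by (simp add: ring_hom_ring.homh)
  from ring_hom_trans[OF this Qp_closure(2)] show "(\<lambda>x. Qp_incl p (cls x)) \<in> ring_hom CR L"
    by (simp add: comp_def)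
qed

lemma incl_eq_0: "a \<in> carrier (Qp p) \<Longrightarrow> Qp_incl p a = \<zero>\<^bsub>L\<^esub> \<longleftrightarrow> a = \<zero>\<^bsub>Qp p\<^esub>"
  using Qp.indexed_const_is_inj ring_hom_zero[OF Qp_closure(2) Qp.ring_axioms L.ring_axioms]
  unfolding Qp_incl_def inj_def by metis

lemma e_add: "padic_Cauchy p x \<Longrightarrow> padic_Cauchy p y \<Longrightarrow> e (\<lambda>n. x n + y n) = e x + e y"
  using incl.hom_add[of x y] by (subst \<rho>_inj[symmetric]) (simp add: \<rho>_add \<rho>_e Cauchy_add CR_simps)

lemma e_mult: "padic_Cauchy p x \<Longrightarrow> padic_Cauchy p y \<Longrightarrow> e (\<lambda>n. x n * y n) = e x * e y"
  using incl.hom_mult[of x y] by (subst \<rho>_inj[symmetric]) (simp add: \<rho>_mult \<rho>_e Cauchy_mult CR_simps)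

lemma e_1: "e (\<lambda>_. 1) = 1"
  using incl.hom_one by (subst \<rho>_inj[symmetric]) (simp add: \<rho>_1 \<rho>_e Cauchy_const CR_simps)

lemma e_0_iff: "padic_Cauchy p x \<Longrightarrow> e x = 0 \<longleftrightarrow> x \<in> padic_null p"
  by (subst \<rho>_eq_0_iff[symmetric]) (simp add: \<rho>_e incl_eq_0 cls_closed cls_eq_zero_iff)

sublocale emb: padic_embedding p e
  by unfold_locales (rule e_add e_mult e_1 e_0_iff; assumption?)+

abbreviation Zset :: "'a set" where "Zset \<equiv> emb.integers"

lemma \<rho>_Zset: "\<rho> ` Zset = Qp_incl p ` Zp p"
  unfolding emb.integers_def Zp_eq
  by (auto simp: \<rho>_e image_image intro!: image_cong)

lemma polynomial_map:
  assumes "polynomial\<^bsub>L\<^esub> (\<rho> ` B) f"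
  obtains xs where "f = map \<rho> xs" "set xs \<subseteq> B" "xs \<noteq> [] \<Longrightarrow> hd xs \<noteq> 0"
proof -
  have "set f \<subseteq> range \<rho>" "set f \<subseteq> \<rho> ` B" using assms by (auto simp: polynomial_def)
  then have "\<exists>xs. f = map \<rho> xs" unfolding ex_map_conv by blast
  then obtain xs where xs: "f = map \<rho> xs" by blast
  moreover have "set xs \<subseteq> B" using \<open>set f \<subseteq> \<rho> ` B\<close> xs by auto
  moreover have "hd xs \<noteq> 0" if "xs \<noteq> []" using assms that xs by (auto simp: polynomial_def hd_map)
  ultimately show ?thesis using that by blast
qed

lemma Poly_rev_props:
  assumes "xs \<noteq> []" "hd xs \<noteq> 0"
  shows "coeffs (Poly (rev xs)) = rev xs" "Poly (rev xs) \<noteq> 0" "lead_coeff (Poly (rev xs)) = hd xs"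
proof -
  show c: "coeffs (Poly (rev xs)) = rev xs"
    using assms by (cases xs) (auto simp: strip_while_def)
  show n: "Poly (rev xs) \<noteq> 0" using c assms by (metis coeffs_0_eq_Nil rev_is_Nil_conv)
  show "lead_coeff (Poly (rev xs)) = hd xs"
    using last_coeffs_eq_coeff_degree[OF n] c assms by (simp add: last_rev)
qed

lemma coeff_in_set: "coeff f i \<in> insert 0 (set (coeffs f))"
  by (metis coeff_in_coeffs coeff_eq_0 insert_iff linorder_not_le coeff_0)

lemma e_scaled:
  assumes "padic_Cauchy p y" shows "\<exists>k. of_nat p ^ k * e y \<in> Zset"
proof -
  obtain k where k: "k \<le> 0" "ev_ge k y" using Cauchy_bounded[OF assms] by blast
  define j where "j = nat (- k)"
  have "ev_ge 0 (\<lambda>n. (of_nat p ^ j * y n))"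
    using k(2)
  proof eventually_elim
    case (elim n)
    then show ?case using val_ge_p_power_mult[of j k "y n"] k(1) by (simp add: j_def)
  qed
  then have "e (\<lambda>n. of_nat p ^ j * y n) \<in> Zset"
    by (intro emb.integersI Cauchy_mult Cauchy_const assms)
  then have "of_nat p ^ j * e y \<in> Zset"
    using e_mult[OF Cauchy_const assms] emb.e_p_power by simp
  then show ?thesis by blast
qed

text \<open>The algebraic closure supplies an annihilating polynomial over Q_p; one power of p
  clears the denominators of its finitely many coefficients.\<close>

lemma Zset_algebraic: "\<exists>f. f \<noteq> 0 \<and> (\<forall>i. coeff f i \<in> Zset) \<and> poly f x = 0"
proof -
  define B where "B = e ` {x. padic_Cauchy p x}"
  interpret Z: field_subring Zset by (rule emb.field_subring_integers)
  have \<rho>B: "Qp_incl p ` carrier (Qp p) = \<rho> ` B"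
    by (auto simp: B_def carrier_Qp \<rho>_e image_image intro!: image_cong)
  obtain f where f: "f \<in> carrier (univ_poly L (Qp_incl p ` carrier (Qp p)))" "f \<noteq> []" "ring.eval L f (\<rho> x) = \<zero>\<^bsub>L\<^esub>"
    using L.algebraicE[OF subfieldE(1)[OF L.subfield_axioms] _ L.algebraic_extension, of "\<rho> x"] by auto
  then have "polynomial\<^bsub>L\<^esub> (\<rho> ` B) f" by (simp add: univ_poly_def \<rho>B)
  then obtain xs where xs: "f = map \<rho> xs" "set xs \<subseteq> B" "xs \<noteq> [] \<Longrightarrow> hd xs \<noteq> 0"
    by (rule polynomial_map) blast
  have ne: "xs \<noteq> []" using f(2) xs by auto
  define g where "g = Poly (rev xs)"
  have g: "g \<noteq> 0" "coeffs g = rev xs" using Poly_rev_props[OF ne xs(3)[OF ne]] by (auto simp: g_def)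
  have "poly g x = 0" using f(3) unfolding xs(1) \<rho>_eval g_def by simp
  have scale: "\<exists>k. of_nat p ^ k * b \<in> Zset" if b: "b \<in> B" for b
    using b e_scaled by (auto simp: B_def)
  have "\<exists>k. \<forall>b\<in>set ys. of_nat p ^ k * b \<in> Zset" if "set ys \<subseteq> B" for ys
    using that
  proof (induction ys)
    case (Cons y ys)
    then obtain k l where "\<forall>b\<in>set ys. of_nat p ^ k * b \<in> Zset" "of_nat p ^ l * y \<in> Zset"
      using scale[of y] by auto
    then have "\<forall>b\<in>set (y # ys). of_nat p ^ (k + l) * b \<in> Zset"
      using Z.Z_mult[OF Z.Z_power[OF Z.Z_of_nat]] by (auto simp: power_add mult.assoc) (metis mult.left_commute)
    then show ?case by blast
  qed simp
  from this[OF xs(2)] obtain k where k: "\<forall>b\<in>set xs. of_nat p ^ k * b \<in> Zset" by blast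
  show ?thesis
  proof (intro exI conjI allI)
    show "smult (of_nat p ^ k) g \<noteq> 0"
      using g(1) emb.e_nonzero by simp
    show "poly (smult (of_nat p ^ k) g) x = 0" using \<open>poly g x = 0\<close> by simp
    show "coeff (smult (of_nat p ^ k) g) i \<in> Zset" for i
      using coeff_in_set[of g i] k Z.Z_0 g(2) by auto
  qed
qed

sublocale Z: padic_integers Zset p
  by (rule emb.padic_integers_integers[OF Zset_algebraic])

text \<open>The left side is the membership condition of \<open>integer_ring\<close>, which thereby
  becomes accessible to the results on \<open>Z.integral\<close>.\<close>

lemma integral_iff:
  "(\<exists>f \<in> carrier (univ_poly L (Qp_incl p ` Zp p)). f \<noteq> [] \<and> Polynomials.lead_coeff f = \<one>\<^bsub>L\<^esub> \<and>
     ring.eval L f (\<rho> x) = \<zero>\<^bsub>L\<^esub>) \<longleftrightarrow> Z.integral x" (is "?l \<longleftrightarrow> _")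
proof
  assume ?l
  then obtain f where f: "polynomial\<^bsub>L\<^esub> (\<rho> ` Zset) f" "f \<noteq> []" "hd f = \<one>\<^bsub>L\<^esub>" "ring.eval L f (\<rho> x) = \<zero>\<^bsub>L\<^esub>"
    by (auto simp: univ_poly_def \<rho>_Zset)
  obtain xs where xs: "f = map \<rho> xs" "set xs \<subseteq> Zset" "xs \<noteq> [] \<Longrightarrow> hd xs \<noteq> 0"
    using f(1) by (rule polynomial_map) blast
  have ne: "xs \<noteq> []" using f(2) xs by auto
  note P = Poly_rev_props[OF ne xs(3)[OF ne]]
  have "hd xs = 1" using f(3) xs(1) ne \<rho>_1 by (metis \<rho>_inj hd_map)
  moreover have "poly (Poly (rev xs)) x = 0" using f(4) unfolding xs(1) \<rho>_eval by simp
  moreover have "Poly (rev xs) \<in> Z.Zpoly"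
    unfolding Z.Zpoly_def
  proof (intro CollectI allI)
    fix i
    show "coeff (Poly (rev xs)) i \<in> Zset"
      using coeff_in_set[of "Poly (rev xs)" i] unfolding P(1) using xs(2) Z.Z_0 by auto
  qed
  ultimately show "Z.integral x" unfolding Z.integral_def using P(3) by metis
next
  assume "Z.integral x"
  then obtain g where g: "g \<in> Z.Zpoly" "lead_coeff g = 1" "poly g x = 0"
    unfolding Z.integral_def by blast
  have g0: "g \<noteq> 0" using g(2) by auto
  define xs where "xs = rev (coeffs g)"
  have ne: "xs \<noteq> []" using g0 by (simp add: xs_def)
  have hd: "hd xs = 1" using g(2) last_coeffs_eq_coeff_degree[OF g0] g0 by (simp add: xs_def hd_rev)
  have "set xs \<subseteq> Zset" using g(1) by (auto simp: xs_def Z.Zpoly_def coeffs_def)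
  then have "map \<rho> xs \<in> carrier (univ_poly L (Qp_incl p ` Zp p))"
    using ne hd by (auto simp: univ_poly_def polynomial_def hd_map \<rho>_Zset[symmetric])
  moreover have "ring.eval L (map \<rho> xs) (\<rho> x) = \<zero>\<^bsub>L\<^esub>"
    unfolding \<rho>_eval using g(3) by (simp add: xs_def \<rho>_0)
  moreover have "hd (map \<rho> xs) = \<one>\<^bsub>L\<^esub>" using ne hd by (simp add: hd_map \<rho>_1)
  ultimately show ?l using ne by (intro bexI[of _ "map \<rho> xs"]) auto
qed

end

section \<open>The ring of integers of K = Q_p(x) for an integral x\<close>

context padic_closure_type begin

context
  fixes x :: 'a and K
  assumes x: "Z.integral x" and K_def: "K = Qp_adjoin p (\<rho> x)"
begin

lemma adjoin_closed: "insert (\<rho> x) (Qp_incl p ` carrier (Qp p)) \<subseteq> carrier L"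
  using incl_closed by auto

lemma K_subfield: "subfield K L"
  unfolding K_def Qp_adjoin_def by (rule L.generate_field_is_subfield[OF adjoin_closed])

lemma K_incl: "\<rho> x \<in> K" "c \<in> carrier (Qp p) \<Longrightarrow> Qp_incl p c \<in> K"
  unfolding K_def Qp_adjoin_def by (auto intro: generate_field.incl)

lemma K_closed:
  "\<rho> 0 \<in> K" "\<rho> 1 \<in> K" "\<rho> y \<in> K \<Longrightarrow> \<rho> z \<in> K \<Longrightarrow> \<rho> (y + z) \<in> K" "\<rho> y \<in> K \<Longrightarrow> \<rho> z \<in> K \<Longrightarrow> \<rho> (y * z) \<in> K"
  "\<rho> y \<in> K \<Longrightarrow> \<rho> (- y) \<in> K" "\<rho> y \<in> K \<Longrightarrow> \<rho> (inverse y) \<in> K"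
proof -
  note sr = subringE[OF subfieldE(1)[OF K_subfield]]
  show "\<rho> 0 \<in> K" "\<rho> 1 \<in> K" using sr by (auto simp: \<rho>_0 \<rho>_1)
  then show "\<rho> y \<in> K \<Longrightarrow> \<rho> (inverse y) \<in> K"
    using L.subfield_m_inv(1)[OF K_subfield, of "\<rho> y"] by (cases "y = 0") (auto simp: \<rho>_inverse)
qed (use subringE[OF subfieldE(1)[OF K_subfield]] in \<open>auto simp: \<rho>_add \<rho>_mult \<rho>_uminus\<close>)

lemma K_Zset: "c \<in> Zset \<Longrightarrow> \<rho> c \<in> K"
proof -
  assume "c \<in> Zset"
  then have "\<rho> c \<in> Qp_incl p ` Zp p" using \<rho>_Zset by blast
  then show "\<rho> c \<in> K" using K_incl(2) by (auto simp: Zp_def)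
qed

text \<open>As the least subfield containing Q_p and \<open>\<rho> x\<close>, K lies in the image of
  the finite-dimensional field from \<open>simple_extension_span\<close>.\<close>

lemma K_span:
  obtains bs where "\<And>y. \<rho> y \<in> K \<Longrightarrow> y \<in> Z.Q.Zspan bs"
proof -
  obtain bs where bs: "x \<in> Z.Q.Zspan bs" "Z.Q \<subseteq> Z.Q.Zspan bs"
    "\<And>v w. v \<in> Z.Q.Zspan bs \<Longrightarrow> w \<in> Z.Q.Zspan bs \<Longrightarrow> v * w \<in> Z.Q.Zspan bs"
    "\<And>v. v \<in> Z.Q.Zspan bs \<Longrightarrow> inverse v \<in> Z.Q.Zspan bs"
    using Z.simple_extension_span[OF x] by metis
  define V where "V = Z.Q.Zspan bs"
  note M = Z.Q.ZmoduleD[OF Z.Q.Zmodule_Zspan[of bs], folded V_def]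
  have one: "1 \<in> V" using bs(2) Z.Z_subset_Q[OF Z.Z_1] by (auto simp: V_def)
  have "subfield (\<rho> ` V) L"
  proof (rule L.subfieldI')
    show "subring (\<rho> ` V) L"
    proof (rule L.subringI)
      show "\<one>\<^bsub>L\<^esub> \<in> \<rho> ` V" using one \<rho>_1 by (metis imageI)
    next
      fix h assume "h \<in> \<rho> ` V"
      then show "\<ominus>\<^bsub>L\<^esub> h \<in> \<rho> ` V" using M(4) by (auto simp: \<rho>_uminus[symmetric])
    next
      fix h1 h2 assume "h1 \<in> \<rho> ` V" "h2 \<in> \<rho> ` V"
      then show "h1 \<otimes>\<^bsub>L\<^esub> h2 \<in> \<rho> ` V" "h1 \<oplus>\<^bsub>L\<^esub> h2 \<in> \<rho> ` V"
        using M(2) bs(3) by (auto simp: \<rho>_mult[symmetric] \<rho>_add[symmetric] V_def)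
    qed auto
  next
    fix k assume "k \<in> \<rho> ` V - {\<zero>\<^bsub>L\<^esub>}"
    then show "inv\<^bsub>L\<^esub> k \<in> \<rho> ` V" using bs(4) by (auto simp: \<rho>_inverse[symmetric] V_def)
  qed
  moreover have "insert (\<rho> x) (Qp_incl p ` carrier (Qp p)) \<subseteq> \<rho> ` V"
  proof -
    have "Qp_incl p (cls y) \<in> \<rho> ` V" if y: "padic_Cauchy p y" for y
    proof -
      have "e y \<in> Z.Q" using e_scaled[OF y] by (auto simp: Z.Q_def)
      then show ?thesis using bs(2) \<rho>_e[OF y] unfolding V_def by (metis imageI subsetD)
    qed
    then show ?thesis using bs(1) by (auto simp: carrier_Qp V_def)
  qed
  ultimately have "K \<subseteq> \<rho> ` V"
    unfolding K_def Qp_adjoin_def by (rule L.generate_field_min_subfield1[OF adjoin_closed])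
  then have "y \<in> V" if "\<rho> y \<in> K" for y using that by auto
  then show ?thesis using that unfolding V_def by blast
qed

abbreviation OK where "OK \<equiv> integer_ring p K"

definition T where "T = {y. \<rho> y \<in> K \<and> Z.integral y}"

lemma OK_simps:
  "carrier OK = \<rho> ` T" "\<one>\<^bsub>OK\<^esub> = \<one>\<^bsub>L\<^esub>" "\<zero>\<^bsub>OK\<^esub> = \<zero>\<^bsub>L\<^esub>" "a \<otimes>\<^bsub>OK\<^esub> b = a \<otimes>\<^bsub>L\<^esub> b" "a \<oplus>\<^bsub>OK\<^esub> b = a \<oplus>\<^bsub>L\<^esub> b"
proof -
  show "carrier OK = \<rho> ` T"
  proof
    show "carrier OK \<subseteq> \<rho> ` T"
    proof
      fix a assume a: "a \<in> carrier OK"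
      then have "a \<in> K" by (simp add: integer_ring_def)
      then have "a \<in> carrier L" using subfieldE(3)[OF K_subfield] by blast
      then obtain y where y: "a = \<rho> y" using \<rho>_surj by blast
      then have "Z.integral y" using a integral_iff[of y] by (simp add: integer_ring_def)
      then show "a \<in> \<rho> ` T" using y \<open>a \<in> K\<close> by (auto simp: T_def)
    qed
    show "\<rho> ` T \<subseteq> carrier OK"
      using integral_iff by (auto simp: integer_ring_def T_def)
  qed
qed (simp_all add: integer_ring_def)

lemma T_closed: "0 \<in> T" "1 \<in> T" "y \<in> T \<Longrightarrow> z \<in> T \<Longrightarrow> y + z \<in> T" "y \<in> T \<Longrightarrow> z \<in> T \<Longrightarrow> y * z \<in> T" "y \<in> T \<Longrightarrow> - y \<in> T"
  "y \<in> T \<Longrightarrow> z \<in> T \<Longrightarrow> y - z \<in> T" "c \<in> Zset \<Longrightarrow> c \<in> T"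
proof -
  show "y \<in> T \<Longrightarrow> z \<in> T \<Longrightarrow> y - z \<in> T"
    using K_closed(3)[of y "- z"] K_closed(5)[of z] by (auto simp: T_def intro: Z.integral_diff)
qed (auto simp: T_def K_closed K_Zset Z.integral_add Z.integral_mult Z.integral_uminus Z.integral_Z Z.Z_0 Z.Z_1)

lemma domain_OK: "domain OK"
proof -
  have "subring (\<rho> ` T) L"
  proof (rule L.subringI)
    show "\<one>\<^bsub>L\<^esub> \<in> \<rho> ` T" using T_closed(2) \<rho>_1 by (metis imageI)
  next
    fix h assume "h \<in> \<rho> ` T"
    then show "\<ominus>\<^bsub>L\<^esub> h \<in> \<rho> ` T" using T_closed(5) by (auto simp: \<rho>_uminus[symmetric])
  next
    fix h1 h2 assume "h1 \<in> \<rho> ` T" "h2 \<in> \<rho> ` T"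
    then show "h1 \<otimes>\<^bsub>L\<^esub> h2 \<in> \<rho> ` T" "h1 \<oplus>\<^bsub>L\<^esub> h2 \<in> \<rho> ` T"
      using T_closed(3,4) by (auto simp: \<rho>_mult[symmetric] \<rho>_add[symmetric])
  qed auto
  then have "domain (L\<lparr>carrier := \<rho> ` T\<rparr>)" by (rule L.subring_is_domain)
  moreover have "OK = L\<lparr>carrier := \<rho> ` T\<rparr>"
    using OK_simps(1) by (simp add: integer_ring_def)
  ultimately show ?thesis by simp
qed

interpretation OK: domain OK by (rule domain_OK)

lemma OK_of_nat: "[n] \<cdot>\<^bsub>OK\<^esub> \<one>\<^bsub>OK\<^esub> = \<rho> (of_nat n)" for n :: nat
  by (induction n) (simp_all add: add_pow_def nat_pow_def OK_simps \<rho>_0 \<rho>_1 \<rho>_add L.a_comm)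

lemma OK_power: "\<rho> y [^]\<^bsub>OK\<^esub> n = \<rho> (y ^ n)" for n :: nat
  by (induction n) (simp_all add: OK_simps \<rho>_1 \<rho>_mult L.m_comm)

lemma OK_minus: "y \<in> T \<Longrightarrow> z \<in> T \<Longrightarrow> \<rho> y \<ominus>\<^bsub>OK\<^esub> \<rho> z = \<rho> (y - z)"
proof -
  assume yz: "y \<in> T" "z \<in> T"
  have "\<ominus>\<^bsub>OK\<^esub> \<rho> z = \<rho> (- z)"
    using yz T_closed(5) by (intro OK.minus_equality) (auto simp: OK_simps \<rho>_add[symmetric] \<rho>_0)
  then show ?thesis by (simp add: a_minus_def OK_simps \<rho>_add[symmetric])
qed

lemma OK_divides: "\<rho> y divides\<^bsub>OK\<^esub> \<rho> z \<longleftrightarrow> (\<exists>c\<in>T. z = y * c)"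
  by (auto simp: factor_def OK_simps \<rho>_mult[symmetric])

lemma OK_p:
  "\<rho> (of_nat p) \<in> carrier OK" "\<rho> (of_nat p) \<noteq> \<zero>\<^bsub>OK\<^esub>" "\<rho> (of_nat p) \<notin> Units OK"
proof -
  show "\<rho> (of_nat p) \<in> carrier OK" using T_closed(7)[OF Z.Z_of_nat] by (simp add: OK_simps)
  show "\<rho> (of_nat p) \<noteq> \<zero>\<^bsub>OK\<^esub>" using Z.p_nonzero by (simp add: OK_simps)
  show "\<rho> (of_nat p) \<notin> Units OK"
  proof
    assume "\<rho> (of_nat p) \<in> Units OK"
    then obtain y where y: "y \<in> T" "\<rho> (of_nat p) \<otimes>\<^bsub>L\<^esub> \<rho> y = \<one>\<^bsub>L\<^esub>"
      by (auto simp: Units_def OK_simps)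
    then have "of_nat p * y = 1" by (metis \<rho>_mult \<rho>_1 \<rho>_inj)
    then have "inverse (of_nat p) = y" by (rule inverse_unique)
    then show False using Z.inverse_p_not_integral y(1) by (simp add: T_def)
  qed
qed

text \<open>Both quotients lie in K, and one of them is integral by
  \<open>integral_or_inverse_integral\<close>.\<close>

lemma OK_total:
  assumes "a \<in> carrier OK" "b \<in> carrier OK" shows "a divides\<^bsub>OK\<^esub> b \<or> b divides\<^bsub>OK\<^esub> a"
proof -
  obtain y z where yz: "a = \<rho> y" "b = \<rho> z" "y \<in> T" "z \<in> T" using assms by (auto simp: OK_simps)
  have "(\<exists>c\<in>T. z = y * c) \<or> (\<exists>c\<in>T. y = z * c)"
  proof (cases "y = 0 \<or> z = 0")
    case True
    then show ?thesis using T_closed(1) by auto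
  next
    case False
    have K: "\<rho> (z * inverse y) \<in> K" "\<rho> (y * inverse z) \<in> K"
      using yz by (auto simp: T_def intro!: K_closed)
    have "Z.integral (z * inverse y) \<or> Z.integral (y * inverse z)"
      using Z.integral_or_inverse_integral[of "z * inverse y"] by (simp add: mult.commute)
    then have "z * inverse y \<in> T \<or> y * inverse z \<in> T" using K by (auto simp: T_def)
    moreover have "z = y * (z * inverse y)" "y = z * (y * inverse z)" using False by auto
    ultimately show ?thesis by blast
  qed
  then show ?thesis unfolding yz(1,2) OK_divides .
qed

lemma OK_finite_mod_p:
  obtains S where "finite S" "S \<subseteq> carrier OK"
    "\<And>a. a \<in> carrier OK \<Longrightarrow> \<exists>s\<in>S. \<exists>y\<in>carrier OK. a = s \<oplus>\<^bsub>OK\<^esub> \<rho> (of_nat p) \<otimes>\<^bsub>OK\<^esub> y"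
proof -
  obtain bs where bs: "\<And>y. \<rho> y \<in> K \<Longrightarrow> y \<in> Z.Q.Zspan bs" using K_span by blast
  have "Z.Zmodule T" using T_closed by (auto simp: Z.Zmodule_def)
  moreover have "T \<subseteq> Z.Q.Zspan bs" using bs by (auto simp: T_def)
  ultimately have "\<exists>S. finite S \<and> S \<subseteq> T \<and> (\<forall>t\<in>T. \<exists>s\<in>S. \<exists>t'\<in>T. t = s + of_nat p * t')"
    by (rule Z.finite_mod_p)
  then obtain S where "finite S" "S \<subseteq> T" "\<forall>t\<in>T. \<exists>s\<in>S. \<exists>t'\<in>T. t = s + of_nat p * t'"
    by blast
  then show ?thesis
    by (intro that[of "\<rho> ` S"]) (auto simp: OK_simps \<rho>_add[symmetric] \<rho>_mult[symmetric])
qed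

text \<open>What the counting has to know about K: \<open>\<kappa>\<close> numbers the residue
  classes, and a difference inside one class lies in the maximal ideal, so that p divides its e_K-th
  power.\<close>

lemma local_field:
  obtains \<kappa> :: "'a \<Rightarrow> nat" where
    "ram_index p K > 0"
    "\<And>y. Z.integral y \<Longrightarrow> \<rho> y \<in> K \<Longrightarrow> \<kappa> y < residue_card p K"
    "\<And>y z. Z.integral y \<Longrightarrow> \<rho> y \<in> K \<Longrightarrow> Z.integral z \<Longrightarrow> \<rho> z \<in> K \<Longrightarrow> \<kappa> y = \<kappa> z \<Longrightarrow>
       \<exists>b. Z.integral b \<and> (y - z) ^ ram_index p K = of_nat p * b"
proof -
  obtain S where S: "finite S" "S \<subseteq> carrier OK"
    "\<And>a. a \<in> carrier OK \<Longrightarrow> \<exists>s\<in>S. \<exists>y\<in>carrier OK. a = s \<oplus>\<^bsub>OK\<^esub> \<rho> (of_nat p) \<otimes>\<^bsub>OK\<^esub> y"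
    using OK_finite_mod_p by blast
  note hyps = OK_p OK_total S
  define M where "M = carrier OK - Units OK"
  have "maximalideal M OK" unfolding M_def by (rule OK.nonunits_maximal[OF hyps])
  then have mi: "max_ideal p K = M"
    unfolding max_ideal_def M_def
    by (rule the_equality) (rule OK.maximalideal_unique[OF hyps])
  interpret M: maximalideal M OK by fact
  obtain e :: nat where e: "e > 0"
    "\<And>n::nat. PIdl\<^bsub>OK\<^esub> \<rho> (of_nat p) = M [^]\<^bsub>ideals_set OK\<^esub> n \<longleftrightarrow> n = e"
    "\<And>a. a \<in> M \<Longrightarrow> \<rho> (of_nat p) divides\<^bsub>OK\<^esub> a [^]\<^bsub>OK\<^esub> e"
    using OK.ramification[OF hyps] unfolding M_def by blast
  have ram: "ram_index p K = e"
    unfolding ram_index_def OK_of_nat mi e(2) by simp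
  have fin: "finite (carrier (OK Quot M))" unfolding M_def by (rule OK.finite_residue_field[OF hyps])
  define q where "q = card (carrier (OK Quot M))"
  have q: "residue_card p K = q" by (simp add: q_def residue_card_def residue_field_def mi)
  obtain h where h: "bij_betw h (carrier (OK Quot M)) {0..<q}"
    using ex_bij_betw_finite_nat[OF fin] unfolding q_def by blast
  define \<kappa> where "\<kappa> y = h (M +>\<^bsub>OK\<^esub> \<rho> y)" for y
  have coset: "M +>\<^bsub>OK\<^esub> \<rho> y \<in> carrier (OK Quot M)" if "y \<in> T" for y
    using that by (auto simp: FactRing_def A_RCOSETS_def' OK_simps)
  have lt: "\<kappa> y < q" if "y \<in> T" for y
    using coset[OF that] h by (auto simp: \<kappa>_def bij_betw_def)
  have "\<exists>b. Z.integral b \<and> (y - z) ^ e = of_nat p * b" if yz: "y \<in> T" "z \<in> T" "\<kappa> y = \<kappa> z" for y z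
  proof -
    have "M +>\<^bsub>OK\<^esub> \<rho> y = M +>\<^bsub>OK\<^esub> \<rho> z"
      using yz coset h unfolding \<kappa>_def bij_betw_def inj_on_def by blast
    then have "\<rho> y \<ominus>\<^bsub>OK\<^esub> \<rho> z \<in> M"
      using OK.quotient_eq_iff_same_a_r_cos[OF M.ideal_axioms, of "\<rho> y" "\<rho> z"] yz by (auto simp: OK_simps)
    then have "\<rho> (of_nat p) divides\<^bsub>OK\<^esub> \<rho> ((y - z) ^ e)"
      using e(3) OK_minus[OF yz(1,2)] OK_power by metis
    then show ?thesis unfolding OK_divides by (auto simp: T_def)
  qed
  then show ?thesis using that[of \<kappa>] e(1) lt unfolding ram q T_def by blast
qed

end
end

section \<open>The algebraic numbers as a subfield of the complex numbers\<close>

abbreviation "CC \<equiv> (ring_of_type_algebra :: complex ring)"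

lemma CC_simps: "carrier CC = UNIV" "x \<otimes>\<^bsub>CC\<^esub> y = x * y" "\<one>\<^bsub>CC\<^esub> = 1" "\<zero>\<^bsub>CC\<^esub> = 0" "x \<oplus>\<^bsub>CC\<^esub> y = x + y"
  by (simp_all add: ring_of_type_algebra_def)

context
begin

interpretation CC: field CC by (rule field_from_type_algebra)

lemma CC_uminus: "\<ominus>\<^bsub>CC\<^esub> x = - x"
  by (intro CC.minus_equality) (auto simp: CC_simps)

lemma CC_inv: "x \<noteq> 0 \<Longrightarrow> inv\<^bsub>CC\<^esub> x = inverse x"
  by (intro CC.comm_inv_char) (auto simp: CC_simps)

lemma CC_power: "x [^]\<^bsub>CC\<^esub> n = x ^ (n :: nat)"
  by (induction n) (auto simp: CC_simps)

lemma CC_eval: "ring.eval CC xs x = poly (Poly (rev xs)) x"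
  by (induction xs) (simp_all add: CC_simps CC_power Poly_append poly_monom)

lemma subfield_Rats: "subfield \<rat> CC"
proof (rule CC.subfieldI')
  show "subring \<rat> CC"
    by (rule CC.subringI) (auto simp: CC_simps CC_uminus)
qed (auto simp: CC_simps CC_inv)

text \<open>Links the predicate on types with the notion of HOL-Algebra, for which
  \<open>subfield_of_algebraics\<close> gives closure under the field operations.\<close>

lemma algebraic_iff_over_Rats: "(CC.algebraic over \<rat>) x \<longleftrightarrow> algebraic x"
proof
  assume "(CC.algebraic over \<rat>) x"
  then obtain f where f: "f \<in> carrier (univ_poly CC \<rat>)" "f \<noteq> []" "ring.eval CC f x = \<zero>\<^bsub>CC\<^esub>"
    using CC.algebraicE[OF subfieldE(1)[OF subfield_Rats]] by (auto simp: CC_simps)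
  then have hd: "hd f \<noteq> 0" and sub: "set f \<subseteq> \<rat>" by (auto simp: univ_poly_def polynomial_def CC_simps)
  define g where "g = Poly (rev f)"
  have c: "coeffs g = rev f" using f(2) hd by (cases f) (auto simp: g_def strip_while_def)
  have "g \<noteq> 0" using c f(2) by auto
  moreover have "coeff g i \<in> \<rat>" for i
  proof (cases "i \<le> degree g")
    case True
    then show ?thesis using coeff_in_coeffs[OF \<open>g \<noteq> 0\<close>] c sub by auto
  qed (simp add: coeff_eq_0)
  moreover have "poly g x = 0" using f(3) by (simp add: CC_eval CC_simps g_def)
  ultimately show "algebraic x" by (auto simp: algebraic_altdef)
next
  assume "algebraic x"
  then obtain g where g: "\<And>i. coeff g i \<in> \<rat>" "g \<noteq> 0" "poly g x = 0" by (auto simp: algebraic_altdef)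
  have "rev (coeffs g) \<in> carrier (univ_poly CC \<rat>)"
    using g(1,2) last_coeffs_eq_coeff_degree[OF g(2)]
    by (auto simp: univ_poly_def polynomial_def CC_simps hd_rev coeffs_def)
  moreover have "ring.eval CC (rev (coeffs g)) x = \<zero>\<^bsub>CC\<^esub>" using g(3) by (simp add: CC_eval CC_simps)
  ultimately show "(CC.algebraic over \<rat>) x" using g(2) by (intro CC.algebraicI) auto
qed

lemma algebraic_subfield: "subfield {x. algebraic x} CC"
proof -
  have "subfield {x \<in> carrier CC. (CC.algebraic over \<rat>) x} CC"
    by (rule CC.subfield_of_algebraics[OF subfield_Rats])
  then show ?thesis by (simp add: CC_simps algebraic_iff_over_Rats)
qed

end

lemma Qbar_simps: "carrier Qbar = {z. algebraic z}" "x \<otimes>\<^bsub>Qbar\<^esub> y = x * y" "\<one>\<^bsub>Qbar\<^esub> = 1" "x \<oplus>\<^bsub>Qbar\<^esub> y = x + y"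
  by (simp_all add: Qbar_def CC_simps)

lemma algebraic_closed:
  fixes x y :: complex
  assumes "algebraic x" "algebraic y"
  shows "algebraic (x + y)" "algebraic (x * y)" "algebraic (x - y)"
proof -
  note sr = subringE[OF subfieldE(1)[OF algebraic_subfield]]
  have add: "algebraic (a + b)" if "algebraic a" "algebraic b" for a b :: complex
    using sr(7)[of a b] that by (simp add: CC_simps)
  show "algebraic (x + y)" using add assms .
  show "algebraic (x * y)" using sr(6)[of x y] assms by (simp add: CC_simps)
  show "algebraic (x - y)" using add[of x "- y"] assms by auto
qed

section \<open>The local bound\<close>

text \<open>With N_i elements in box i, Cauchy-Schwarz is applied to sqrt(wt i) and N_i / sqrt(wt
  i). The term N_i^2 / wt i counts the ordered pairs in box i, those with \<open>w = z\<close>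
  included.\<close>

lemma card_square_le_weighted_pairs:
  fixes wt :: "'b \<Rightarrow> real"
  assumes "finite C" "finite I" "\<And>z. z \<in> C \<Longrightarrow> cl z \<in> I" "\<And>i. i \<in> I \<Longrightarrow> wt i > 0"
  shows "(real (card C))\<^sup>2 / (\<Sum>i\<in>I. wt i) \<le> (\<Sum>z\<in>C. \<Sum>w\<in>{w\<in>C. cl w = cl z}. 1 / wt (cl z))"
proof -
  define N where "N i = real (card {z\<in>C. cl z = i})" for i
  have group: "(\<Sum>z\<in>C. g z) = (\<Sum>i\<in>I. \<Sum>z\<in>{z\<in>C. cl z = i}. g z)" for g :: "'a \<Rightarrow> real"
    using sum.group[of C I cl g] assms by (simp add: image_subset_iff)
  have "real (card C) = (\<Sum>z\<in>C. 1)" by simp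
  also have "\<dots> = (\<Sum>i\<in>I. N i)" unfolding group N_def by simp
  finally have cardC: "real (card C) = (\<Sum>i\<in>I. N i)" .
  have "(\<Sum>i\<in>I. N i) = (\<Sum>i\<in>I. sqrt (wt i) * (N i / sqrt (wt i)))"
    by (rule sum.cong) (use assms(4) in \<open>force+\<close>)
  then have "(real (card C))\<^sup>2 \<le> (\<Sum>i\<in>I. (sqrt (wt i))\<^sup>2) * (\<Sum>i\<in>I. (N i / sqrt (wt i))\<^sup>2)"
    using Cauchy_Schwarz_ineq_sum[of "\<lambda>i. sqrt (wt i)" "\<lambda>i. N i / sqrt (wt i)" I] cardC by simp
  also have "(\<Sum>i\<in>I. (sqrt (wt i))\<^sup>2) = (\<Sum>i\<in>I. wt i)"
    by (rule sum.cong) (use assms(4) in \<open>auto intro: less_imp_le\<close>)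
  also have "(\<Sum>i\<in>I. (N i / sqrt (wt i))\<^sup>2) = (\<Sum>i\<in>I. (N i)\<^sup>2 / wt i)"
    by (rule sum.cong) (use assms(4) in \<open>auto simp: power_divide intro: less_imp_le\<close>)
  also have "\<dots> = (\<Sum>i\<in>I. \<Sum>z\<in>{z\<in>C. cl z = i}. N i / wt i)"
    by (simp add: N_def power2_eq_square)
  also have "\<dots> = (\<Sum>z\<in>C. N (cl z) / wt (cl z))" unfolding group by simp
  also have "\<dots> = (\<Sum>z\<in>C. \<Sum>w\<in>{w\<in>C. cl w = cl z}. 1 / wt (cl z))" by (simp add: N_def)
  finally have main: "(real (card C))\<^sup>2 \<le> (\<Sum>i\<in>I. wt i) * (\<Sum>z\<in>C. \<Sum>w\<in>{w\<in>C. cl w = cl z}. 1 / wt (cl z))" .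
  show ?thesis
  proof (cases "I = {}")
    case False
    then have "(\<Sum>i\<in>I. wt i) > 0" using assms(2,4) by (intro sum_pos) auto
    then show ?thesis using main by (simp add: divide_le_eq mult.commute)
  next
    case True
    then have "C = {}" using assms(3) by auto
    then show ?thesis by simp
  qed
qed

text \<open>A predicate of the prime alone, closed over \<open>j\<close>, \<open>C\<close> and
  \<open>D\<close>, so that a single well-chosen prime can settle it for all. \<open>D\<close> is
  the discriminant up to sign.\<close>

definition local_bound :: "nat \<Rightarrow> bool" where
  "local_bound p \<longleftrightarrow> (\<forall>j C D. j \<in> ring_hom Qbar (Qp_bar p) \<longrightarrow> finite C \<longrightarrow> (\<forall>z\<in>C. algebraic_int z) \<longrightarrow>
     D \<noteq> 0 \<longrightarrow> of_int D = (\<Prod>z\<in>C. \<Prod>w\<in>C - {z}. z - w) \<longrightarrow>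
     (let \<K> = (\<lambda>z. Qp_adjoin p (j z)) ` C in
       (real (card C))\<^sup>2 / (\<Sum>K\<in>\<K>. real (ram_index p K) * real (residue_card p K))
         - (\<Sum>K\<in>\<K>. real (card {z\<in>C. j z \<in> K}) / real (ram_index p K)) \<le> real (multiplicity (int p) D)))"

lemma (in padic_closure_type) local_boundI: "local_bound p"
  unfolding local_bound_def Let_def
proof (intro allI impI)
  fix j and C :: "complex set" and D :: int
  assume j: "j \<in> ring_hom Qbar L" and C: "finite C" "\<forall>z\<in>C. algebraic_int z" and D: "D \<noteq> 0"
    "of_int D = (\<Prod>z\<in>C. \<Prod>w\<in>C - {z}. z - w)"
  \<comment> \<open>The embedding read in the field type. As \<open>j\<close> is a homomorphism on
    \<open>Qbar\<close>, the laws for \<open>\<phi>\<close> are stated for algebraic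
    arguments.\<close>
  define \<phi> where "\<phi> z = inv_into UNIV \<rho> (j z)" for z
  have \<rho>\<phi>: "\<rho> (\<phi> z) = j z" if "algebraic z" for z
    unfolding \<phi>_def using that \<rho>_bij ring_hom_closed[OF j, of z]
    by (intro f_inv_into_f) (auto simp: bij_betw_def Qbar_simps)
  have \<phi>_add: "\<phi> (z + w) = \<phi> z + \<phi> w" if "algebraic z" "algebraic w" for z w
    using ring_hom_add[OF j, of z w] that algebraic_closed[OF that]
    by (subst \<rho>_inj[symmetric]) (simp add: \<rho>\<phi> \<rho>_add Qbar_simps)
  have \<phi>_mult: "\<phi> (z * w) = \<phi> z * \<phi> w" if "algebraic z" "algebraic w" for z w
    using ring_hom_mult[OF j, of z w] that algebraic_closed[OF that]
    by (subst \<rho>_inj[symmetric]) (simp add: \<rho>\<phi> \<rho>_mult Qbar_simps)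
  have alg_int: "algebraic (of_int m :: complex)" for m by (intro rat_imp_algebraic) simp
  have alg_0: "algebraic (0 :: complex)" by simp
  have \<phi>_0: "\<phi> 0 = 0" using \<phi>_add[OF alg_0 alg_0] by (metis add.right_neutral add_left_cancel)
  have alg_1: "algebraic (1 :: complex)" using alg_int[of 1] by simp
  have \<phi>_1: "\<phi> 1 = 1"
    using ring_hom_one[OF j] by (subst \<rho>_inj[symmetric]) (simp add: \<rho>\<phi> \<rho>_1 Qbar_simps alg_1)
  have \<phi>_diff: "\<phi> (z - w) = \<phi> z - \<phi> w" if "algebraic z" "algebraic w" for z w
    using \<phi>_add[of "z - w" w] algebraic_closed[OF that] that by simp
  have \<phi>_of_nat: "\<phi> (of_nat n) = of_nat n" for n
  proof (induction n)
    case (Suc n)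
    then show ?case using \<phi>_add[OF alg_1, of "of_nat n"] alg_int[of "int n"] \<phi>_1 by simp
  qed (simp add: \<phi>_0)
  have \<phi>_of_int: "\<phi> (of_int m) = of_int m" for m
  proof (cases m)
    case (neg n)
    have "\<phi> (0 - of_nat (Suc n)) = \<phi> 0 - \<phi> (of_nat (Suc n))"
      using alg_int[of "int (Suc n)"] by (intro \<phi>_diff) simp_all
    then show ?thesis unfolding neg \<phi>_of_nat \<phi>_0 by simp
  qed (simp add: \<phi>_of_nat)
  have \<phi>_prod: "algebraic (prod f A) \<and> \<phi> (prod f A) = (\<Prod>a\<in>A. \<phi> (f a))"
    if "\<And>a. a \<in> A \<Longrightarrow> algebraic (f a)" for f :: "complex \<Rightarrow> complex" and A
    using that by (induction A rule: infinite_finite_induct) (auto simp: \<phi>_1 alg_1 \<phi>_mult intro: algebraic_closed)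
  have algC: "algebraic z" if "z \<in> C" for z using C(2) that by auto
  have "of_int D = \<phi> (\<Prod>z\<in>C. \<Prod>w\<in>C - {z}. z - w)" using \<phi>_of_int[of D] D(2) by simp
  also have "\<dots> = (\<Prod>z\<in>C. \<phi> (\<Prod>w\<in>C - {z}. z - w))"
    by (rule conjunct2[OF \<phi>_prod], rule conjunct1[OF \<phi>_prod]) (use algC in \<open>auto intro: algebraic_closed\<close>)
  also have "\<dots> = (\<Prod>z\<in>C. \<Prod>w\<in>C - {z}. \<phi> z - \<phi> w)"
  proof (rule prod.cong[OF refl])
    fix z assume z: "z \<in> C"
    have "\<phi> (\<Prod>w\<in>C - {z}. z - w) = (\<Prod>w\<in>C - {z}. \<phi> (z - w))"
      by (rule conjunct2[OF \<phi>_prod]) (use algC z in \<open>auto intro: algebraic_closed\<close>)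
    also have "\<dots> = (\<Prod>w\<in>C - {z}. \<phi> z - \<phi> w)"
      by (intro prod.cong refl \<phi>_diff) (use algC z in auto)
    finally show "\<phi> (\<Prod>w\<in>C - {z}. z - w) = (\<Prod>w\<in>C - {z}. \<phi> z - \<phi> w)" .
  qed
  finally have D': "of_int D = (\<Prod>z\<in>C. \<Prod>w\<in>C - {z}. \<phi> z - \<phi> w)" .
  have int: "Z.integral (\<phi> z)" if z: "z \<in> C" for z
  proof -
    obtain f where f: "poly (map_poly of_int f) z = 0" "lead_coeff f = 1"
      using C(2) z algebraic_int_altdef_ipoly by blast
    have eval: "algebraic (poly (map_poly of_int g) z) \<and> \<phi> (poly (map_poly of_int g) z) = poly (map_poly of_int g) (\<phi> z)"
      for g :: "int poly"
    proof (induction g)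
      case (pCons a g)
      then have "algebraic (z * poly (map_poly of_int g) z)" using algC[OF z] algebraic_closed by blast
      then show ?case
        using pCons algC[OF z] alg_int[of a] algebraic_closed
        by (auto simp: map_poly_pCons \<phi>_add \<phi>_mult \<phi>_of_int)
    qed (simp add: \<phi>_0)
    then have "poly (map_poly of_int f) (\<phi> z) = 0" using f(1) \<phi>_0 by metis
    moreover have "map_poly of_int f \<in> Z.Zpoly" by (simp add: Z.Zpoly_def coeff_map_poly Z.Z_of_int)
    moreover have "lead_coeff (map_poly of_int f :: 'a poly) = 1"
    proof -
      have "degree (map_poly of_int f :: 'a poly) = degree f"
        by (rule antisym[OF degree_le le_degree]) (auto simp: coeff_map_poly coeff_eq_0 f(2))
      then show ?thesis using f(2) by (simp add: coeff_map_poly)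
    qed
    ultimately show ?thesis unfolding Z.integral_def by blast
  qed
  define Kf where "Kf z = Qp_adjoin p (j z)" for z
  define \<K> where "\<K> = Kf ` C"
  have Kf: "Kf z = Qp_adjoin p (\<rho> (\<phi> z))" if "z \<in> C" for z using \<rho>\<phi>[OF algC[OF that]] by (simp add: Kf_def)
  \<comment> \<open>Bundled into one predicate so that a residue numbering can be chosen for all K
    simultaneously.\<close>
  define good where "good K \<kappa> \<longleftrightarrow> ram_index p K > 0 \<and>
    (\<forall>y. Z.integral y \<longrightarrow> \<rho> y \<in> K \<longrightarrow> \<kappa> y < residue_card p K) \<and>
    (\<forall>y z. Z.integral y \<longrightarrow> \<rho> y \<in> K \<longrightarrow> Z.integral z \<longrightarrow> \<rho> z \<in> K \<longrightarrow> \<kappa> y = \<kappa> z \<longrightarrow>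
       (\<exists>b. Z.integral b \<and> (y - z) ^ ram_index p K = of_nat p * b))"
    for K and \<kappa> :: "'a \<Rightarrow> nat"
  have "\<exists>\<kappa>. good K \<kappa>" if K: "K \<in> \<K>" for K
  proof -
    obtain z where z: "z \<in> C" "K = Qp_adjoin p (\<rho> (\<phi> z))" using K Kf by (auto simp: \<K>_def)
    show ?thesis unfolding good_def by (rule local_field[OF int[OF z(1)] z(2)]) blast
  qed
  then obtain \<kappa> where \<kappa>: "\<And>K. K \<in> \<K> \<Longrightarrow> good K (\<kappa> K)" by metis
  have e_pos: "\<And>K. K \<in> \<K> \<Longrightarrow> ram_index p K > 0"
    and \<kappa>_less: "\<And>K y. K \<in> \<K> \<Longrightarrow> Z.integral y \<Longrightarrow> \<rho> y \<in> K \<Longrightarrow> \<kappa> K y < residue_card p K"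
    and \<kappa>_eq: "\<And>K y z. K \<in> \<K> \<Longrightarrow> Z.integral y \<Longrightarrow> \<rho> y \<in> K \<Longrightarrow> Z.integral z \<Longrightarrow> \<rho> z \<in> K \<Longrightarrow> \<kappa> K y = \<kappa> K z \<Longrightarrow>
       \<exists>b. Z.integral b \<and> (y - z) ^ ram_index p K = of_nat p * b"
    using \<kappa> unfolding good_def by blast+
  have mem: "\<rho> (\<phi> z) \<in> Kf z" if "z \<in> C" for z
    using K_incl(1)[OF int[OF that] Kf[OF that]] .
  \<comment> \<open>The box of a conjugate: its field together with its residue class there. A box
    of K has weight e_K, so the total weight is the sum of the e_K q_K.\<close>
  define cl where "cl z = (Kf z, \<kappa> (Kf z) (\<phi> z))" for z
  define I where "I = Sigma \<K> (\<lambda>K. {..<residue_card p K})"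
  define wt where "wt i = real (ram_index p (fst i))" for i :: "padic_closure set \<times> nat"
  have fin\<K>: "finite \<K>" using C(1) by (simp add: \<K>_def)
  have clI: "cl z \<in> I" if "z \<in> C" for z
    using that \<kappa>_less[OF _ int mem] by (auto simp: cl_def I_def \<K>_def)
  have step1: "(real (card C))\<^sup>2 / (\<Sum>i\<in>I. wt i) \<le> (\<Sum>z\<in>C. \<Sum>w\<in>{w\<in>C. cl w = cl z}. 1 / wt (cl z))"
    by (rule card_square_le_weighted_pairs)
       (use C(1) fin\<K> clI e_pos in \<open>auto simp: I_def wt_def\<close>)
  have sumI: "(\<Sum>i\<in>I. wt i) = (\<Sum>K\<in>\<K>. real (ram_index p K) * real (residue_card p K))"
    unfolding I_def wt_def
    using sum.Sigma[OF fin\<K>, of "\<lambda>K. {..<residue_card p K}" "\<lambda>K _. real (ram_index p K)"]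
    by (simp add: case_prod_unfold mult.commute)
  \<comment> \<open>A common multiple of all e_K: inside a box of K the E-th power of a difference
    is divisible by p to the integral exponent E / e_K, a substitute for valuation 1/e_K.\<close>
  define E where "E = (\<Prod>K\<in>\<K>. ram_index p K)"
  have E: "E > 0" unfolding E_def using e_pos by (intro prod_pos) auto
  have Ediv: "ram_index p K dvd E" if "K \<in> \<K>" for K unfolding E_def using that fin\<K> by (rule dvd_prodI[rotated])
  define n where "n z w = (if cl w = cl z then E div ram_index p (Kf z) else 0)" for z w
  have pair: "\<exists>b. Z.integral b \<and> (\<phi> z - \<phi> w) ^ E = of_nat p ^ n z w * b" if zw: "z \<in> C" "w \<in> C" for z w
  proof (cases "cl w = cl z")
    case True
    then have "\<kappa> (Kf z) (\<phi> z) = \<kappa> (Kf z) (\<phi> w)" "Kf w = Kf z" by (auto simp: cl_def)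
    then obtain b where b: "Z.integral b" "(\<phi> z - \<phi> w) ^ ram_index p (Kf z) = of_nat p * b"
      using \<kappa>_eq[of "Kf z" "\<phi> z" "\<phi> w"] zw int mem by (auto simp: \<K>_def)
    have "(\<phi> z - \<phi> w) ^ E = ((\<phi> z - \<phi> w) ^ ram_index p (Kf z)) ^ n z w"
      using Ediv[of "Kf z"] zw True by (simp add: n_def \<K>_def flip: power_mult)
    also have "\<dots> = of_nat p ^ n z w * b ^ n z w" unfolding b(2) by (rule power_mult_distrib)
    finally show ?thesis using Z.integral_power[OF b(1)] by blast
  next
    case False
    then show ?thesis using Z.integral_power[OF Z.integral_diff[OF int int]] zw by (auto simp: n_def)
  qed
  then obtain b where b: "\<And>z w. z \<in> C \<Longrightarrow> w \<in> C \<Longrightarrow> Z.integral (b z w) \<and> (\<phi> z - \<phi> w) ^ E = of_nat p ^ n z w * b z w"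
    by metis
  define N where "N = (\<Sum>z\<in>C. \<Sum>w\<in>C - {z}. n z w)"
  have "of_int (D ^ E) = (\<Prod>z\<in>C. \<Prod>w\<in>C - {z}. (\<phi> z - \<phi> w) ^ E)"
    by (simp add: D' flip: prod_power_distrib)
  also have "\<dots> = (\<Prod>z\<in>C. \<Prod>w\<in>C - {z}. of_nat p ^ n z w * b z w)"
    by (intro prod.cong) (use b in auto)
  also have "\<dots> = of_nat p ^ N * (\<Prod>z\<in>C. \<Prod>w\<in>C - {z}. b z w)"
    by (simp add: prod.distrib N_def power_sum)
  finally have "int p ^ N dvd D ^ E"
    by (rule Z.multiplicity_of_integral_quotient) (use b prime_p in \<open>auto intro!: Z.integral_prod\<close>)
  then have "N \<le> multiplicity (int p) (D ^ E)"
    using D(1) p_gt_1 by (intro multiplicity_geI) auto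
  also have "\<dots> = E * multiplicity (int p) D"
    using D(1) prime_p by (intro prime_elem_multiplicity_power_distrib) auto
  finally have N_le: "real N / real E \<le> real (multiplicity (int p) D)"
    using E by (simp add: divide_le_eq mult.commute flip: of_nat_mult)
  have "real N / real E = (\<Sum>z\<in>C. \<Sum>w\<in>C - {z}. real (n z w) / real E)"
    by (simp add: N_def sum_divide_distrib)
  also have "\<dots> = (\<Sum>z\<in>C. \<Sum>w\<in>C - {z}. if cl w = cl z then 1 / wt (cl z) else 0)"
  proof (intro sum.cong refl)
    fix z w assume "z \<in> C" "w \<in> C - {z}"
    then have "Kf z \<in> \<K>" by (auto simp: \<K>_def)
    then show "real (n z w) / real E = (if cl w = cl z then 1 / wt (cl z) else 0)"
      using Ediv[of "Kf z"] e_pos[of "Kf z"] E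
      by (auto simp: n_def wt_def cl_def real_of_nat_div field_simps)
  qed
  \<comment> \<open>The pair \<open>w = z\<close> is added and removed again: it lies in one box but
    contributes no factor to \<open>D\<close>.\<close>
  also have "\<dots> = (\<Sum>z\<in>C. (\<Sum>w\<in>C. if cl w = cl z then 1 / wt (cl z) else 0) - 1 / wt (cl z))"
    by (intro sum.cong refl) (subst sum_diff1, use C(1) in auto)
  also have "\<dots> = (\<Sum>z\<in>C. \<Sum>w\<in>{w\<in>C. cl w = cl z}. 1 / wt (cl z)) - (\<Sum>z\<in>C. 1 / wt (cl z))"
    by (simp only: sum_subtractf sum.inter_filter[OF C(1)])
  finally have NE: "real N / real E = (\<Sum>z\<in>C. \<Sum>w\<in>{w\<in>C. cl w = cl z}. 1 / wt (cl z)) - (\<Sum>z\<in>C. 1 / wt (cl z))" .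
  have "(\<Sum>z\<in>C. 1 / wt (cl z)) = (\<Sum>K\<in>\<K>. \<Sum>z\<in>{z\<in>C. Kf z = K}. 1 / wt (cl z))"
    using sum.group[of C \<K> Kf "\<lambda>z. 1 / wt (cl z)"] C(1) fin\<K> by (auto simp: \<K>_def)
  also have "\<dots> = (\<Sum>K\<in>\<K>. real (card {z\<in>C. Kf z = K}) / real (ram_index p K))"
    by (intro sum.cong) (auto simp: wt_def cl_def)
  \<comment> \<open>A conjugate generating K lies in K; on the right those generating a proper
    subfield of K are counted as well.\<close>
  also have "\<dots> \<le> (\<Sum>K\<in>\<K>. real (card {z\<in>C. j z \<in> K}) / real (ram_index p K))"
    using mem \<rho>\<phi> algC C(1)
    by (intro sum_mono divide_right_mono) (auto intro!: card_mono)
  finally have "(real (card C))\<^sup>2 / (\<Sum>K\<in>\<K>. real (ram_index p K) * real (residue_card p K))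
         - (\<Sum>K\<in>\<K>. real (card {z\<in>C. j z \<in> K}) / real (ram_index p K)) \<le> real (multiplicity (int p) D)"
    using step1 NE N_le unfolding sumI by linarith
  then show "(real (card C))\<^sup>2 / (\<Sum>K\<in>(\<lambda>z. Qp_adjoin p (j z)) ` C. real (ram_index p K) * real (residue_card p K))
         - (\<Sum>K\<in>(\<lambda>z. Qp_adjoin p (j z)) ` C. real (card {z\<in>C. j z \<in> K}) / real (ram_index p K)) \<le> real (multiplicity (int p) D)"
    unfolding \<K>_def Kf_def .
qed

text \<open>A type cannot depend on the variable \<open>p\<close>, so \<open>local_bound\<close> is proved for one prime at which
  it fails if it fails anywhere.\<close>

definition critical_prime :: nat where
  "critical_prime = (SOME p. prime p \<and>
     (local_bound p \<longrightarrow> (\<forall>q::nat. prime q \<longrightarrow> local_bound q)))"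

lemma critical_prime:
  shows prime_critical_prime: "prime critical_prime"
    and local_bound_if_critical: "local_bound critical_prime \<Longrightarrow> prime q \<Longrightarrow> local_bound q"
proof -
  \<comment> \<open>A prime at which \<open>local_bound\<close> fails is a witness because the
    implication is then vacuous; if there is none, any prime will do.\<close>
  have "\<exists>p. prime p \<and>
     (local_bound p \<longrightarrow> (\<forall>q::nat. prime q \<longrightarrow> local_bound q))"
    using two_is_prime_nat by blast
  from someI_ex[OF this]
  show "prime critical_prime"
    and "local_bound critical_prime \<Longrightarrow> prime q \<Longrightarrow> local_bound q"
    unfolding critical_prime_def[symmetric] by blast+
qed

lemma field_Qp_bar: "prime p \<Longrightarrow> field (Qp_bar p)"
  using field.alg_closureE(1)[OF prime_nat.field_Qp[OF prime_nat.intro]]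
  unfolding Qp_bar_def by (auto simp: algebraic_closure_def)

section \<open>A field type for the algebraic closure at the critical prime\<close>

typedef critical_closure = "carrier (Qp_bar critical_prime)"
  using field_Qp_bar[OF prime_critical_prime] monoid.one_closed[of "Qp_bar critical_prime"]
  by (auto simp: field_def domain_def cring_def ring_def)

setup_lifting type_definition_critical_closure

instantiation critical_closure :: field
begin

context
begin

interpretation K: field "Qp_bar critical_prime"
  by (rule field_Qp_bar[OF prime_critical_prime])

lift_definition zero_critical_closure :: critical_closure is "\<zero>\<^bsub>Qp_bar critical_prime\<^esub>"
  by (rule K.zero_closed)

lift_definition one_critical_closure :: critical_closure is "\<one>\<^bsub>Qp_bar critical_prime\<^esub>"
  by (rule K.one_closed)

lift_definition plus_critical_closure :: "critical_closure \<Rightarrow> critical_closure \<Rightarrow> critical_closure"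
  is "ring.add (Qp_bar critical_prime)"
  by (rule K.a_closed)

lift_definition minus_critical_closure :: "critical_closure \<Rightarrow> critical_closure \<Rightarrow> critical_closure"
  is "a_minus (Qp_bar critical_prime)"
  by (rule K.minus_closed)

lift_definition times_critical_closure :: "critical_closure \<Rightarrow> critical_closure \<Rightarrow> critical_closure"
  is "monoid.mult (Qp_bar critical_prime)"
  by (rule K.m_closed)

lift_definition uminus_critical_closure :: "critical_closure \<Rightarrow> critical_closure"
  is "a_inv (Qp_bar critical_prime)"
  by (rule K.a_inv_closed)

text \<open>The class \<open>field\<close> fixes \<open>inverse 0 = 0\<close>, whereas
  \<open>m_inv\<close> at zero is unspecified and might leave the carrier.\<close>

lift_definition inverse_critical_closure :: "critical_closure \<Rightarrow> critical_closure"
  is "\<lambda>x. if x = \<zero>\<^bsub>Qp_bar critical_prime\<^esub> then \<zero>\<^bsub>Qp_bar critical_prime\<^esub> else m_inv (Qp_bar critical_prime) x"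
  by (auto simp: K.field_Units)

lift_definition divide_critical_closure :: "critical_closure \<Rightarrow> critical_closure \<Rightarrow> critical_closure"
  is "\<lambda>x y. if y = \<zero>\<^bsub>Qp_bar critical_prime\<^esub> then \<zero>\<^bsub>Qp_bar critical_prime\<^esub>
    else x \<otimes>\<^bsub>Qp_bar critical_prime\<^esub> m_inv (Qp_bar critical_prime) y"
  by (auto simp: K.field_Units)

end

instance
proof intro_classes
  interpret K: field "Qp_bar critical_prime" by (rule field_Qp_bar[OF prime_critical_prime])
  fix a b c :: critical_closure
  show "a * b * c = a * (b * c)" by transfer (rule K.m_assoc)
  show "a * b = b * a" by transfer (rule K.m_comm)
  show "1 * a = a" by transfer (rule K.l_one)
  show "a + b + c = a + (b + c)" by transfer (rule K.a_assoc)
  show "a + b = b + a" by transfer (rule K.a_comm)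
  show "0 + a = a" by transfer (rule K.l_zero)
  show "- a + a = 0" by transfer (rule K.l_neg)
  show "a - b = a + - b" by transfer (simp add: a_minus_def)
  show "(a + b) * c = a * c + b * c" by transfer (rule K.l_distr)
  show "(0::critical_closure) \<noteq> 1" by transfer (rule K.zero_not_one)
  show "a \<noteq> 0 \<Longrightarrow> inverse a * a = 1" by transfer (auto simp: K.field_Units)
  show "a div b = a * inverse b" by transfer auto
  show "inverse (0::critical_closure) = 0" by transfer simp
qed

end

lemma padic_closure_type_critical: "padic_closure_type critical_prime Rep_critical_closure"
proof
  show "prime critical_prime" by (rule prime_critical_prime)
  show "bij_betw Rep_critical_closure UNIV (carrier (Qp_bar critical_prime))"
    unfolding bij_betw_def inj_def
    using Rep_critical_closure_inject type_definition.Rep_range[OF type_definition_critical_closure] by auto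
qed (simp_all add: plus_critical_closure.rep_eq times_critical_closure.rep_eq
    zero_critical_closure.rep_eq one_critical_closure.rep_eq)

theorem local_bound_prime: "prime p \<Longrightarrow> local_bound p"
  by (rule local_bound_if_critical[OF padic_closure_type.local_boundI[OF padic_closure_type_critical]])

section \<open>The Vandermonde determinant and Hadamard's inequality\<close>

lemma prod_list_diag_mat:
  assumes "A \<in> carrier_mat n n" shows "prod_list (diag_mat A) = (\<Prod>i<n. A $$ (i, i))"
  using assms by (simp add: diag_mat_def prod.list_conv_set_nth atLeast0LessThan)

text \<open>Column operations turn the powers \<open>X\<^sup>j\<close> into the Newton basis \<open>P j\<close>, in which the
  matrix is triangular.\<close>

lemma det_Vandermonde:
  fixes z :: "nat \<Rightarrow> 'a::idom"
  shows "det (mat n n (\<lambda>(i, j). z i ^ j)) = (\<Prod>i<n. \<Prod>k<i. z i - z k)"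
proof -
  define P where "P j = (\<Prod>k<j. [:- z k, 1:])" for j
  have deg: "degree (P j) = j" "coeff (P j) j = 1" for j
  proof -
    show d: "degree (P j) = j"
      unfolding P_def by (subst degree_prod_eq_sum_degree) auto
    have "lead_coeff (P j) = 1" unfolding P_def lead_coeff_prod by simp
    then show "coeff (P j) j = 1" by (simp add: d)
  qed
  have P0: "poly (P j) (z i) = 0" if "i < j" for i j
    using that by (auto simp: P_def poly_prod)
  define V where "V = mat n n (\<lambda>(i, j). z i ^ j)"
  define U where "U = mat n n (\<lambda>(k, j). coeff (P j) k)"
  define W where "W = mat n n (\<lambda>(i, j). poly (P j) (z i))"
  have "V * U = W"
  proof (rule eq_matI)
    fix i j assume ij: "i < dim_row W" "j < dim_col W"
    then have ij: "i < n" "j < n" by (auto simp: W_def)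
    have "poly (P j) (z i) = (\<Sum>k\<le>j. coeff (P j) k * z i ^ k)"
      by (simp add: poly_altdef deg)
    also have "\<dots> = (\<Sum>k<n. z i ^ k * coeff (P j) k)"
      using ij by (intro sum.mono_neutral_cong_left) (auto simp: coeff_eq_0 deg mult.commute)
    finally show "(V * U) $$ (i, j) = W $$ (i, j)"
      using ij by (simp add: V_def U_def W_def scalar_prod_def atLeast0LessThan)
  qed (auto simp: V_def U_def W_def)
  moreover have "V \<in> carrier_mat n n" "U \<in> carrier_mat n n" "W \<in> carrier_mat n n"
    by (auto simp: V_def U_def W_def)
  moreover have "det U = 1"
  proof -
    have "det U = prod_list (diag_mat U)"
      by (rule det_upper_triangular) (auto simp: U_def coeff_eq_0 deg upper_triangular_def)
    also have "\<dots> = 1" by (subst prod_list_diag_mat[of _ n]) (auto simp: U_def deg)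
    finally show ?thesis .
  qed
  moreover have "det W = (\<Prod>i<n. \<Prod>k<i. z i - z k)"
  proof -
    have "det W = prod_list (diag_mat W)"
      by (rule det_lower_triangular[of n]) (auto simp: W_def P0)
    also have "\<dots> = (\<Prod>i<n. \<Prod>k<i. z i - z k)"
      by (subst prod_list_diag_mat[of _ n]) (auto simp: W_def P_def poly_prod)
    finally show ?thesis .
  qed
  ultimately show ?thesis using det_mult[of V n U] by (simp add: V_def)
qed

section \<open>Gram-Schmidt orthogonalisation in complex n-space\<close>

definition cip :: "nat \<Rightarrow> (nat \<Rightarrow> complex) \<Rightarrow> (nat \<Rightarrow> complex) \<Rightarrow> complex" where
  "cip n u v = (\<Sum>j<n. u j * cnj (v j))"

lemma cip_self: "cip n u u = of_real (\<Sum>j<n. (cmod (u j))\<^sup>2)"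
  unfolding cip_def of_real_sum by (rule sum.cong[OF refl]) (simp only: complex_norm_square)

lemma cip_commute: "cip n v u = cnj (cip n u v)"
  by (simp add: cip_def mult.commute)

lemma cip_diff_left: "cip n (\<lambda>j. u j - w j) v = cip n u v - cip n w v"
  by (simp add: cip_def sum_subtractf algebra_simps)

lemma cip_sum_left: "cip n (\<lambda>j. \<Sum>k<m. c k * w k j) v = (\<Sum>k<m. c k * cip n (w k) v)"
proof -
  have "cip n (\<lambda>j. \<Sum>k<m. c k * w k j) v = (\<Sum>j<n. \<Sum>k<m. c k * w k j * cnj (v j))"
    by (simp add: cip_def sum_distrib_right)
  also have "\<dots> = (\<Sum>k<m. \<Sum>j<n. c k * w k j * cnj (v j))" by (rule sum.swap)
  finally show ?thesis by (simp add: cip_def sum_distrib_left mult.assoc)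
qed

text \<open>Gram-Schmidt without normalisation. If an earlier vector vanishes, its coefficient is 0
  by division by zero, and orthogonality survives by \<open>cip_self_eq_0\<close>.\<close>

fun gs :: "nat \<Rightarrow> (nat \<Rightarrow> nat \<Rightarrow> complex) \<Rightarrow> nat \<Rightarrow> nat \<Rightarrow> complex" where
  "gs n a i = (\<lambda>j. a i j - (\<Sum>k<i. cip n (a i) (gs n a k) / cip n (gs n a k) (gs n a k) * gs n a k j))"

declare gs.simps [simp del]

lemma cip_self_eq_0: "cip n v v = 0 \<Longrightarrow> cip n u v = 0"
proof -
  assume "cip n v v = 0"
  then have "(\<Sum>j<n. (cmod (v j))\<^sup>2) = 0" unfolding cip_self of_real_eq_0_iff .
  then have "\<forall>j\<in>{..<n}. (cmod (v j))\<^sup>2 = 0" by (subst (asm) sum_nonneg_eq_0_iff) auto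
  then show ?thesis by (simp add: cip_def)
qed

text \<open>By induction every projection other than the one along the \<open>k\<close>-th vector is
  orthogonal to that vector, and the remaining one cancels the product with
  \<open>a i\<close>.\<close>

lemma gs_orthogonal: "k < i \<Longrightarrow> cip n (gs n a i) (gs n a k) = 0"
proof (induction i arbitrary: k rule: less_induct)
  case (less i)
  let ?b = "gs n a"
  have "cip n (?b i) (?b k) = cip n (a i) (?b k) - (\<Sum>l<i. cip n (a i) (?b l) / cip n (?b l) (?b l) * cip n (?b l) (?b k))"
    by (subst gs.simps) (simp only: cip_diff_left cip_sum_left)
  also have "(\<Sum>l<i. cip n (a i) (?b l) / cip n (?b l) (?b l) * cip n (?b l) (?b k)) =
    (\<Sum>l\<in>{k}. cip n (a i) (?b l) / cip n (?b l) (?b l) * cip n (?b l) (?b k))"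
  proof (rule sum.mono_neutral_right)
    show "\<forall>l\<in>{..<i} - {k}. cip n (a i) (?b l) / cip n (?b l) (?b l) * cip n (?b l) (?b k) = 0"
    proof
      fix l assume "l \<in> {..<i} - {k}"
      then have "l < k \<or> k < l" "l < i" by auto
      then have "cip n (?b l) (?b k) = 0"
        using less.IH[of l k] less.IH[of k l] less.prems cip_commute[of n "?b l" "?b k"] by auto
      then show "cip n (a i) (?b l) / cip n (?b l) (?b l) * cip n (?b l) (?b k) = 0" by simp
    qed
  qed (use less.prems in auto)
  finally show ?case using cip_self_eq_0[of n "?b k" "a i"] by (cases "cip n (?b k) (?b k) = 0") auto
qed

text \<open>Pythagoras: \<open>a i\<close> is the orthogonal sum of its Gram-Schmidt vector and a
  combination \<open>c\<close> of the earlier ones.\<close>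

lemma gs_norm_le: "(\<Sum>j<n. (cmod (gs n a i j))\<^sup>2) \<le> (\<Sum>j<n. (cmod (a i j))\<^sup>2)"
proof -
  let ?b = "gs n a"
  define c where "c j = (\<Sum>k<i. cip n (a i) (?b k) / cip n (?b k) (?b k) * ?b k j)" for j
  have a: "a i j = ?b i j + c j" for j by (subst gs.simps) (simp add: c_def)
  have "cip n c (?b i) = 0"
    unfolding c_def cip_sum_left using gs_orthogonal[of _ i n a] cip_commute[of n _ "?b i"]
    by (intro sum.neutral) auto
  then have z: "(\<Sum>j<n. Re (c j * cnj (?b i j))) = 0" by (simp only: cip_def Re_sum[symmetric]) simp
  have sq: "(cmod (u + v))\<^sup>2 = (cmod u)\<^sup>2 + (cmod v)\<^sup>2 + 2 * Re (v * cnj u)" for u v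
    by (simp only: cmod_power2) (simp add: algebra_simps power2_eq_square)
  have "(\<Sum>j<n. (cmod (a i j))\<^sup>2) =
    (\<Sum>j<n. (cmod (?b i j))\<^sup>2 + (cmod (c j))\<^sup>2 + 2 * Re (c j * cnj (?b i j)))"
    unfolding a sq ..
  also have "\<dots> = (\<Sum>j<n. (cmod (?b i j))\<^sup>2) + (\<Sum>j<n. (cmod (c j))\<^sup>2)"
    using z by (simp add: sum.distrib flip: sum_distrib_left)
  finally show ?thesis by (simp add: sum_nonneg)
qed

lemma comm_ring_hom_cnj: "comm_ring_hom cnj"
  by unfold_locales auto

text \<open>A = L B with \<open>L\<close> unitriangular and the Gram-Schmidt vectors as rows of
  \<open>B\<close>. The Gram matrix of these rows is diagonal, so |det A|^2 is the product of their
  squared norms, which \<open>gs_norm_le\<close> bounds.\<close>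

theorem Hadamard_inequality:
  "(cmod (det (mat n n (\<lambda>(i, j). a i j))))\<^sup>2 \<le> (\<Prod>i<n. \<Sum>j<n. (cmod (a i j))\<^sup>2)"
proof -
  let ?b = "gs n a"
  define A where "A = mat n n (\<lambda>(i, j). a i j)"
  define B where "B = mat n n (\<lambda>(i, j). ?b i j)"
  define B' where "B' = mat n n (\<lambda>(i, j). cnj (?b j i))"
  define L where "L = mat n n (\<lambda>(i, k). if k < i then cip n (a i) (?b k) / cip n (?b k) (?b k) else if k = i then 1 else 0)"
  define G where "G = mat n n (\<lambda>(i, k). cip n (?b i) (?b k))"
  have car: "A \<in> carrier_mat n n" "B \<in> carrier_mat n n" "B' \<in> carrier_mat n n" "L \<in> carrier_mat n n" "G \<in> carrier_mat n n"
    by (auto simp: A_def B_def B'_def L_def G_def)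
  have "L * B = A"
  proof (rule eq_matI)
    fix i j assume "i < dim_row A" "j < dim_col A"
    then have ij: "i < n" "j < n" by (auto simp: A_def)
    have "(L * B) $$ (i, j) = (\<Sum>k<n. L $$ (i, k) * ?b k j)"
      using ij by (simp add: L_def B_def scalar_prod_def atLeast0LessThan)
    also have "\<dots> = (\<Sum>k\<in>insert i {..<i}. L $$ (i, k) * ?b k j)"
      using ij by (intro sum.mono_neutral_right) (auto simp: L_def)
    also have "\<dots> = ?b i j + (\<Sum>k<i. cip n (a i) (?b k) / cip n (?b k) (?b k) * ?b k j)"
      using ij by (subst sum.insert) (auto simp: L_def intro!: sum.cong)
    also have "\<dots> = a i j" by (subst gs.simps) simp
    finally show "(L * B) $$ (i, j) = A $$ (i, j)" using ij by (simp add: A_def)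
  qed (auto simp: A_def L_def B_def)
  moreover have "det L = 1"
  proof -
    have "det L = prod_list (diag_mat L)"
      by (rule det_lower_triangular[OF _ car(4)]) (auto simp: L_def)
    also have "\<dots> = 1" by (subst prod_list_diag_mat[OF car(4)]) (auto simp: L_def)
    finally show ?thesis .
  qed
  ultimately have detA: "det A = det B" using det_mult[OF car(4,2)] by simp
  have "B * B' = G"
    by (rule eq_matI) (auto simp: B_def B'_def G_def cip_def scalar_prod_def atLeast0LessThan)
  then have "det B * det B' = det G" using det_mult[OF car(2,3)] by simp
  moreover have "det B' = cnj (det B)"
  proof -
    interpret cnj: comm_ring_hom cnj by (rule comm_ring_hom_cnj)
    have "B' = transpose_mat (map_mat cnj B)" by (rule eq_matI) (auto simp: B_def B'_def)
    then have "det B' = det (map_mat cnj B)" using car(2) by (simp add: det_transpose)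
    then show ?thesis using cnj.hom_det by simp
  qed
  moreover have "det G = (\<Prod>i<n. cip n (?b i) (?b i))"
  proof -
    have "det G = prod_list (diag_mat G)"
    proof (rule det_lower_triangular[OF _ car(5)])
      fix i j assume "i < j" "j < n"
      then show "G $$ (i, j) = 0"
        using gs_orthogonal[of i j n a] cip_commute[of n "?b i" "?b j"] by (simp add: G_def)
    qed
    also have "\<dots> = (\<Prod>i<n. cip n (?b i) (?b i))"
      by (subst prod_list_diag_mat[OF car(5)]) (auto simp: G_def)
    finally show ?thesis .
  qed
  ultimately have "complex_of_real ((cmod (det B))\<^sup>2) = of_real (\<Prod>i<n. \<Sum>j<n. (cmod (?b i j))\<^sup>2)"
    by (simp only: complex_norm_square cip_self of_real_prod)
  then have "(cmod (det B))\<^sup>2 = (\<Prod>i<n. \<Sum>j<n. (cmod (?b i j))\<^sup>2)" by (simp only: of_real_eq_iff)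
  also have "\<dots> \<le> (\<Prod>i<n. \<Sum>j<n. (cmod (a i j))\<^sup>2)"
    by (intro prod_mono conjI gs_norm_le sum_nonneg) auto
  finally show ?thesis using detA by (simp add: A_def)
qed

section \<open>The discriminant of an algebraic integer\<close>

abbreviation cpoly :: "int poly \<Rightarrow> complex poly" where "cpoly \<equiv> map_poly of_int"

lemma cpoly_arith:
  "cpoly (f + g) = cpoly f + cpoly g" "cpoly (f - g) = cpoly f - cpoly g" "cpoly (f * g) = cpoly f * cpoly g"
  "cpoly (smult c f) = smult (of_int c) (cpoly f)" "cpoly (pderiv f) = pderiv (cpoly f)"
  by (rule poly_eqI, simp add: coeff_map_poly coeff_mult coeff_pderiv; fail)+

lemma cpoly_eq_0_iff: "cpoly f = 0 \<longleftrightarrow> f = 0"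
  by (auto simp: poly_eq_iff coeff_map_poly)

lemma degree_cpoly: "degree (cpoly f) = degree f"
  by (rule antisym; rule degree_le) (auto simp: coeff_map_poly coeff_eq_0 dest: coeff_eq_0[of "cpoly f"])

definition is_min_int_poly :: "complex \<Rightarrow> int poly \<Rightarrow> bool" where
  "is_min_int_poly \<alpha> f \<longleftrightarrow> Polynomial.content f = 1 \<and> lead_coeff f > 0 \<and> poly (cpoly f) \<alpha> = 0 \<and>
     (\<forall>g. g \<noteq> 0 \<and> poly (cpoly g) \<alpha> = 0 \<longrightarrow> degree f \<le> degree g)"

text \<open>Scaling each by the leading coefficient of the other makes the difference
  \<open>h\<close> drop in degree, so minimality kills it; comparing contents then identifies the
  positive leading coefficients.\<close>

lemma is_min_int_poly_unique:
  assumes "is_min_int_poly \<alpha> f" "is_min_int_poly \<alpha> g" shows "f = g"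
proof -
  let ?lf = "lead_coeff f" and ?lg = "lead_coeff g"
  have pos: "?lf > 0" "?lg > 0" using assms by (auto simp: is_min_int_poly_def)
  have deg: "degree f = degree g"
  proof -
    have "f \<noteq> 0" "g \<noteq> 0" using pos by auto
    then show ?thesis using assms by (intro antisym) (auto simp: is_min_int_poly_def)
  qed
  define h where "h = smult ?lg f - smult ?lf g"
  have root: "poly (cpoly h) \<alpha> = 0" using assms by (simp add: h_def cpoly_arith is_min_int_poly_def)
  have "h = 0"
  proof (rule ccontr)
    assume "h \<noteq> 0"
    then have le: "degree f \<le> degree h"
      using assms(1) root by (auto simp: is_min_int_poly_def)
    moreover have "degree h \<le> degree f"
      unfolding h_def by (rule degree_diff_le) (auto simp: deg)
    ultimately have "lead_coeff h = 0" using deg by (simp add: h_def)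
    then show False using \<open>h \<noteq> 0\<close> by simp
  qed
  then have eq: "smult ?lg f = smult ?lf g" by (simp add: h_def)
  then have "Polynomial.content (smult ?lg f) = Polynomial.content (smult ?lf g)" by simp
  then have "?lg = ?lf" using assms pos by (simp add: is_min_int_poly_def)
  then show "f = g" using eq pos by (metis less_irrefl smult_cancel)
qed

text \<open>Existence for the definite description: an annihilating polynomial of least degree is
  made primitive and given a positive leading coefficient. All algebraic numbers are covered, as
  \<open>is_min_int_poly_rsquarefree\<close> applies this to an arbitrary root.\<close>

lemma is_min_int_poly_min_int_poly:
  assumes "P \<noteq> 0" "poly (cpoly P) \<alpha> = 0"
  shows "is_min_int_poly \<alpha> (min_int_poly \<alpha>)"
proof -
  define A where "A g \<longleftrightarrow> g \<noteq> 0 \<and> poly (cpoly g) \<alpha> = 0" for g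
  obtain g where g: "A g" "\<And>h. A h \<Longrightarrow> degree g \<le> degree h"
    using ex_has_least_nat[of A P degree] assms by (auto simp: A_def)
  define f where "f = smult (sgn (lead_coeff g)) (primitive_part g)"
  have c: "Polynomial.content g > 0"
    using g(1) by (metis A_def content_eq_zero_iff normalize_content normalize_int_def abs_ge_zero order_le_imp_less_or_eq)
  have gp: "g = smult (Polynomial.content g) (primitive_part g)" by simp
  have s: "sgn (lead_coeff g) \<noteq> 0" using g(1) by (auto simp: A_def sgn_0_0)
  have lc: "lead_coeff g = Polynomial.content g * lead_coeff (primitive_part g)"
    by (metis gp lead_coeff_smult)
  have "is_min_int_poly \<alpha> f" unfolding is_min_int_poly_def
  proof (intro conjI allI impI)
    show "Polynomial.content f = 1"
      using g(1) s by (simp add: f_def A_def)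
    have "lead_coeff f = sgn (lead_coeff g) * lead_coeff (primitive_part g)"
      unfolding f_def by (rule lead_coeff_smult)
    also have "\<dots> > 0" using c s unfolding lc sgn_mult by (simp add: sgn_if split: if_splits)
    finally show "lead_coeff f > 0" .
    have "poly (cpoly (smult (Polynomial.content g) (primitive_part g))) \<alpha> = 0"
      using g(1) by (simp add: A_def)
    then have "poly (cpoly (primitive_part g)) \<alpha> = 0"
      using c g(1) unfolding cpoly_arith A_def by simp
    then show "poly (cpoly f) \<alpha> = 0" by (simp add: f_def cpoly_arith)
  next
    fix h assume "h \<noteq> 0 \<and> poly (cpoly h) \<alpha> = 0"
    then have "degree g \<le> degree h" using g(2) by (auto simp: A_def)
    moreover have "degree f = degree g"
      using s by (simp add: f_def)
    ultimately show "degree f \<le> degree h" by simp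
  qed
  then show ?thesis
    using is_min_int_poly_unique theI[of "is_min_int_poly \<alpha>" f]
    unfolding min_int_poly_def is_min_int_poly_def[symmetric] by blast
qed

text \<open>Pseudo-division stays over the integers at the price of the constant \<open>c\<close>; a
  nonzero remainder would have root \<open>\<alpha>\<close> and too small a degree.\<close>

lemma is_min_int_poly_divides:
  assumes f: "is_min_int_poly \<alpha> f" and h: "poly (cpoly h) \<alpha> = 0"
  obtains c q where "c \<noteq> 0" "smult c h = f * q"
proof -
  have f0: "f \<noteq> 0" using f by (auto simp: is_min_int_poly_def)
  define r where "r = pseudo_mod h f"
  obtain c q where cq: "c \<noteq> 0" "smult c h = f * q + r"
    using pseudo_mod(1)[OF f0, of h] unfolding r_def by blast
  have "cpoly r = smult (of_int c) (cpoly h) - cpoly f * cpoly q"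
    using arg_cong[OF cq(2), of cpoly] by (simp add: cpoly_arith)
  then have "poly (cpoly r) \<alpha> = 0" using f h by (simp add: is_min_int_poly_def)
  then have "r = 0"
    using f pseudo_mod(2)[OF f0, of h] unfolding r_def[symmetric] is_min_int_poly_def by fastforce
  then show ?thesis using that cq by simp
qed

lemma is_min_int_poly_degree_pos:
  assumes "is_min_int_poly \<alpha> f" shows "degree f > 0"
proof (rule ccontr)
  assume "\<not> degree f > 0"
  then obtain c where c: "f = [:c:]" using degree_eq_zeroE by blast
  have "poly (cpoly f) \<alpha> = of_int c" unfolding c by (simp add: map_poly_pCons)
  moreover have "c > 0" using assms c by (simp add: is_min_int_poly_def)
  ultimately show False using assms by (simp add: is_min_int_poly_def)
qed

text \<open>At a double root \<open>z\<close>, the minimal polynomial \<open>g\<close> of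
  \<open>z\<close> divides \<open>f\<close> and its derivative up to constants. Minimality of
  \<open>f\<close> for \<open>\<alpha>\<close> forces \<open>g\<close> to have at least the degree
  of \<open>f\<close>, too large for a divisor of the derivative.\<close>

lemma is_min_int_poly_rsquarefree:
  assumes f: "is_min_int_poly \<alpha> f" shows "rsquarefree (cpoly f)"
  unfolding rsquarefree_roots
proof (intro allI notI)
  fix z assume z: "poly (cpoly f) z = 0 \<and> poly (pderiv (cpoly f)) z = 0"
  have f0: "f \<noteq> 0" using f by (auto simp: is_min_int_poly_def)
  define g where "g = min_int_poly z"
  have g: "is_min_int_poly z g" unfolding g_def using is_min_int_poly_min_int_poly[OF f0] z by simp
  have g0: "g \<noteq> 0" using g by (auto simp: is_min_int_poly_def)
  obtain c q where cq: "c \<noteq> 0" "smult c f = g * q"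
    using is_min_int_poly_divides[OF g] z by metis
  have q0: "q \<noteq> 0" using cq f0 by auto
  have "degree f = degree g + degree q"
    using arg_cong[OF cq(2), of degree] cq(1) g0 q0 by (simp add: degree_mult_eq)
  \<comment> \<open>\<open>q\<close> has smaller degree than \<open>f\<close>, so
    \<open>\<alpha>\<close> must be a root of the other factor \<open>g\<close>.\<close>
  then have "poly (cpoly q) \<alpha> \<noteq> 0"
    using f q0 is_min_int_poly_degree_pos[OF g] by (fastforce simp: is_min_int_poly_def)
  moreover have "poly (cpoly g) \<alpha> * poly (cpoly q) \<alpha> = 0"
    using arg_cong[OF cq(2), of "\<lambda>f. poly (cpoly f) \<alpha>"] f by (simp add: cpoly_arith is_min_int_poly_def)
  ultimately have "poly (cpoly g) \<alpha> = 0" by simp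
  then have le: "degree f \<le> degree g" using f g0 by (simp add: is_min_int_poly_def)
  have "poly (cpoly (pderiv f)) z = 0" using z by (simp add: cpoly_arith)
  then obtain c' q' where cq': "c' \<noteq> 0" "smult c' (pderiv f) = g * q'"
    using is_min_int_poly_divides[OF g] by metis
  have d: "degree (pderiv f) = degree f - 1" by (rule degree_pderiv)
  have "pderiv f \<noteq> 0" using is_min_int_poly_degree_pos[OF f] by (simp add: pderiv_eq_0_iff)
  then have "q' \<noteq> 0" using cq' by auto
  then have "degree (pderiv f) = degree g + degree q'"
    using arg_cong[OF cq'(2), of degree] cq'(1) g0 by (simp add: degree_mult_eq)
  then show False using d le is_min_int_poly_degree_pos[OF f] by simp
qed

text \<open>A monic annihilating polynomial is primitive. By multiplicativity of contents the
  cofactor \<open>q\<close> has content |c|, so \<open>c\<close> cancels among the leading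
  coefficients and that of \<open>f\<close> divides 1.\<close>

lemma is_min_int_poly_monic:
  assumes f: "is_min_int_poly \<alpha> f" and "algebraic_int \<alpha>" shows "lead_coeff f = 1"
proof -
  obtain P where P: "poly (cpoly P) \<alpha> = 0" "lead_coeff P = 1"
    using assms(2) algebraic_int_altdef_ipoly by blast
  obtain c q where cq: "c \<noteq> 0" "smult c P = f * q"
    using is_min_int_poly_divides[OF f P(1)] by metis
  have "Polynomial.content P dvd lead_coeff P" by (rule content_dvd_coeff)
  then have "is_unit (Polynomial.content P)" using P(2) by simp
  then have "Polynomial.content P = 1" by (metis is_unit_normalize normalize_content)
  then have "Polynomial.content q = \<bar>c\<bar>"
    using arg_cong[OF cq(2), of Polynomial.content] f by (simp add: content_mult is_min_int_poly_def)
  then have "c dvd lead_coeff q" by (metis abs_dvd_iff content_dvd_coeff)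
  then obtain e where e: "lead_coeff q = c * e" by blast
  have "c * 1 = c * (e * lead_coeff f)"
    using arg_cong[OF cq(2), of lead_coeff] P(2) e
    unfolding lead_coeff_smult lead_coeff_mult by (simp add: mult_ac)
  then have "e * lead_coeff f = 1" using cq(1) by simp
  then have "lead_coeff f dvd 1" by (metis dvd_triv_right)
  then show ?thesis using f by (simp add: is_min_int_poly_def)
qed

lemma conjugates_algebraic_int:
  assumes "algebraic_int \<alpha>"
  shows "finite (conjugates \<alpha>)" "card (conjugates \<alpha>) = alg_degree \<alpha>" "alg_degree \<alpha> > 0"
    "lead_coeff (min_int_poly \<alpha>) = 1"
    "(\<Prod>z\<in>conjugates \<alpha>. [:- z, 1:]) = cpoly (min_int_poly \<alpha>)"
    "z \<in> conjugates \<alpha> \<Longrightarrow> algebraic_int z"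
proof -
  obtain P where P: "poly (cpoly P) \<alpha> = 0" "lead_coeff P = 1"
    using assms algebraic_int_altdef_ipoly by blast
  define f where "f = min_int_poly \<alpha>"
  have f: "is_min_int_poly \<alpha> f"
    unfolding f_def using P by (intro is_min_int_poly_min_int_poly[of P]) auto
  show lc: "lead_coeff (min_int_poly \<alpha>) = 1"
    using is_min_int_poly_monic[OF f assms] by (simp add: f_def)
  show "alg_degree \<alpha> > 0" using is_min_int_poly_degree_pos[OF f] by (simp add: alg_degree_def f_def)
  have f0: "f \<noteq> 0" using f by (auto simp: is_min_int_poly_def)
  show "finite (conjugates \<alpha>)"
    unfolding conjugates_def f_def[symmetric] using f0 by (intro poly_roots_finite) (simp add: cpoly_eq_0_iff)
  have "lead_coeff (cpoly f) = 1" using lc by (simp add: degree_cpoly coeff_map_poly f_def)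
  then show prod: "(\<Prod>z\<in>conjugates \<alpha>. [:- z, 1:]) = cpoly (min_int_poly \<alpha>)"
    using complex_poly_decompose_rsquarefree[OF is_min_int_poly_rsquarefree[OF f]]
    by (simp add: conjugates_def f_def)
  have "degree (\<Prod>z\<in>conjugates \<alpha>. [:- z, 1:]) = card (conjugates \<alpha>)"
    by (subst degree_prod_eq_sum_degree) auto
  then show "card (conjugates \<alpha>) = alg_degree \<alpha>"
    unfolding prod by (simp add: degree_cpoly alg_degree_def)
  show "z \<in> conjugates \<alpha> \<Longrightarrow> algebraic_int z"
    using lc unfolding algebraic_int_altdef_ipoly conjugates_def by blast
qed

text \<open>Horner's scheme for division by X - z, run downwards from an index \<open>m\<close> at
  which the quotient has coefficient 0.\<close>

lemma coeff_linear_quotient: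
  fixes F G :: "'a::comm_ring_1 poly"
  assumes "F = [:- z, 1:] * G" "coeff G m = 0"
  shows "t \<le> m \<Longrightarrow> coeff G (m - t) = (\<Sum>i<t. coeff F (m - t + 1 + i) * z ^ i)"
proof (induction t)
  case (Suc t)
  have step: "coeff F (Suc j) = coeff G j - z * coeff G (Suc j)" for j
    unfolding assms(1) by simp
  define l where "l = m - Suc t"
  have l: "m - t = Suc l" using Suc by (simp add: l_def)
  have "coeff G l = coeff F (Suc l) + z * coeff G (Suc l)" using step[of l] by simp
  also have "coeff G (Suc l) = (\<Sum>i<t. coeff F (Suc l + 1 + i) * z ^ i)"
    using Suc l by simp
  also have "coeff F (Suc l) + z * \<dots> = (\<Sum>i<Suc t. coeff F (l + 1 + i) * z ^ i)"
    unfolding sum.lessThan_Suc_shift sum_distrib_left by (simp add: mult_ac)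
  finally show ?case by (simp add: l_def)
qed (simp add: assms)

text \<open>Newton's identities, read off from \<open>F' = \<Sum>\<^sub>z F / (X - z)\<close>.\<close>

lemma power_sums_integral:
  assumes C: "finite C" and F: "(\<Prod>z\<in>C. [:- z, 1:]) = cpoly f"
  shows "(\<Sum>z\<in>C. z ^ k) \<in> \<int>"
proof (induction k rule: less_induct)
  case (less k)
  define d where "d = card C"
  define F where "F = cpoly f"
  define a where "a i = coeff F i" for i
  define s where "s i = (\<Sum>z\<in>C. z ^ i)" for i
  have aZ: "a i \<in> \<int>" for i by (simp add: a_def F_def coeff_map_poly)
  have Fp: "F = (\<Prod>z\<in>C. [:- z, 1:])" using F by (simp add: F_def)
  have deg: "degree F = d" unfolding Fp d_def by (subst degree_prod_eq_sum_degree) auto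
  have "lead_coeff F = 1" unfolding Fp lead_coeff_prod by simp
  then have ad: "a d = 1" by (simp add: a_def deg)
  have IH: "s i \<in> \<int>" if "i < k" for i using less that by (simp add: s_def)
  show ?case
  proof (cases "k < d")
    case True
    define G where "G z = (\<Prod>w\<in>C - {z}. [:- w, 1:])" for z
    have G: "F = [:- z, 1:] * G z" "coeff (G z) d = 0" if z: "z \<in> C" for z
    proof -
      show "F = [:- z, 1:] * G z" unfolding Fp G_def by (rule prod.remove[OF C z])
      have "degree (G z) = card (C - {z})" unfolding G_def by (subst degree_prod_eq_sum_degree) auto
      also have "\<dots> < d" using card_Diff1_less[OF C z] by (simp add: d_def)
      finally show "coeff (G z) d = 0" by (rule coeff_eq_0)
    qed
    \<comment> \<open>The coefficients of X^(d - 1 - k) are compared. The \<open>k\<close>-th power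
      sum occurs with the leading coefficient 1 as factor, all other power sums have smaller
      index.\<close>
    define j where "j = d - Suc k"
    have j: "d - Suc k = j" "j + Suc k = d" using True by (auto simp: j_def)
    have "of_nat (Suc j) * a (Suc j) = coeff (pderiv F) j"
      by (simp add: coeff_pderiv a_def)
    also have "pderiv F = (\<Sum>z\<in>C. G z)"
      unfolding Fp pderiv_prod G_def by (intro sum.cong) (auto simp: pderiv_pCons)
    also have "coeff (\<Sum>z\<in>C. G z) j = (\<Sum>z\<in>C. \<Sum>i<Suc k. a (j + 1 + i) * z ^ i)"
      using coeff_linear_quotient[OF G, of _ "Suc k"] True unfolding coeff_sum a_def j(1)
      by (intro sum.cong) auto
    also have "\<dots> = (\<Sum>i<Suc k. a (j + 1 + i) * s i)"
      unfolding s_def sum_distrib_left by (rule sum.swap)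
    also have "\<dots> = (\<Sum>i<k. a (j + 1 + i) * s i) + s k"
      using ad j by simp
    finally have "s k = of_nat (Suc j) * a (Suc j) - (\<Sum>i<k. a (j + 1 + i) * s i)" by simp
    also have "\<dots> \<in> \<int>"
      by (intro Ints_diff Ints_mult aZ Ints_sum IH) auto
    finally show ?thesis by (simp add: s_def)
  next
    case False
    \<comment> \<open>From index d on, F(z) = 0 times z^(k - d), summed over the roots, expresses
      the power sum by earlier ones.\<close>
    have "(\<Sum>i\<le>d. a i * z ^ (k - d + i)) = 0" if z: "z \<in> C" for z
    proof -
      have "poly F z = 0" unfolding Fp poly_prod using C z by auto
      then have "z ^ (k - d) * (\<Sum>i\<le>d. a i * z ^ i) = 0" by (simp add: poly_altdef deg a_def)
      then show ?thesis by (simp add: sum_distrib_left power_add mult_ac)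
    qed
    then have "0 = (\<Sum>z\<in>C. \<Sum>i\<le>d. a i * z ^ (k - d + i))" by simp
    also have "\<dots> = (\<Sum>i\<le>d. a i * s (k - d + i))"
      unfolding s_def sum_distrib_left by (rule sum.swap)
    also have "\<dots> = (\<Sum>i<d. a i * s (k - d + i)) + s k"
      using ad False by (simp flip: lessThan_Suc_atMost)
    finally have "s k = - (\<Sum>i<d. a i * s (k - d + i))" by (simp add: eq_neg_iff_add_eq_0 add.commute)
    also have "\<dots> \<in> \<int>"
      using False by (intro Ints_minus Ints_sum Ints_mult aZ IH) auto
    finally show ?thesis by (simp add: s_def)
  qed
qed

text \<open>For the Vandermonde matrix \<open>V\<close> of the roots, V^T V has power sums as
  entries, so (det V)^2 is an integer; up to sign it is the product over ordered pairs. Hadamard's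
  inequality for the rows of \<open>V\<close> gives the bound.\<close>

lemma discriminant_integral_bound:
  assumes C: "finite C" and F: "(\<Prod>z\<in>C. [:- z, 1:]) = cpoly f"
  obtains D :: int where "D \<noteq> 0" "of_int D = (\<Prod>z\<in>C. \<Prod>w\<in>C - {z}. z - w)"
    "real_of_int \<bar>D\<bar> \<le> (\<Prod>z\<in>C. real (card C) * max 1 (cmod z) ^ (2 * card C))"
proof -
  define n where "n = card C"
  obtain z where z: "bij_betw z {0..<n} C"
    using ex_bij_betw_nat_finite[OF C] unfolding n_def by blast
  then have z: "bij_betw z {..<n} C" by (simp add: atLeast0LessThan)
  have inj: "inj_on z {..<n}" using z by (simp add: bij_betw_def)
  define V where "V = mat n n (\<lambda>(i, j). z i ^ j)"
  have V: "V \<in> carrier_mat n n" by (simp add: V_def)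
  have detV: "det V = (\<Prod>i<n. \<Prod>k<i. z i - z k)" unfolding V_def by (rule det_Vandermonde)
  have "\<forall>k. \<exists>m. (\<Sum>x\<in>C. x ^ k) = of_int m"
    using power_sums_integral[OF assms] unfolding Ints_def by blast
  from choice[OF this] obtain s where s: "\<And>k. (\<Sum>x\<in>C. x ^ k) = of_int (s k)" by blast
  define S where "S = mat n n (\<lambda>(i, j). s (i + j))"
  have "transpose_mat V * V = map_mat of_int S"
  proof (rule eq_matI)
    fix i j assume "i < dim_row (map_mat of_int S)" "j < dim_col (map_mat of_int S)"
    then have ij: "i < n" "j < n" by (auto simp: S_def)
    have "(transpose_mat V * V) $$ (i, j) = (\<Sum>k<n. z k ^ (i + j))"
      using ij by (simp add: V_def scalar_prod_def atLeast0LessThan power_add)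
    also have "\<dots> = (\<Sum>x\<in>C. x ^ (i + j))" by (rule sum.reindex_bij_betw[OF z])
    finally show "(transpose_mat V * V) $$ (i, j) = map_mat of_int S $$ (i, j)"
      using ij s by (simp add: S_def)
  qed (auto simp: V_def S_def)
  then have "det (transpose_mat V * V) = of_int (det S)" by (simp add: of_int_hom.hom_det)
  then have detS: "of_int (det S) = (det V)\<^sup>2"
    using det_mult[of "transpose_mat V" n V] V by (simp add: det_transpose power2_eq_square)
  \<comment> \<open>This is n (n - 1) / 2, the number of factors whose sign changes when the pairs
    with k > i are turned round.\<close>
  define N where "N = (\<Sum>i<n. card {..<i})"
  have inner: "(\<Prod>w\<in>C - {z i}. z i - w) = (\<Prod>k\<in>{..<n} - {i}. z i - z k)" if i: "i < n" for i
  proof -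
    have "bij_betw z ({..<n} - {i}) (C - {z i})"
      using z i inj by (auto simp: bij_betw_def inj_on_def)
    from prod.reindex_bij_betw[OF this, of "\<lambda>w. z i - w"] show ?thesis by simp
  qed
  have "(\<Prod>x\<in>C. \<Prod>w\<in>C - {x}. x - w) = (\<Prod>i<n. \<Prod>w\<in>C - {z i}. z i - w)"
    by (rule prod.reindex_bij_betw[OF z, symmetric])
  also have "\<dots> = (\<Prod>i<n. \<Prod>k\<in>{..<n} - {i}. z i - z k)"
    by (intro prod.cong) (auto simp: inner)
  also have "\<dots> = (\<Prod>i<n. (\<Prod>k<i. z i - z k) * (\<Prod>k\<in>{Suc i..<n}. z i - z k))"
  proof (intro prod.cong refl)
    fix i assume "i \<in> {..<n}"
    then have eq: "{..<n} - {i} = {..<i} \<union> {Suc i..<n}" by auto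
    show "(\<Prod>k\<in>{..<n} - {i}. z i - z k) = (\<Prod>k<i. z i - z k) * (\<Prod>k\<in>{Suc i..<n}. z i - z k)"
      unfolding eq by (rule prod.union_disjoint) auto
  qed
  also have "\<dots> = det V * (\<Prod>i<n. \<Prod>k\<in>{Suc i..<n}. z i - z k)"
    by (simp add: prod.distrib detV)
  also have "(\<Prod>i<n. \<Prod>k\<in>{Suc i..<n}. z i - z k) = (\<Prod>(i, k)\<in>Sigma {..<n} (\<lambda>i. {Suc i..<n}). z i - z k)"
    by (rule prod.Sigma) auto
  also have "\<dots> = (\<Prod>(k, i)\<in>Sigma {..<n} (\<lambda>k. {..<k}). z i - z k)"
    by (rule prod.reindex_bij_witness[of _ "\<lambda>(k, i). (i, k)" "\<lambda>(i, k). (k, i)"]) auto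
  also have "\<dots> = (\<Prod>k<n. \<Prod>i<k. z i - z k)"
    by (rule prod.Sigma[symmetric]) auto
  also have "\<dots> = (\<Prod>k<n. \<Prod>i<k. (- 1) * (z k - z i))" by simp
  also have "\<dots> = (- 1) ^ N * det V"
    unfolding prod.distrib prod_constant detV N_def by (simp add: power_sum)
  finally have prodD: "(\<Prod>x\<in>C. \<Prod>w\<in>C - {x}. x - w) = (- 1) ^ N * (det V)\<^sup>2"
    by (simp add: power2_eq_square mult_ac)
  define D where "D = (- 1) ^ N * det S"
  have D: "of_int D = (\<Prod>x\<in>C. \<Prod>w\<in>C - {x}. x - w)" unfolding prodD by (simp add: D_def detS)
  have "(\<Prod>x\<in>C. \<Prod>w\<in>C - {x}. x - w) \<noteq> 0" using C by auto
  then have "D \<noteq> 0" using D by auto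
  moreover have "real_of_int \<bar>D\<bar> \<le> (\<Prod>x\<in>C. real (card C) * max 1 (cmod x) ^ (2 * card C))"
  proof -
    have "real_of_int \<bar>D\<bar> = cmod (of_int D)" by simp
    also have "\<dots> = (cmod (det V))\<^sup>2" unfolding D prodD by (simp add: norm_mult norm_power)
    also have "\<dots> \<le> (\<Prod>i<n. \<Sum>j<n. (cmod (z i ^ j))\<^sup>2)"
      unfolding V_def by (rule Hadamard_inequality)
    \<comment> \<open>The exponents 2 j with j < n are rounded up to 2 n; the \<open>n\<close>
      entries of a row give the factor \<open>n\<close>, the source of the term with ln d.\<close>
    also have "\<dots> \<le> (\<Prod>i<n. real n * max 1 (cmod (z i)) ^ (2 * n))"
    proof (intro prod_mono conjI sum_nonneg)
      fix i
      have "(cmod (z i ^ j))\<^sup>2 \<le> max 1 (cmod (z i)) ^ (2 * n)" if "j < n" for j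
      proof -
        have "(cmod (z i ^ j))\<^sup>2 = cmod (z i) ^ (2 * j)" by (simp add: norm_power mult.commute flip: power_mult)
        also have "\<dots> \<le> max 1 (cmod (z i)) ^ (2 * j)" by (intro power_mono) auto
        also have "\<dots> \<le> max 1 (cmod (z i)) ^ (2 * n)" using that by (intro power_increasing) auto
        finally show ?thesis .
      qed
      then have "(\<Sum>j<n. (cmod (z i ^ j))\<^sup>2) \<le> (\<Sum>j<n. max 1 (cmod (z i)) ^ (2 * n))"
        by (intro sum_mono) auto
      then show "(\<Sum>j<n. (cmod (z i ^ j))\<^sup>2) \<le> real n * max 1 (cmod (z i)) ^ (2 * n)" by simp
    qed auto
    also have "\<dots> = (\<Prod>x\<in>C. real (card C) * max 1 (cmod x) ^ (2 * card C))"
      using prod.reindex_bij_betw[OF z, of "\<lambda>x. real n * max 1 (cmod x) ^ (2 * n)"] by (simp add: n_def)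
    finally show ?thesis .
  qed
  ultimately show ?thesis using that D by blast
qed

lemma ln_as_sum_multiplicities:
  fixes D :: int
  assumes "D \<noteq> 0"
  shows "ln (real_of_int \<bar>D\<bar>) =
    (\<Sum>p\<in>prime_factors (nat \<bar>D\<bar>). real (multiplicity (int p) D) * ln (real p))"
proof -
  define n where "n = nat \<bar>D\<bar>"
  have n: "n > 0" "int n = \<bar>D\<bar>" using assms by (auto simp: n_def)
  have mult: "multiplicity p n = multiplicity (int p) D" if "p \<in> prime_factors n" for p
  proof -
    have p: "prime p" using that by (simp add: in_prime_factors_iff)
    have "int p ^ multiplicity p n dvd D"
      using multiplicity_dvd[of p n] n(2) by (metis dvd_abs_iff int_dvd_int_iff of_nat_power)
    moreover have "\<not> int p ^ Suc (multiplicity p n) dvd D"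
    proof
      assume "int p ^ Suc (multiplicity p n) dvd D"
      then have "int (p ^ Suc (multiplicity p n)) dvd int n" unfolding n(2) by simp
      then have "p ^ Suc (multiplicity p n) dvd n" by (simp only: int_dvd_int_iff)
      then have "Suc (multiplicity p n) \<le> multiplicity p n"
        using p n(1) by (intro multiplicity_geI) (auto simp: prime_gt_1_nat)
      then show False by simp
    qed
    ultimately show ?thesis by (intro multiplicity_eqI[symmetric])
  qed
  have "ln (real_of_int \<bar>D\<bar>) = ln (real n)" unfolding n(2)[symmetric] by simp
  also have "real n = (\<Prod>p\<in>prime_factors n. real p ^ multiplicity p n)"
    using arg_cong[OF prime_factorization_nat[OF n(1)], of real] by simp
  also have "ln \<dots> = (\<Sum>p\<in>prime_factors n. ln (real p ^ multiplicity p n))"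
    by (rule ln_prod) (auto simp: in_prime_factors_iff prime_gt_0_nat)
  also have "\<dots> = (\<Sum>p\<in>prime_factors n. real (multiplicity (int p) D) * ln (real p))"
    by (intro sum.cong refl) (auto simp: mult ln_realpow in_prime_factors_iff prime_gt_0_nat)
  finally show ?thesis by (simp add: n_def)
qed

theorem theorem1p4:
  fixes \<alpha> :: complex and d :: nat and i :: "nat \<Rightarrow> complex \<Rightarrow> padic_closure"
  defines "t \<equiv> (\<lambda>p. max 0
             (1 / (\<Sum>K\<in>conj_fields p (i p) \<alpha>. real (ram_index p K) * real (residue_card p K))
              - 1 / (real d)\<^sup>2 * (\<Sum>K\<in>conj_fields p (i p) \<alpha>.
                    real (card (conj_in (i p) \<alpha> K)) / real (ram_index p K))) * ln (real p))"
  assumes embedding: "\<And>p. Factorial_Ring.prime p \<Longrightarrow> i p \<in> ring_hom Qbar (Qp_bar p)"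
    and "algebraic_int \<alpha>" and "\<alpha> \<noteq> 0" and "\<alpha> \<notin> roots_of_unity"
    and "d = alg_degree \<alpha>"
  shows "t summable_on {p. Factorial_Ring.prime p} \<and>
    weil_height \<alpha> \<ge> 1 / 2 * (\<Sum>\<^sub>\<infinity>p\<in>{p. Factorial_Ring.prime p}. t p) - ln (real d) / (2 * real d)"
proof -
  define C where "C = conjugates \<alpha>"
  note conj = conjugates_algebraic_int[OF \<open>algebraic_int \<alpha>\<close>]
  have C: "finite C" "card C = d" "d > 0" using conj(1-3) \<open>d = alg_degree \<alpha>\<close> by (auto simp: C_def)
  obtain D :: int where D: "D \<noteq> 0" "of_int D = (\<Prod>z\<in>C. \<Prod>w\<in>C - {z}. z - w)"
    "real_of_int \<bar>D\<bar> \<le> (\<Prod>z\<in>C. real (card C) * max 1 (cmod z) ^ (2 * card C))"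
    using discriminant_integral_bound[OF C(1)] conj(5) unfolding C_def by blast
  have bound: "t p \<le> real (multiplicity (int p) D) / (real d)\<^sup>2 * ln (real p)" "t p \<ge> 0"
    if p: "Factorial_Ring.prime p" for p
  proof -
    define A where "A = (\<Sum>K\<in>conj_fields p (i p) \<alpha>. real (ram_index p K) * real (residue_card p K))"
    define B where "B = (\<Sum>K\<in>conj_fields p (i p) \<alpha>. real (card (conj_in (i p) \<alpha> K)) / real (ram_index p K))"
    have "(real d)\<^sup>2 / A - B \<le> real (multiplicity (int p) D)"
      using local_bound_prime[OF p] embedding[OF p] C(1,2) D(1,2) conj(6)
      unfolding local_bound_def Let_def A_def B_def conj_fields_def conj_in_def C_def[symmetric] by blast
    then have "((real d)\<^sup>2 / A - B) / (real d)\<^sup>2 \<le> real (multiplicity (int p) D) / (real d)\<^sup>2"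
      by (rule divide_right_mono) simp
    then have "1 / A - 1 / (real d)\<^sup>2 * B \<le> real (multiplicity (int p) D) / (real d)\<^sup>2"
      using C(3) by (simp add: diff_divide_distrib)
    \<comment> \<open>Multiplicities are nonnegative, so the bound survives the maximum with
      0.\<close>
    then have le: "max 0 (1 / A - 1 / (real d)\<^sup>2 * B) \<le> real (multiplicity (int p) D) / (real d)\<^sup>2" by simp
    have ln: "ln (real p) \<ge> 0" using prime_ge_1_nat[OF p] by simp
    show "t p \<le> real (multiplicity (int p) D) / (real d)\<^sup>2 * ln (real p)"
      using mult_right_mono[OF le ln] unfolding t_def A_def B_def .
    show "t p \<ge> 0" unfolding t_def using ln by simp
  qed
  define P where "P = prime_factors (nat \<bar>D\<bar>)"
  have P: "finite P" "P \<subseteq> {p. Factorial_Ring.prime p}" by (auto simp: P_def)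
  \<comment> \<open>At primes not dividing \<open>D\<close> the upper bound is 0, so the infinite
    sum reduces to the finite set of prime factors of \<open>D\<close>.\<close>
  have zero: "t p = 0" if "p \<in> {p. Factorial_Ring.prime p} - P" for p
  proof -
    have p: "Factorial_Ring.prime p" "\<not> p dvd nat \<bar>D\<bar>"
      using that D(1) by (auto simp: P_def in_prime_factors_iff)
    then have "\<not> int p dvd D" by (metis dvd_abs_iff int_dvd_int_iff nat_0_le abs_ge_zero)
    then have "multiplicity (int p) D = 0" by (rule not_dvd_imp_multiplicity_0)
    then show ?thesis using bound[OF p(1)] by simp
  qed
  have "t summable_on P" using P(1) by simp
  then have summable: "t summable_on {p. Factorial_Ring.prime p}"
    using summable_on_cong_neutral[of "{p. Factorial_Ring.prime p}" P t t] zero P(2) by auto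
  have "(\<Sum>\<^sub>\<infinity>p\<in>{p. Factorial_Ring.prime p}. t p) = infsum t P"
    using zero P(2) by (intro infsum_cong_neutral) auto
  also have "\<dots> = sum t P" using P(1) by simp
  also have "\<dots> \<le> (\<Sum>p\<in>P. real (multiplicity (int p) D) / (real d)\<^sup>2 * ln (real p))"
    using P(2) by (intro sum_mono bound(1)) auto
  also have "\<dots> = ln (real_of_int \<bar>D\<bar>) / (real d)\<^sup>2"
    unfolding ln_as_sum_multiplicities[OF D(1)] P_def by (simp add: sum_divide_distrib)
  finally have sum_le: "(\<Sum>\<^sub>\<infinity>p\<in>{p. Factorial_Ring.prime p}. t p) \<le> ln (real_of_int \<bar>D\<bar>) / (real d)\<^sup>2" .
  \<comment> \<open>An algebraic integer has a monic minimal polynomial, so \<open>M\<close> is d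
    times the height.\<close>
  define M where "M = (\<Sum>z\<in>C. ln (max 1 (cmod z)))"
  have height: "weil_height \<alpha> = M / real d"
    unfolding weil_height_def M_def using conj(4) \<open>d = alg_degree \<alpha>\<close> C(1)
    by (simp add: ln_prod C_def)
  have "ln (real_of_int \<bar>D\<bar>) \<le> ln (\<Prod>z\<in>C. real (card C) * max 1 (cmod z) ^ (2 * card C))"
    using D(1,3) by (intro ln_mono) auto
  also have "\<dots> = (\<Sum>z\<in>C. ln (real d * max 1 (cmod z) ^ (2 * d)))"
    using C by (subst ln_prod) auto
  also have "\<dots> = (\<Sum>z\<in>C. ln (real d) + 2 * real d * ln (max 1 (cmod z)))"
    using C(3) by (intro sum.cong refl) (simp add: ln_mult ln_realpow)
  also have "\<dots> = real d * ln (real d) + 2 * real d * M"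
    by (simp add: sum.distrib C(2) M_def sum_distrib_left)
  finally have "ln (real_of_int \<bar>D\<bar>) / (real d)\<^sup>2 \<le> (real d * ln (real d) + 2 * real d * M) / (real d)\<^sup>2"
    by (rule divide_right_mono) simp
  also have "\<dots> = ln (real d) / real d + 2 * weil_height \<alpha>"
    unfolding height using C(3) by (simp add: field_simps power2_eq_square)
  finally have "(\<Sum>\<^sub>\<infinity>p\<in>{p. Factorial_Ring.prime p}. t p) \<le> ln (real d) / real d + 2 * weil_height \<alpha>"
    using sum_le by simp
  then have "weil_height \<alpha> \<ge> 1 / 2 * (\<Sum>\<^sub>\<infinity>p\<in>{p. Factorial_Ring.prime p}. t p) - ln (real d) / (2 * real d)"
    by (simp add: field_simps)
  with summable show ?thesis by blast
qed

end
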